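(* Let $(A,\rho,D,U)$ be an oriented quantum algebra over a commutative ring $k$. Then the assignment $F:\mathrm{Tang}\longrightarrow \mathrm{Cat}(A)$, which is the identity on objects, fixes cups and caps, and replaces each crossing of an oriented tangle diagram by a flat crossing decorated with $\rho$ (positive crossing) or $\rho^{-1}$ (negative crossing) as described in the context, is a well-defined functor: if $Q$ and $Q'$ are oriented tangle diagrams that are equivalent (regularly isotopic), then $F(Q)=F(Q')$ in $\mathrm{Cat}(A)$.
   Context: **Oriented quantum algebra.** Let $k$ be a commutative ring and $A$ an associative unital $k$-algebra. An oriented quantum algebra is a quadruple $(A,\rho,D,U)$ where $\rho=\sum e\otimes e'\in A\otimes A$ is invertible with inverse $\rho^{-1}=\sum E\otimes E'$ and satisfies the algebraic Yang-Baxter equation $\rho_{12}\rho_{13}\rho_{23}=\rho_{23}\rho_{13}\rho_{12}$ in $A^{\otimes 3}$ (where $\rho_{ij}$ has the factors of $\rho$ in positions $i,j$ and $1$ elsewhere), and $U,D:A\to A$ are commuting algebra automorphisms with $(U\otimes U)\rho=\rho$, $(D\otimes D)\rho=\rho$, and such that $(1_A\otimes U)\rho$ and $(D\otimes 1_{A^{op}})\rho^{-1}$ are mutually inverse (two-sided) in the algebra $A\otimes A^{op}$, $A^{op}$ being the opposite algebra. **The category Tang.** Objects are finite (possibly empty) lists of signs $\pm1$. Morphisms are oriented tangle diagrams in a planar box, with input strands at the bottom and output strands at the top (sign $+1$ = strand oriented upward, $-1$ = downward), in Morse position with respect to the vertical direction (critical points: local maxima = caps, local minima = cups, and crossings, at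 distinct heights), modulo equivalence = regular isotopy. Regular isotopy is generated by the following oriented moves for Morse diagrams, with all choices of orientation: cancellation of adjacent maximum and minimum; the second Reidemeister move (both with parallel and with opposite orientations); the third Reidemeister move; and the switchback moves passing a strand across a maximum or minimum (which express a crossing with one strand up and one strand down as a composite of a crossing with both strands up, or both strands down, with one cap and one cup). The first Reidemeister move is not allowed. Composition is vertical stacking, tensor product is juxtaposition. $\mathrm{Flat}$ is the category defined in the same way with crossings having no over/under information (flat crossings), the same moves being imposed without over/under stipulations. **The category $\mathrm{Cat}(A)$.** It has the same objects as $\mathrm{Flat}$. Morphisms are formal $k$-linear sums of flat tangles decorated on vertical segments by elements of $A$ ("beads"), decorations being multilinear. Relations: those of $\mathrm{Flat}$; beads slide freely along strands through flat crossings; beads met consecutively along an oriented strand multiply in order of appearance (first bead met = left factor), and an undecorated segment carries $1$; and the following sliding rules. Moving a bead $a$ counterclockwise across a cap (from its right leg to its left leg) or across a cup (from its left leg to its right leg) replaces $a$ by $U(a)$ if the cap is oriented clockwise or the cup is oriented counterclockwise, and replaces $a$ by $D(a)$ if the cap is oriented counterclockwise or the cup is oriented clockwise. Clockwise moves apply $U^{-1}$, $D^{-1}$ accordingly. **The assignment $F$.** A crossing with both strands up or both strands down is replaced by the flat crossing decorated as follows: for a positive crossing, $e$ is placed on the incoming part of the overcrossing strand and $e'$ on the incoming part of the undercrossing strand (summed over $\rho=\sum e\otimes e'$); for a negative crossing, $E$ is placed on the outgoing part of the overcrossing strand and $E'$ on the outgoing part of the undercrossing strand (summed over $\rho^{-1}=\sum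 E\otimes E'$). A crossing with one strand up and one strand down is first rewritten, by a switchback move, as a composite of a crossing of the previous type with a cap and a cup, and then decorated. Part of the claim is that this does not depend on which switchback rewriting is used. *)

theory Defs
  imports Main "HOL-Library.Poly_Mapping"
begin

section \<open>Formal linear combinations\<close>

text \<open>
  The free \<open>k\<close>-module on a type of basis elements is the type of finitely supported functions
  into \<open>k\<close>. The sort of the scalars is that of commutative unital rings in which
  \<open>0 = 1\<close> is not excluded (unlike \<^class>\<open>comm_ring_1\<close>).
\<close>

definition smul :: "'k \<Rightarrow> ('x \<Rightarrow>\<^sub>0 'k) \<Rightarrow> ('x \<Rightarrow>\<^sub>0 'k::{comm_ring,comm_monoid_mult})" where
  "smul c x = Poly_Mapping.map ((*) c) x"

abbreviation basis :: "'x \<Rightarrow> ('x \<Rightarrow>\<^sub>0 'k::{comm_ring,comm_monoid_mult})" where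
  "basis w \<equiv> Poly_Mapping.single w 1"

text \<open>The linear extension of a map defined on the basis.\<close>

definition lin_ext ::
    "('x \<Rightarrow> ('y \<Rightarrow>\<^sub>0 'k)) \<Rightarrow> ('x \<Rightarrow>\<^sub>0 'k) \<Rightarrow> ('y \<Rightarrow>\<^sub>0 'k::{comm_ring,comm_monoid_mult})" where
  "lin_ext f x = (\<Sum>w\<in>Poly_Mapping.keys x. smul (Poly_Mapping.lookup x w) (f w))"

inductive_set submodule_span ::
    "('x \<Rightarrow>\<^sub>0 'k::{comm_ring,comm_monoid_mult}) set \<Rightarrow> ('x \<Rightarrow>\<^sub>0 'k) set"
  for S where
    zero: "0 \<in> submodule_span S"
  | step: "\<lbrakk>x \<in> submodule_span S; g \<in> S\<rbrakk> \<Longrightarrow> x + smul c g \<in> submodule_span S"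

section \<open>Algebras and their tensor powers\<close>

definition is_algebra ::
    "('k::{comm_ring,comm_monoid_mult} \<Rightarrow> 'a::{ring,monoid_mult} \<Rightarrow> 'a) \<Rightarrow> bool" where
  "is_algebra scale \<longleftrightarrow>
     (\<forall>c x y. scale c (x + y) = scale c x + scale c y) \<and>
     (\<forall>c d x. scale (c + d) x = scale c x + scale d x) \<and>
     (\<forall>c d x. scale (c * d) x = scale c (scale d x)) \<and>
     (\<forall>x. scale 1 x = x) \<and>
     (\<forall>c x y. scale c (x * y) = scale c x * y) \<and>
     (\<forall>c x y. scale c (x * y) = x * scale c y)"

definition algebra_automorphism ::
    "('k::{comm_ring,comm_monoid_mult} \<Rightarrow> 'a::{ring,monoid_mult} \<Rightarrow> 'a) \<Rightarrow> ('a \<Rightarrow> 'a) \<Rightarrow> bool" where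
  "algebra_automorphism scale f \<longleftrightarrow> bij f \<and>
     (\<forall>x y. f (x + y) = f x + f y) \<and> (\<forall>c x. f (scale c x) = scale c (f x)) \<and>
     (\<forall>x y. f (x * y) = f x * f y) \<and> f 1 = 1"

text \<open>
  The \<open>n\<close>-th tensor power of \<open>A\<close> over \<open>k\<close> is the free module on the lists of
  length \<open>n\<close> over \<open>A\<close>, modulo multilinearity. A list \<open>[a\<^sub>1, \<dots>, a\<^sub>n]\<close> stands for
  the pure tensor; elements of the tensor power are handled through representatives, with
  \<open>tensor_eq\<close> as equality.
\<close>

definition tensors :: "nat \<Rightarrow> ('a list \<Rightarrow>\<^sub>0 'k::zero) set" where
  "tensors n = {x. \<forall>w\<in>Poly_Mapping.keys x. length w = n}"

definition multilinear_rels ::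
    "('k::{comm_ring,comm_monoid_mult} \<Rightarrow> 'a::{ring,monoid_mult} \<Rightarrow> 'a) \<Rightarrow> nat \<Rightarrow>
     ('a list \<Rightarrow>\<^sub>0 'k) set" where
  "multilinear_rels scale n =
     {basis (u @ [a + b] @ v) - basis (u @ [a] @ v) - basis (u @ [b] @ v) | u a b v.
        length u + 1 + length v = n} \<union>
     {basis (u @ [scale c a] @ v) - smul c (basis (u @ [a] @ v)) | u c a v.
        length u + 1 + length v = n}"

definition tensor_eq ::
    "('k::{comm_ring,comm_monoid_mult} \<Rightarrow> 'a::{ring,monoid_mult} \<Rightarrow> 'a) \<Rightarrow> nat \<Rightarrow>
     ('a list \<Rightarrow>\<^sub>0 'k) \<Rightarrow> ('a list \<Rightarrow>\<^sub>0 'k) \<Rightarrow> bool" where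
  "tensor_eq scale n x y \<longleftrightarrow> x \<in> tensors n \<and> y \<in> tensors n \<and>
     x - y \<in> submodule_span (multilinear_rels scale n)"

text \<open>The product of a tensor product of algebras, given the product \<open>ms ! i\<close> of each factor.\<close>

definition tensor_mult ::
    "('a \<Rightarrow> 'a \<Rightarrow> 'a) list \<Rightarrow> ('a list \<Rightarrow>\<^sub>0 'k) \<Rightarrow> ('a list \<Rightarrow>\<^sub>0 'k) \<Rightarrow>
     ('a list \<Rightarrow>\<^sub>0 'k::{comm_ring,comm_monoid_mult})" where
  "tensor_mult ms x y =
     lin_ext (\<lambda>u. lin_ext (\<lambda>v. basis (map2 (\<lambda>m (a, b). m a b) ms (zip u v))) y) x"

definition op_mult :: "'a::times \<Rightarrow> 'a \<Rightarrow> 'a" where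
  "op_mult a b = b * a"

definition tensor_map ::
    "('a \<Rightarrow> 'a) list \<Rightarrow> ('a list \<Rightarrow>\<^sub>0 'k) \<Rightarrow> ('a list \<Rightarrow>\<^sub>0 'k::{comm_ring,comm_monoid_mult})" where
  "tensor_map fs = lin_ext (\<lambda>w. basis (map2 (\<lambda>f a. f a) fs w))"

definition tensor12 :: "('a::one list \<Rightarrow>\<^sub>0 'k) \<Rightarrow> ('a list \<Rightarrow>\<^sub>0 'k::{comm_ring,comm_monoid_mult})" where
  "tensor12 = lin_ext (\<lambda>w. basis [w ! 0, w ! 1, 1])"

definition tensor13 :: "('a::one list \<Rightarrow>\<^sub>0 'k) \<Rightarrow> ('a list \<Rightarrow>\<^sub>0 'k::{comm_ring,comm_monoid_mult})" where
  "tensor13 = lin_ext (\<lambda>w. basis [w ! 0, 1, w ! 1])"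

definition tensor23 :: "('a::one list \<Rightarrow>\<^sub>0 'k) \<Rightarrow> ('a list \<Rightarrow>\<^sub>0 'k::{comm_ring,comm_monoid_mult})" where
  "tensor23 = lin_ext (\<lambda>w. basis [1, w ! 0, w ! 1])"

section \<open>Oriented quantum algebras\<close>

definition mutually_inverse ::
    "('k::{comm_ring,comm_monoid_mult} \<Rightarrow> 'a::{ring,monoid_mult} \<Rightarrow> 'a) \<Rightarrow> ('a \<Rightarrow> 'a \<Rightarrow> 'a) list \<Rightarrow>
     ('a list \<Rightarrow>\<^sub>0 'k) \<Rightarrow> ('a list \<Rightarrow>\<^sub>0 'k) \<Rightarrow> bool" where
  "mutually_inverse scale ms x y \<longleftrightarrow> x \<in> tensors 2 \<and> y \<in> tensors 2 \<and>
     tensor_eq scale 2 (tensor_mult ms x y) (basis [1, 1]) \<and>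
     tensor_eq scale 2 (tensor_mult ms y x) (basis [1, 1])"

definition is_inverse ::
    "('k::{comm_ring,comm_monoid_mult} \<Rightarrow> 'a::{ring,monoid_mult} \<Rightarrow> 'a) \<Rightarrow>
     ('a list \<Rightarrow>\<^sub>0 'k) \<Rightarrow> ('a list \<Rightarrow>\<^sub>0 'k) \<Rightarrow> bool" where
  "is_inverse scale rho r \<longleftrightarrow> mutually_inverse scale [(*), (*)] rho r"

definition yang_baxter ::
    "('k::{comm_ring,comm_monoid_mult} \<Rightarrow> 'a::{ring,monoid_mult} \<Rightarrow> 'a) \<Rightarrow> ('a list \<Rightarrow>\<^sub>0 'k) \<Rightarrow> bool" where
  "yang_baxter scale rho \<longleftrightarrow>
     (let m = tensor_mult [(*), (*), (*)] in
      tensor_eq scale 3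
        (m (m (tensor12 rho) (tensor13 rho)) (tensor23 rho))
        (m (m (tensor23 rho) (tensor13 rho)) (tensor12 rho)))"

definition oriented_quantum_algebra ::
    "('k::{comm_ring,comm_monoid_mult} \<Rightarrow> 'a::{ring,monoid_mult} \<Rightarrow> 'a) \<Rightarrow> ('a list \<Rightarrow>\<^sub>0 'k) \<Rightarrow>
     ('a \<Rightarrow> 'a) \<Rightarrow> ('a \<Rightarrow> 'a) \<Rightarrow> bool" where
  "oriented_quantum_algebra scale rho D U \<longleftrightarrow>
     is_algebra scale \<and>
     rho \<in> tensors 2 \<and>
     yang_baxter scale rho \<and>
     algebra_automorphism scale U \<and> algebra_automorphism scale D \<and> U \<circ> D = D \<circ> U \<and>
     tensor_eq scale 2 (tensor_map [U, U] rho) rho \<and>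
     tensor_eq scale 2 (tensor_map [D, D] rho) rho \<and>
     (\<exists>r. is_inverse scale rho r \<and>
        mutually_inverse scale [(*), op_mult] (tensor_map [id, U] rho) (tensor_map [D, id] r))"

section \<open>Categories and functors\<close>

record ('o, 'm) category_data =
  Ob :: "'o set"
  Hom :: "'o \<Rightarrow> 'o \<Rightarrow> 'm set"
  Ident :: "'o \<Rightarrow> 'm"
  Comp :: "'o \<Rightarrow> 'o \<Rightarrow> 'o \<Rightarrow> 'm \<Rightarrow> 'm \<Rightarrow> 'm"  \<comment> \<open>\<open>Comp C p q r g f\<close> is \<open>g \<circ> f : p \<rightarrow> q \<rightarrow> r\<close>\<close>

definition is_category :: "('o, 'm) category_data \<Rightarrow> bool" where
  "is_category C \<longleftrightarrow>
     (\<forall>p\<in>Ob C. Ident C p \<in> Hom C p p) \<and>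
     (\<forall>p\<in>Ob C. \<forall>q\<in>Ob C. \<forall>r\<in>Ob C. \<forall>f\<in>Hom C p q. \<forall>g\<in>Hom C q r.
        Comp C p q r g f \<in> Hom C p r) \<and>
     (\<forall>p\<in>Ob C. \<forall>q\<in>Ob C. \<forall>f\<in>Hom C p q.
        Comp C p p q f (Ident C p) = f \<and> Comp C p q q (Ident C q) f = f) \<and>
     (\<forall>p\<in>Ob C. \<forall>q\<in>Ob C. \<forall>r\<in>Ob C. \<forall>s\<in>Ob C.
        \<forall>f\<in>Hom C p q. \<forall>g\<in>Hom C q r. \<forall>h\<in>Hom C r s.
        Comp C p r s h (Comp C p q r g f) = Comp C p q s (Comp C q r s h g) f)"

definition is_functor ::
    "('o, 'm) category_data \<Rightarrow> ('o2, 'm2) category_data \<Rightarrow>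
     ('o \<Rightarrow> 'o2) \<Rightarrow> ('o \<Rightarrow> 'o \<Rightarrow> 'm \<Rightarrow> 'm2) \<Rightarrow> bool" where
  "is_functor C C' F0 F1 \<longleftrightarrow> is_category C \<and> is_category C' \<and>
     (\<forall>p\<in>Ob C. F0 p \<in> Ob C') \<and>
     (\<forall>p\<in>Ob C. \<forall>q\<in>Ob C. \<forall>f\<in>Hom C p q. F1 p q f \<in> Hom C' (F0 p) (F0 q)) \<and>
     (\<forall>p\<in>Ob C. F1 p p (Ident C p) = Ident C' (F0 p)) \<and>
     (\<forall>p\<in>Ob C. \<forall>q\<in>Ob C. \<forall>r\<in>Ob C. \<forall>f\<in>Hom C p q. \<forall>g\<in>Hom C q r.
        F1 p r (Comp C p q r g f) = Comp C' (F0 p) (F0 q) (F0 r) (F1 q r g) (F1 p q f))"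

section \<open>Diagrams in Morse position\<close>

datatype sign = Up | Down

primrec opp :: "sign \<Rightarrow> sign" where
  "opp Up = Down"
| "opp Down = Up"

text \<open>
  A diagram in Morse position is read from bottom to top as a list of layers, one for each
  critical level. A layer \<open>(l, e, r)\<close> consists of the event \<open>e\<close> (a cap, cup, crossing, or
  bead), with vertical strands of signs \<open>l\<close> to the left and \<open>r\<close> to the right of it. The
  functions \<open>inputs\<close> and \<open>outputs\<close> give the signs, from left to right, of the strands at
  the bottom and at the top of an event.
\<close>

class morse_event =
  fixes inputs :: "'a \<Rightarrow> sign list"
    and outputs :: "'a \<Rightarrow> sign list"

type_synonym 'e layer = "sign list \<times> 'e \<times> sign list"
type_synonym 'e diagram = "'e layer list"

fun path :: "sign list \<Rightarrow> 'e::morse_event diagram \<Rightarrow> sign list \<Rightarrow> bool" where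
  "path p [] q \<longleftrightarrow> p = q"
| "path p ((l, e, r) # w) q \<longleftrightarrow> p = l @ inputs e @ r \<and> path (l @ outputs e @ r) w q"

definition diagrams :: "sign list \<Rightarrow> sign list \<Rightarrow> 'e::morse_event diagram set" where
  "diagrams p q = {w. path p w q}"

text \<open>Juxtaposition of vertical strands on both sides of a diagram.\<close>

definition whisker :: "sign list \<Rightarrow> 'e diagram \<Rightarrow> sign list \<Rightarrow> 'e diagram" where
  "whisker l w r = map (\<lambda>(l', e, r'). (l @ l', e, r' @ r)) w"

text \<open>Planar isotopy: the heights of two horizontally separated events may be exchanged.\<close>

inductive interchange :: "'e::morse_event diagram \<Rightarrow> 'e diagram \<Rightarrow> bool" where
  "interchange
     [([], e, m @ inputs e'), (outputs e @ m, e', [])]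
     [(inputs e @ m, e', []), ([], e, m @ outputs e')]"

text \<open>
  \<open>Cup s\<close> and \<open>Cap s\<close> have left leg of sign \<open>s\<close> and right leg of sign \<open>opp s\<close>. So
  \<open>Cap Up\<close> and \<open>Cup Down\<close> are oriented clockwise and counterclockwise, respectively, and
  \<open>Cap Down\<close> and \<open>Cup Up\<close> counterclockwise and clockwise.
  In \<open>Cross c s t\<close> the strand \<open>/\<close> from bottom left to top right has sign \<open>s\<close>, the strand
  from bottom right to top left has sign \<open>t\<close>, and \<open>c\<close> is the crossing information.
\<close>

datatype 'c event = Cup sign | Cap sign | Cross 'c sign sign

instantiation event :: (type) morse_event
begin

primrec inputs_event :: "'a event \<Rightarrow> sign list" where
  "inputs_event (Cup s) = []"
| "inputs_event (Cap s) = [s, opp s]"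
| "inputs_event (Cross c s t) = [s, t]"

primrec outputs_event :: "'a event \<Rightarrow> sign list" where
  "outputs_event (Cup s) = [s, opp s]"
| "outputs_event (Cap s) = []"
| "outputs_event (Cross c s t) = [t, s]"

instance ..

end

section \<open>The category of oriented tangles up to regular isotopy\<close>

text \<open>
  \<open>SlashOver\<close>: the strand from bottom left to top right is the overcrossing strand;
  \<open>BackslashOver\<close>: the one from bottom right to top left is. If both strands go up, or both
  go down, \<open>SlashOver\<close> is the positive (right-handed) crossing and \<open>BackslashOver\<close> the
  negative one; if one goes up and the other down, it is the other way round.
\<close>

datatype crossing = SlashOver | BackslashOver

primrec flip :: "crossing \<Rightarrow> crossing" where
  "flip SlashOver = BackslashOver"
| "flip BackslashOver = SlashOver"

text \<open>
  In \<open>reidemeister3\<close> three strands of signs \<open>s1, s2, s3\<close> start from left to right at the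
  bottom, and \<open>c12\<close>, \<open>c13\<close>, \<open>c23\<close> is the information at the crossing of the respective two
  strands; the strand further left at the bottom is the \<open>/\<close> strand of each crossing. The
  premise says that the three strands lie at three different heights over the plane.
  In \<open>switch_max\<close> and \<open>switch_min\<close> a strand of sign \<open>t\<close> is passed across a maximum or
  minimum.
\<close>

inductive tangle_move :: "crossing event diagram \<Rightarrow> crossing event diagram \<Rightarrow> bool" where
  isotopy: "interchange w w' \<Longrightarrow> tangle_move w w'"
| cancel1: "tangle_move [([s], Cup (opp s), []), ([], Cap s, [s])] []"
| cancel2: "tangle_move [([], Cup s, [s]), ([s], Cap (opp s), [])] []"
| reidemeister2: "tangle_move [([], Cross c s t, []), ([], Cross (flip c) t s, [])] []"
| reidemeister3:
    "(c12 = c23 \<longrightarrow> c13 = c12) \<Longrightarrow> tangle_move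
       [([], Cross c12 s1 s2, [s3]), ([s2], Cross c13 s1 s3, []), ([], Cross c23 s2 s3, [s1])]
       [([s1], Cross c23 s2 s3, []), ([], Cross c13 s1 s3, [s2]), ([s3], Cross c12 s1 s2, [])]"
| switch_max: "tangle_move
       [([s], Cross c t (opp s), []), ([], Cap s, [t])]
       [([], Cross (flip c) s t, [opp s]), ([t], Cap s, [])]"
| switch_min: "tangle_move
       [([], Cup s, [t]), ([s], Cross c (opp s) t, [])]
       [([t], Cup s, []), ([], Cross (flip c) t s, [opp s])]"

inductive regularly_isotopic ::
    "sign list \<Rightarrow> sign list \<Rightarrow> crossing event diagram \<Rightarrow> crossing event diagram \<Rightarrow> bool"
  for p q where
    refl: "w \<in> diagrams p q \<Longrightarrow> regularly_isotopic p q w w"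
  | sym: "regularly_isotopic p q w w' \<Longrightarrow> regularly_isotopic p q w' w"
  | trans: "\<lbrakk>regularly_isotopic p q w w'; regularly_isotopic p q w' w''\<rbrakk> \<Longrightarrow>
      regularly_isotopic p q w w''"
  | move: "\<lbrakk>tangle_move w w'; u @ whisker l w r @ v \<in> diagrams p q;
      u @ whisker l w' r @ v \<in> diagrams p q\<rbrakk> \<Longrightarrow>
      regularly_isotopic p q (u @ whisker l w r @ v) (u @ whisker l w' r @ v)"

definition tangle_class ::
    "sign list \<Rightarrow> sign list \<Rightarrow> crossing event diagram \<Rightarrow> crossing event diagram set" where
  "tangle_class p q w = {w'. regularly_isotopic p q w w'}"

definition Tang :: "(sign list, crossing event diagram set) category_data" where
  "Tang = \<lparr>
     Ob = UNIV,
     Hom = (\<lambda>p q. diagrams p q // {(w, w'). regularly_isotopic p q w w'}),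
     Ident = (\<lambda>p. tangle_class p p []),
     Comp = (\<lambda>p q r Y X. \<Union>x\<in>X. \<Union>y\<in>Y. tangle_class p r (x @ y))\<rparr>"

section \<open>The category of beaded flat tangles\<close>

datatype 'a bead_event = Flat "unit event" | Bead 'a sign

instantiation bead_event :: (type) morse_event
begin

primrec inputs_bead_event :: "'a bead_event \<Rightarrow> sign list" where
  "inputs_bead_event (Flat e) = inputs e"
| "inputs_bead_event (Bead a s) = [s]"

primrec outputs_bead_event :: "'a bead_event \<Rightarrow> sign list" where
  "outputs_bead_event (Flat e) = outputs e"
| "outputs_bead_event (Bead a s) = [s]"

instance ..

end

abbreviation FCross :: "sign \<Rightarrow> sign \<Rightarrow> 'a bead_event" where
  "FCross s t \<equiv> Flat (Cross () s t)"

text \<open>The moves of flat tangles are those of tangles with the crossing information forgotten.\<close>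

definition flat_shadow :: "crossing event diagram \<Rightarrow> 'a bead_event diagram" where
  "flat_shadow w = map (\<lambda>(l, e, r). (l, Flat (map_event (\<lambda>_. ()) e), r)) w"

text \<open>
  The relations of \<open>Cat(A)\<close>: \<open>bead_rel scale D U w x\<close> says that the beaded flat diagram
  \<open>w\<close> equals the formal sum \<open>x\<close>. On a strand of sign \<open>Up\<close> the lower of two beads is met
  first, on a strand of sign \<open>Down\<close> the upper one.
\<close>

inductive bead_rel ::
    "('k::{comm_ring,comm_monoid_mult} \<Rightarrow> 'a::{ring,monoid_mult} \<Rightarrow> 'a) \<Rightarrow> ('a \<Rightarrow> 'a) \<Rightarrow> ('a \<Rightarrow> 'a) \<Rightarrow>
     'a bead_event diagram \<Rightarrow> ('a bead_event diagram \<Rightarrow>\<^sub>0 'k) \<Rightarrow> bool"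
  for scale D U where
    isotopy: "interchange w w' \<Longrightarrow> bead_rel scale D U w (basis w')"
  | flat: "tangle_move w w' \<Longrightarrow> bead_rel scale D U (flat_shadow w) (basis (flat_shadow w'))"
  | add: "bead_rel scale D U [([], Bead (a + b) s, [])]
      (basis [([], Bead a s, [])] + basis [([], Bead b s, [])])"
  | scale: "bead_rel scale D U [([], Bead (scale c a) s, [])]
      (smul c (basis [([], Bead a s, [])]))"
  | unit: "bead_rel scale D U [([], Bead 1 s, [])] (basis [])"
  | mult_up: "bead_rel scale D U [([], Bead a Up, []), ([], Bead b Up, [])]
      (basis [([], Bead (a * b) Up, [])])"
  | mult_down: "bead_rel scale D U [([], Bead a Down, []), ([], Bead b Down, [])]
      (basis [([], Bead (b * a) Down, [])])"
  | cross_left: "bead_rel scale D U [([], Bead a s, [t]), ([], FCross s t, [])]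
      (basis [([], FCross s t, []), ([t], Bead a s, [])])"
  | cross_right: "bead_rel scale D U [([s], Bead a t, []), ([], FCross s t, [])]
      (basis [([], FCross s t, []), ([], Bead a t, [s])])"
  | cap_clockwise: "bead_rel scale D U
      [([Up], Bead a Down, []), ([], Flat (Cap Up), [])]
      (basis [([], Bead (U a) Up, [Down]), ([], Flat (Cap Up), [])])"
  | cap_counterclockwise: "bead_rel scale D U
      [([Down], Bead a Up, []), ([], Flat (Cap Down), [])]
      (basis [([], Bead (D a) Down, [Up]), ([], Flat (Cap Down), [])])"
  | cup_counterclockwise: "bead_rel scale D U
      [([], Flat (Cup Down), []), ([], Bead a Down, [Up])]
      (basis [([], Flat (Cup Down), []), ([Down], Bead (U a) Up, [])])"
  | cup_clockwise: "bead_rel scale D U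
      [([], Flat (Cup Up), []), ([], Bead a Up, [Down])]
      (basis [([], Flat (Cup Up), []), ([Up], Bead (D a) Down, [])])"

definition formal_sums :: "sign list \<Rightarrow> sign list \<Rightarrow> ('a bead_event diagram \<Rightarrow>\<^sub>0 'k::zero) set" where
  "formal_sums p q = {x. Poly_Mapping.keys x \<subseteq> diagrams p q}"

definition in_context ::
    "'a bead_event diagram \<Rightarrow> sign list \<Rightarrow> sign list \<Rightarrow> 'a bead_event diagram \<Rightarrow>
     ('a bead_event diagram \<Rightarrow>\<^sub>0 'k) \<Rightarrow> ('a bead_event diagram \<Rightarrow>\<^sub>0 'k::{comm_ring,comm_monoid_mult})"
  where
  "in_context u l r v = lin_ext (\<lambda>w. basis (u @ whisker l w r @ v))"

definition cat_rels ::
    "('k::{comm_ring,comm_monoid_mult} \<Rightarrow> 'a::{ring,monoid_mult} \<Rightarrow> 'a) \<Rightarrow> ('a \<Rightarrow> 'a) \<Rightarrow> ('a \<Rightarrow> 'a) \<Rightarrow>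
     sign list \<Rightarrow> sign list \<Rightarrow> ('a bead_event diagram \<Rightarrow>\<^sub>0 'k) set" where
  "cat_rels scale D U p q =
     {basis (u @ whisker l w r @ v) - in_context u l r v x | u l w r v x.
        bead_rel scale D U w x \<and> u @ whisker l w r @ v \<in> diagrams p q \<and>
        in_context u l r v x \<in> formal_sums p q}"

definition cat_eq ::
    "('k::{comm_ring,comm_monoid_mult} \<Rightarrow> 'a::{ring,monoid_mult} \<Rightarrow> 'a) \<Rightarrow> ('a \<Rightarrow> 'a) \<Rightarrow> ('a \<Rightarrow> 'a) \<Rightarrow>
     sign list \<Rightarrow> sign list \<Rightarrow> ('a bead_event diagram \<Rightarrow>\<^sub>0 'k) \<Rightarrow> ('a bead_event diagram \<Rightarrow>\<^sub>0 'k) \<Rightarrow> bool"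
  where
  "cat_eq scale D U p q x y \<longleftrightarrow> x \<in> formal_sums p q \<and> y \<in> formal_sums p q \<and>
     x - y \<in> submodule_span (cat_rels scale D U p q)"

definition cat_class ::
    "('k::{comm_ring,comm_monoid_mult} \<Rightarrow> 'a::{ring,monoid_mult} \<Rightarrow> 'a) \<Rightarrow> ('a \<Rightarrow> 'a) \<Rightarrow> ('a \<Rightarrow> 'a) \<Rightarrow>
     sign list \<Rightarrow> sign list \<Rightarrow> ('a bead_event diagram \<Rightarrow>\<^sub>0 'k) \<Rightarrow> ('a bead_event diagram \<Rightarrow>\<^sub>0 'k) set"
  where
  "cat_class scale D U p q x = {y. cat_eq scale D U p q x y}"

text \<open>Bilinear extension of vertical stacking, with the first argument at the bottom.\<close>

definition stack ::
    "('e diagram \<Rightarrow>\<^sub>0 'k) \<Rightarrow> ('e diagram \<Rightarrow>\<^sub>0 'k) \<Rightarrow> ('e diagram \<Rightarrow>\<^sub>0 'k::{comm_ring,comm_monoid_mult})" where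
  "stack x y = lin_ext (\<lambda>u. lin_ext (\<lambda>v. basis (u @ v)) y) x"

definition Cat ::
    "('k::{comm_ring,comm_monoid_mult} \<Rightarrow> 'a::{ring,monoid_mult} \<Rightarrow> 'a) \<Rightarrow> ('a \<Rightarrow> 'a) \<Rightarrow> ('a \<Rightarrow> 'a) \<Rightarrow>
     (sign list, ('a bead_event diagram \<Rightarrow>\<^sub>0 'k) set) category_data" where
  "Cat scale D U = \<lparr>
     Ob = UNIV,
     Hom = (\<lambda>p q. formal_sums p q // {(x, y). cat_eq scale D U p q x y}),
     Ident = (\<lambda>p. cat_class scale D U p p (basis [])),
     Comp = (\<lambda>p q r Y X. \<Union>x\<in>X. \<Union>y\<in>Y. cat_class scale D U p r (stack x y))\<rparr>"

section \<open>The decoration of tangle diagrams\<close>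

text \<open>
  The flat crossing of two strands of the same sign \<open>s\<close>, where \<open>a\<close> decorates the
  overcrossing and \<open>b\<close> the undercrossing strand: on the incoming parts for a positive
  crossing (\<open>SlashOver\<close>) and on the outgoing parts for a negative one (\<open>BackslashOver\<close>).
\<close>

fun decorated_crossing :: "crossing \<Rightarrow> sign \<Rightarrow> 'a \<Rightarrow> 'a \<Rightarrow> 'a bead_event diagram" where
  "decorated_crossing SlashOver Up a b =
     [([], Bead a Up, [Up]), ([Up], Bead b Up, []), ([], FCross Up Up, [])]"
| "decorated_crossing SlashOver Down a b =
     [([], FCross Down Down, []), ([], Bead b Down, [Down]), ([Down], Bead a Down, [])]"
| "decorated_crossing BackslashOver Up a b =
     [([], FCross Up Up, []), ([], Bead a Up, [Up]), ([Up], Bead b Up, [])]"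
| "decorated_crossing BackslashOver Down a b =
     [([], Bead b Down, [Down]), ([Down], Bead a Down, []), ([], FCross Down Down, [])]"

text \<open>
  The two rewritings of a crossing \<open>Cross c s (opp s)\<close> as a crossing of two strands of sign
  \<open>t\<close> composed with a cup and a cap: \<open>t = s\<close> bends the strand of sign \<open>opp s\<close>,
  \<open>t = opp s\<close> bends the other one. The strand \<open>/\<close> becomes the strand from bottom right to top
  left, so the crossing information is flipped.
\<close>

definition switchback :: "crossing \<Rightarrow> sign \<Rightarrow> sign \<Rightarrow> crossing event diagram" where
  "switchback c s t =
     (if t = s
      then [([], Cup (opp s), [s, opp s]),
            ([opp s], Cross (flip c) s s, [opp s]),
            ([opp s, s], Cap s, [])]
      else [([s, opp s], Cup (opp s), []),
            ([s], Cross (flip c) (opp s) (opp s), [s]),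
            ([], Cap s, [opp s, s])])"

text \<open>
  \<open>decoration scale rho w x\<close>: the formal sum \<open>x\<close> is a value of \<open>F\<close> on the tangle diagram
  \<open>w\<close>, for some choice of the switchback rewritings and of the representatives of
  \<open>\<rho>\<close> and \<open>\<rho>\<inverse>\<close> at the crossings.
\<close>

inductive decoration ::
    "('k::{comm_ring,comm_monoid_mult} \<Rightarrow> 'a::{ring,monoid_mult} \<Rightarrow> 'a) \<Rightarrow> ('a list \<Rightarrow>\<^sub>0 'k) \<Rightarrow>
     crossing event diagram \<Rightarrow> ('a bead_event diagram \<Rightarrow>\<^sub>0 'k) \<Rightarrow> bool"
  for scale rho where
    empty: "decoration scale rho [] (basis [])"
  | cup: "decoration scale rho w x \<Longrightarrow>
      decoration scale rho ((l, Cup s, r) # w) (stack (basis [(l, Flat (Cup s), r)]) x)"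
  | cap: "decoration scale rho w x \<Longrightarrow>
      decoration scale rho ((l, Cap s, r) # w) (stack (basis [(l, Flat (Cap s), r)]) x)"
  | positive: "\<lbrakk>decoration scale rho w x; tensor_eq scale 2 z rho\<rbrakk> \<Longrightarrow>
      decoration scale rho ((l, Cross SlashOver s s, r) # w)
        (stack (lin_ext (\<lambda>t. basis (whisker l (decorated_crossing SlashOver s (t ! 0) (t ! 1)) r)) z) x)"
  | negative: "\<lbrakk>decoration scale rho w x; is_inverse scale rho z\<rbrakk> \<Longrightarrow>
      decoration scale rho ((l, Cross BackslashOver s s, r) # w)
        (stack (lin_ext (\<lambda>t. basis (whisker l (decorated_crossing BackslashOver s (t ! 0) (t ! 1)) r)) z) x)"
  | mixed: "decoration scale rho (whisker l (switchback c s t) r @ w) x \<Longrightarrow>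
      decoration scale rho ((l, Cross c s (opp s), r) # w) x"

text \<open>
  The value of \<open>F\<close> on an isotopy class \<open>X\<close> of tangle diagrams is the union of the classes in
  \<open>Cat(A)\<close> of all decorations of all members of \<open>X\<close>. That this is a single class, that is,
  a morphism of \<open>Cat(A)\<close>, is well-definedness.
\<close>

definition tangle_functor ::
    "('k::{comm_ring,comm_monoid_mult} \<Rightarrow> 'a::{ring,monoid_mult} \<Rightarrow> 'a) \<Rightarrow> ('a list \<Rightarrow>\<^sub>0 'k) \<Rightarrow>
     ('a \<Rightarrow> 'a) \<Rightarrow> ('a \<Rightarrow> 'a) \<Rightarrow> sign list \<Rightarrow> sign list \<Rightarrow>
     crossing event diagram set \<Rightarrow> ('a bead_event diagram \<Rightarrow>\<^sub>0 'k) set" where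
  "tangle_functor scale rho D U p q X =
     \<Union>{cat_class scale D U p q x | w x. w \<in> X \<and> decoration scale rho w x}"

end

theory Submission
  imports Defs
begin

text \<open>
  The idea is to slide all beads at a crossing to its bottom. A crossing then becomes a flat crossing
  below which an element of \<open>A \<otimes> A\<close> decorates the two strands, where a downward strand
  carries the opposite algebra; see \<open>crossing_tensor\<close>. This element is \<open>\<rho>\<close> or
  the swapped \<open>\<rho>\<inverse>\<close> if the strands have equal signs, and has one factor moved
  by \<open>U\<inverse>\<close> or \<open>D\<inverse>\<close> across a cap if they have not. Stacking tangles
  multiplies the tensors (\<open>bead_sum_mult\<close>), and sliding them through a flat crossing permutes
  their factors (\<open>bead_sum_crossing\<close>). So each move of tangles becomes the same move of flat
  tangles together with an identity of tensors. The identities are the axioms of an oriented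
  quantum algebra: the second Reidemeister move is invertibility of \<open>\<rho>\<close> in
  \<open>A \<otimes> A\<close> for strands of equal signs, and the axiom on
  \<open>A \<otimes> A\<^sup>o\<^sup>p\<close> for strands of opposite signs
  (\<open>crossing_tensor_inverse\<close>); the switchback at a maximum is invariance of
  \<open>\<rho>\<close> under \<open>U\<close> and \<open>D\<close> (\<open>crossing_tensor_turn\<close>);
  the third Reidemeister move for positive crossings of upward strands is the Yang-Baxter equation
  (\<open>crossing_sum_braid\<close>).

  These few moves generate regular isotopy. The remaining third Reidemeister moves need no algebra:
  conjugating by a crossing permutes the strands, hence also the heights at which they lie, and
  bending a strand with a minimum and a maximum reverses its orientation. Likewise, the switchback at
  a minimum and the equivalence of a mixed crossing with both of its switchback rewritings follow by
  straightening snakes. This is done once for every congruence of tangle diagrams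
  (\<open>E_regularly_isotopic\<close>, \<open>E_switchback\<close>).

  Hence the value \<open>diagram_value\<close> of a diagram, formed with the normalized crossings, is
  invariant under regular isotopy, and every decoration is equal to it
  (\<open>decoration_diagram_value\<close>). Functoriality is then formal, as decorations of stacked
  diagrams can be stacked.
\<close>

section \<open>Linear extension\<close>

lemma lookup_smul [simp]: "Poly_Mapping.lookup (smul c x) w = c * Poly_Mapping.lookup x w"
  by (simp add: smul_def Poly_Mapping.map.rep_eq when_def)

lemma smul_add_right: "smul c (x + y) = smul c x + smul c y"
  by (rule poly_mapping_eqI) (simp add: lookup_add algebra_simps)

lemma smul_add_left: "smul (c + d) x = smul c x + smul d x"
  by (rule poly_mapping_eqI) (simp add: lookup_add algebra_simps)

lemma smul_smul: "smul c (smul d x) = smul (c * d) x"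
  by (rule poly_mapping_eqI) (simp add: algebra_simps)

lemma smul_one [simp]: "smul 1 x = x"
  by (rule poly_mapping_eqI) simp

lemma smul_zero [simp]: "smul c 0 = 0" "smul 0 x = 0"
  by (rule poly_mapping_eqI, simp)+

lemma smul_minus: "smul (- 1) x = - x"
  by (rule poly_mapping_eqI) (metis lookup_smul lookup_uminus mult_1 mult_minus_left)

lemma smul_sum: "smul c (sum f S) = (\<Sum>i\<in>S. smul c (f i))"
  by (induction S rule: infinite_finite_induct) (simp_all add: smul_add_right)

text \<open>
  Sums over any finite set containing the support make \<open>lin_ext\<close> additive: the supports of
  \<open>x\<close>, \<open>y\<close> and \<open>x + y\<close> differ.
\<close>

lemma lin_ext_over:
  assumes "finite S" "Poly_Mapping.keys x \<subseteq> S"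
  shows "lin_ext f x = (\<Sum>w\<in>S. smul (Poly_Mapping.lookup x w) (f w))"
  unfolding lin_ext_def using assms
  by (intro sum.mono_neutral_left) (auto simp: in_keys_iff)

lemma lin_ext_zero [simp]: "lin_ext f 0 = 0"
  by (simp add: lin_ext_def)

lemma lin_ext_add: "lin_ext f (x + y) = lin_ext f x + lin_ext f y"
proof -
  let ?S = "Poly_Mapping.keys x \<union> Poly_Mapping.keys y"
  have "Poly_Mapping.keys (x + y) \<subseteq> ?S"
    by (rule Poly_Mapping.keys_add)
  then show ?thesis
    by (simp add: lin_ext_over[of ?S] lookup_add smul_add_left sum.distrib)
qed

lemma lin_ext_smul: "lin_ext f (smul c x) = smul c (lin_ext f x)"
proof -
  have "Poly_Mapping.keys (smul c x) \<subseteq> Poly_Mapping.keys x"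
    by (auto simp: in_keys_iff)
  then show ?thesis
    by (simp add: lin_ext_over[of "Poly_Mapping.keys x"] smul_sum smul_smul)
qed

lemma lin_ext_minus: "lin_ext f (- x) = - lin_ext f x"
  using lin_ext_smul[of f "- 1" x] by (simp only: smul_minus)

lemma lin_ext_diff: "lin_ext f (x - y) = lin_ext f x - lin_ext f y"
  using lin_ext_add[of f x "- y"] by (simp add: lin_ext_minus)

lemma lin_ext_basis [simp]: "lin_ext f (basis w) = f w"
proof -
  have "lin_ext f (basis w) = (\<Sum>v\<in>{w}. smul (Poly_Mapping.lookup (basis w) v) (f v))"
    by (rule lin_ext_over) simp_all
  then show ?thesis by simp
qed

lemma lin_ext_cong:
  "(\<And>w. w \<in> Poly_Mapping.keys x \<Longrightarrow> f w = g w) \<Longrightarrow> lin_ext f x = lin_ext g x"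
  unfolding lin_ext_def by (rule sum.cong) simp_all

lemma lin_ext_sum: "lin_ext f (sum g S) = (\<Sum>i\<in>S. lin_ext f (g i))"
  by (induction S rule: infinite_finite_induct) (simp_all add: lin_ext_add)

lemma lin_ext_lin_ext: "lin_ext f (lin_ext g x) = lin_ext (\<lambda>w. lin_ext f (g w)) x"
  unfolding lin_ext_def[of g] lin_ext_def[of "\<lambda>w. lin_ext f (g w)"]
  by (simp add: lin_ext_sum lin_ext_smul)

lemma lin_ext_fun_add: "lin_ext (\<lambda>w. f w + g w) x = lin_ext f x + lin_ext g x"
  unfolding lin_ext_def by (simp add: smul_add_right sum.distrib)

lemma lin_ext_fun_smul: "lin_ext (\<lambda>w. smul c (f w)) x = smul c (lin_ext f x)"
  unfolding lin_ext_def by (simp add: smul_sum smul_smul mult.commute)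

lemma lin_ext_fun_diff: "lin_ext (\<lambda>w. f w - g w) x = lin_ext f x - lin_ext g x"
  using lin_ext_fun_add[of f "\<lambda>w. - g w" x] lin_ext_fun_smul[of "- 1" g x]
  by (simp add: smul_minus)

lemma lin_ext_self: "lin_ext basis x = x"
proof (rule poly_mapping_eqI)
  fix v
  have "Poly_Mapping.lookup (lin_ext basis x) v =
      (\<Sum>w\<in>Poly_Mapping.keys x. Poly_Mapping.lookup x w * (1 when w = v))"
    by (simp add: lin_ext_def lookup_sum lookup_single)
  also have "\<dots> = (\<Sum>w\<in>Poly_Mapping.keys x. if w = v then Poly_Mapping.lookup x w else 0)"
    by (rule sum.cong) (auto simp: when_def)
  finally show "Poly_Mapping.lookup (lin_ext basis x) v = Poly_Mapping.lookup x v"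
    by (simp add: in_keys_iff)
qed

lemma lin_ext_commute:
  "lin_ext (\<lambda>u. lin_ext (f u) y) x = lin_ext (\<lambda>v. lin_ext (\<lambda>u. f u v) x) y"
  unfolding lin_ext_def
  by (simp add: smul_sum smul_smul) (subst sum.swap, simp add: mult.commute)

lemma keys_lin_ext:
  "Poly_Mapping.keys (lin_ext f x) \<subseteq> (\<Union>w\<in>Poly_Mapping.keys x. Poly_Mapping.keys (f w))"
proof
  fix v
  assume "v \<in> Poly_Mapping.keys (lin_ext f x)"
  then have "(\<Sum>w\<in>Poly_Mapping.keys x. Poly_Mapping.lookup x w * Poly_Mapping.lookup (f w) v) \<noteq> 0"
    by (simp add: in_keys_iff lin_ext_def lookup_sum)
  then obtain w where "w \<in> Poly_Mapping.keys x"
      "Poly_Mapping.lookup x w * Poly_Mapping.lookup (f w) v \<noteq> 0"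
    by (meson sum.neutral)
  moreover from this have "v \<in> Poly_Mapping.keys (f w)"
    by (metis in_keys_iff mult_zero_right)
  ultimately show "v \<in> (\<Union>w\<in>Poly_Mapping.keys x. Poly_Mapping.keys (f w))"
    by blast
qed

section \<open>Submodules\<close>

lemma span_generator: "g \<in> S \<Longrightarrow> g \<in> submodule_span S"
  using submodule_span.step[OF submodule_span.zero, of g S 1] by simp

lemma span_add:
  assumes "x \<in> submodule_span S" "y \<in> submodule_span S"
  shows "x + y \<in> submodule_span S"
  using assms(2) assms(1)
  by induction (simp_all add: submodule_span.step flip: add.assoc)

lemma span_smul: "x \<in> submodule_span S \<Longrightarrow> smul c x \<in> submodule_span S"
  by (induction rule: submodule_span.induct)
    (simp_all add: submodule_span.zero submodule_span.step smul_add_right smul_smul)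

lemma span_minus: "x \<in> submodule_span S \<Longrightarrow> - x \<in> submodule_span S"
  using span_smul[of x S "- 1"] by (simp add: smul_minus)

lemma span_lin_ext:
  assumes "\<And>w. w \<in> Poly_Mapping.keys x \<Longrightarrow> f w \<in> submodule_span S"
  shows "lin_ext f x \<in> submodule_span S"
proof -
  have "(\<Sum>w\<in>I. smul (Poly_Mapping.lookup x w) (f w)) \<in> submodule_span S"
    if "finite I" "I \<subseteq> Poly_Mapping.keys x" for I
    using that
    by (induction I) (auto intro!: span_add span_smul assms submodule_span.zero)
  then show ?thesis
    by (simp add: lin_ext_def)
qed

text \<open>
  How a linear map passes to quotients: it has to be checked on the generators of the relations only.
\<close>

lemma span_image:
  assumes "x \<in> submodule_span S" and "\<And>g. g \<in> S \<Longrightarrow> lin_ext f g \<in> submodule_span T"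
  shows "lin_ext f x \<in> submodule_span T"
  using assms(1)
  by induction (simp_all add: submodule_span.zero lin_ext_add lin_ext_smul span_add span_smul assms(2))

section \<open>Diagrams in context\<close>

lemma path_append: "path p (u @ v) q \<longleftrightarrow> (\<exists>m. path p u m \<and> path m v q)"
  by (induction u arbitrary: p) auto

lemma whisker_simps [simp]:
  "whisker l [] r = []"
  "whisker l ((l', e, r') # w) r = (l @ l', e, r' @ r) # whisker l w r"
  by (simp_all add: whisker_def)

lemma whisker_append [simp]: "whisker l (u @ v) r = whisker l u r @ whisker l v r"
  by (simp add: whisker_def)

lemma whisker_whisker [simp]: "whisker l (whisker l' w r') r = whisker (l @ l') w (r' @ r)"
  by (auto simp: whisker_def)

lemma whisker_Nil [simp]: "whisker [] w [] = w"
  by (induction w) auto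

lemma path_whisker: "path p w q \<Longrightarrow> path (l @ p @ r) (whisker l w r) (l @ q @ r)"
proof (induction w arbitrary: p)
  case (Cons x w)
  then show ?case
    using Cons.IH by (cases x) fastforce
qed simp

lemma path_context:
  assumes "path p w q" "path p' u (l @ p @ r)" "path (l @ q @ r) v q'"
  shows "path p' (u @ whisker l w r @ v) q'"
  using assms path_whisker by (fastforce simp: path_append)

lemma in_context_basis [simp]: "in_context u l r v (basis w) = basis (u @ whisker l w r @ v)"
  by (simp add: in_context_def)

lemma in_context_Nil [simp]: "in_context [] [] [] [] x = x"
  by (simp add: in_context_def lin_ext_self)

lemma in_context_in_context:
  "in_context u l r v (in_context u' l' r' v' x) =
     in_context (u @ whisker l u' r) (l @ l') (r' @ r) (whisker l v' r @ v) x"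
  by (simp add: in_context_def lin_ext_lin_ext)

lemma in_context_lin_ext: "in_context u l r v (lin_ext f x) = lin_ext (\<lambda>w. in_context u l r v (f w)) x"
  by (simp add: in_context_def lin_ext_lin_ext)

lemma in_context_diff: "in_context u l r v (x - y) = in_context u l r v x - in_context u l r v y"
  by (simp add: in_context_def lin_ext_diff)

section \<open>Stacking and whiskering formal sums\<close>

abbreviation whisk ::
    "sign list \<Rightarrow> ('a bead_event diagram \<Rightarrow>\<^sub>0 'k) \<Rightarrow> sign list \<Rightarrow>
     ('a bead_event diagram \<Rightarrow>\<^sub>0 'k::{comm_ring,comm_monoid_mult})" where
  "whisk l x r \<equiv> in_context [] l r [] x"

lemma stack_basis_basis [simp]: "stack (basis u) (basis v) = basis (u @ v)"
  by (simp add: stack_def)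

lemma stack_Nil [simp]: "stack (basis []) x = x" "stack x (basis []) = x"
  by (simp_all add: stack_def lin_ext_self)

lemma stack_assoc: "stack (stack x y) z = stack x (stack y z)"
  by (simp add: stack_def lin_ext_lin_ext)

lemma stack_lin_ext_left: "stack (lin_ext f x) y = lin_ext (\<lambda>w. stack (f w) y) x"
  by (simp add: stack_def lin_ext_lin_ext)

lemma stack_lin_ext_right: "stack x (lin_ext f y) = lin_ext (\<lambda>w. stack x (f w)) y"
  by (simp add: stack_def lin_ext_lin_ext) (subst lin_ext_commute, simp)

lemma stack_expand_left: "stack x y = lin_ext (\<lambda>u. in_context u [] [] [] y) x"
  by (simp add: stack_def in_context_def)

lemma stack_expand_right: "stack x y = lin_ext (\<lambda>v. in_context [] [] [] v x) y"
  unfolding stack_def by (subst lin_ext_commute) (simp add: in_context_def)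

lemma whisk_stack: "whisk l (stack x y) r = stack (whisk l x r) (whisk l y r)"
  by (simp add: stack_def in_context_def lin_ext_lin_ext)

lemma formal_sums_basis: "w \<in> diagrams p q \<Longrightarrow> basis w \<in> formal_sums p q"
  using keys_single[of w 1] by (auto simp: formal_sums_def split: if_splits)

lemma formal_sums_add: "x \<in> formal_sums p q \<Longrightarrow> y \<in> formal_sums p q \<Longrightarrow> x + y \<in> formal_sums p q"
  using Poly_Mapping.keys_add[of x y] by (auto simp: formal_sums_def)

lemma formal_sums_smul: "x \<in> formal_sums p q \<Longrightarrow> smul c x \<in> formal_sums p q"
  unfolding formal_sums_def by (auto simp: in_keys_iff) (metis in_keys_iff mult_zero_right subsetD)

lemma formal_sums_lin_ext:
  "(\<And>w. w \<in> Poly_Mapping.keys x \<Longrightarrow> f w \<in> formal_sums p q) \<Longrightarrow> lin_ext f x \<in> formal_sums p q"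
  using keys_lin_ext[of f x] by (fastforce simp: formal_sums_def)

lemma formal_sums_in_context:
  assumes "x \<in> formal_sums p q" "path p' u (l @ p @ r)" "path (l @ q @ r) v q'"
  shows "in_context u l r v x \<in> formal_sums p' q'"
  unfolding in_context_def
proof (rule formal_sums_lin_ext)
  fix w
  assume "w \<in> Poly_Mapping.keys x"
  then have "path p w q"
    using assms(1) by (auto simp: formal_sums_def diagrams_def)
  then show "basis (u @ whisker l w r @ v) \<in> formal_sums p' q'"
    using assms(2,3) by (intro formal_sums_basis) (simp add: diagrams_def path_context)
qed

lemma formal_sums_whisk:
  "x \<in> formal_sums p q \<Longrightarrow> whisk l x r \<in> formal_sums (l @ p @ r) (l @ q @ r)"
  by (rule formal_sums_in_context) simp_all

lemma formal_sums_stack: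
  assumes "x \<in> formal_sums p q" "y \<in> formal_sums q r"
  shows "stack x y \<in> formal_sums p r"
  unfolding stack_expand_left
proof (rule formal_sums_lin_ext)
  fix u
  assume "u \<in> Poly_Mapping.keys x"
  then show "in_context u [] [] [] y \<in> formal_sums p r"
    using assms by (intro formal_sums_in_context[OF assms(2)]) (auto simp: formal_sums_def diagrams_def)
qed

section \<open>Congruence in the category of beaded flat tangles\<close>

locale bead_calculus =
  fixes scale :: "'k::{comm_ring,comm_monoid_mult} \<Rightarrow> 'a::{ring,monoid_mult} \<Rightarrow> 'a"
    and D U :: "'a \<Rightarrow> 'a"
begin

abbreviation ceq ::
    "sign list \<Rightarrow> sign list \<Rightarrow> ('a bead_event diagram \<Rightarrow>\<^sub>0 'k) \<Rightarrow> ('a bead_event diagram \<Rightarrow>\<^sub>0 'k) \<Rightarrow> bool"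
  where "ceq \<equiv> cat_eq scale D U"

lemma ceq_refl: "x \<in> formal_sums p q \<Longrightarrow> ceq p q x x"
  by (simp add: cat_eq_def submodule_span.zero)

lemma ceq_sym: "ceq p q x y \<Longrightarrow> ceq p q y x"
  using span_minus[of "x - y" "cat_rels scale D U p q"] by (simp add: cat_eq_def)

lemma ceq_trans [trans]: "ceq p q x y \<Longrightarrow> ceq p q y z \<Longrightarrow> ceq p q x z"
  using span_add[of "x - y" "cat_rels scale D U p q" "y - z"] by (simp add: cat_eq_def)

lemma ceq_sums: "ceq p q x y \<Longrightarrow> x \<in> formal_sums p q" "ceq p q x y \<Longrightarrow> y \<in> formal_sums p q"
  by (simp_all add: cat_eq_def)

lemma ceq_lin_ext:
  assumes "\<And>w. w \<in> Poly_Mapping.keys x \<Longrightarrow> ceq p q (f w) (g w)"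
  shows "ceq p q (lin_ext f x) (lin_ext g x)"
  using assms span_lin_ext[of x "\<lambda>w. f w - g w" "cat_rels scale D U p q"]
  by (simp add: cat_eq_def formal_sums_lin_ext lin_ext_fun_diff)

text \<open>
  The generators of the relations are already closed under stacking and whiskering by diagrams, so
  equality in \<open>Cat(A)\<close> is a congruence for both operations.
\<close>

lemma in_context_cat_rels:
  assumes "g \<in> cat_rels scale D U p q" "path p' u (l @ p @ r)" "path (l @ q @ r) v q'"
  shows "in_context u l r v g \<in> cat_rels scale D U p' q'"
proof -
  obtain u1 l1 w r1 v1 x where g: "g = basis (u1 @ whisker l1 w r1 @ v1) - in_context u1 l1 r1 v1 x"
    and rel: "bead_rel scale D U w x"
    and path: "u1 @ whisker l1 w r1 @ v1 \<in> diagrams p q" "in_context u1 l1 r1 v1 x \<in> formal_sums p q"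
    using assms(1) unfolding cat_rels_def by blast
  define u2 l2 r2 v2 where "u2 = u @ whisker l u1 r" "l2 = l @ l1" "r2 = r1 @ r" "v2 = whisker l v1 r @ v"
  note defs = this
  have "in_context u l r v g = basis (u2 @ whisker l2 w r2 @ v2) - in_context u2 l2 r2 v2 x"
    by (simp add: g in_context_diff in_context_in_context defs)
  moreover have "u2 @ whisker l2 w r2 @ v2 \<in> diagrams p' q'"
    using path_context[of p "u1 @ whisker l1 w r1 @ v1" q p' u l r v q'] path(1) assms(2,3)
    by (simp add: defs diagrams_def)
  moreover have "in_context u2 l2 r2 v2 x \<in> formal_sums p' q'"
    using formal_sums_in_context[OF path(2) assms(2,3)] by (simp add: in_context_in_context defs)
  ultimately show ?thesis
    using rel unfolding cat_rels_def by blast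
qed

lemma ceq_in_context:
  assumes "ceq p q x y" "path p' u (l @ p @ r)" "path (l @ q @ r) v q'"
  shows "ceq p' q' (in_context u l r v x) (in_context u l r v y)"
proof -
  have "in_context u l r v (x - y) \<in> submodule_span (cat_rels scale D U p' q')"
    unfolding in_context_def
    by (rule span_image[of _ "cat_rels scale D U p q"])
      (use assms in_context_cat_rels in \<open>auto simp: cat_eq_def simp flip: in_context_def intro: span_generator\<close>)
  then show ?thesis
    using assms by (auto simp: cat_eq_def in_context_diff intro: formal_sums_in_context)
qed

lemma ceq_whisk: "ceq p q x y \<Longrightarrow> ceq (l @ p @ r) (l @ q @ r) (whisk l x r) (whisk l y r)"
  by (rule ceq_in_context) simp_all

lemma ceq_stack:
  assumes "ceq p q x x'" "ceq q r y y'"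
  shows "ceq p r (stack x y) (stack x' y')"
proof -
  have "ceq p r (stack x y) (stack x y')"
    unfolding stack_expand_left
  proof (rule ceq_lin_ext)
    fix u
    assume "u \<in> Poly_Mapping.keys x"
    then show "ceq p r (in_context u [] [] [] y) (in_context u [] [] [] y')"
      using assms by (intro ceq_in_context[OF assms(2)]) (auto simp: cat_eq_def formal_sums_def diagrams_def)
  qed
  also have "ceq p r (stack x y') (stack x' y')"
    unfolding stack_expand_right
  proof (rule ceq_lin_ext)
    fix v
    assume "v \<in> Poly_Mapping.keys y'"
    then show "ceq p r (in_context [] [] [] v x) (in_context [] [] [] v x')"
      using assms by (intro ceq_in_context[OF assms(1)]) (auto simp: cat_eq_def formal_sums_def diagrams_def)
  qed
  finally show ?thesis .
qed

lemma ceq_rel: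
  assumes "bead_rel scale D U w x" "path p w q" "x \<in> formal_sums p q"
  shows "ceq p q (basis w) x"
proof -
  have "basis ([] @ whisker [] w [] @ []) - in_context [] [] [] [] x \<in> cat_rels scale D U p q"
    unfolding cat_rels_def using assms by (fastforce simp: diagrams_def)
  then have "basis w - x \<in> cat_rels scale D U p q"
    by simp
  then show ?thesis
    using assms by (auto simp: cat_eq_def formal_sums_basis diagrams_def intro: span_generator)
qed

abbreviation deq :: "sign list \<Rightarrow> sign list \<Rightarrow> 'a bead_event diagram \<Rightarrow> 'a bead_event diagram \<Rightarrow> bool"
  where "deq p q w w' \<equiv> ceq p q (basis w) (basis w')"

lemma deq_rel:
  assumes "bead_rel scale D U w (basis w')" "path p w q" "path p w' q"
  shows "deq p q w w'"
  using assms by (intro ceq_rel) (auto simp: formal_sums_basis diagrams_def)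

lemma deq_refl: "path p w q \<Longrightarrow> deq p q w w"
  by (simp add: ceq_refl formal_sums_basis diagrams_def)

lemma deq_context:
  assumes "deq p q w w'" "path p' u (l @ p @ r)" "path (l @ q @ r) v q'"
  shows "deq p' q' (u @ whisker l w r @ v) (u @ whisker l w' r @ v)"
  using ceq_in_context[OF assms] by simp

lemma deq_append: "deq p q u u' \<Longrightarrow> deq q r v v' \<Longrightarrow> deq p r (u @ v) (u' @ v')"
  using ceq_stack[of p q "basis u" "basis u'" r "basis v" "basis v'"] by simp

lemma deq_whisker: "deq p q w w' \<Longrightarrow> deq (l @ p @ r) (l @ q @ r) (whisker l w r) (whisker l w' r)"
  using ceq_whisk[of p q "basis w" "basis w'" l r] by simp

lemma deq_interchange_events:
  "deq (inputs e @ m @ inputs e') (outputs e @ m @ outputs e')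
     [([], e, m @ inputs e'), (outputs e @ m, e', [])]
     [(inputs e @ m, e', []), ([], e, m @ outputs e')]"
  by (rule deq_rel[OF bead_rel.isotopy[OF interchange.intros]]) simp_all

text \<open>
  The relation gives the exchange of two single events only. A decorated crossing consists of several
  layers, so the exchange is extended, by induction on the number of layers on the left and then on
  the right, to diagrams and finally, bilinearly, to formal sums.
\<close>

lemma deq_interchange_layer:
  assumes "path p w q"
  shows "deq (p @ m @ l @ inputs e @ r) (q @ m @ l @ outputs e @ r)
    (whisker [] w (m @ l @ inputs e @ r) @ [(q @ m @ l, e, r)])
    ((p @ m @ l, e, r) # whisker [] w (m @ l @ outputs e @ r))"
  using assms
proof (induction w arbitrary: p)
  case Nil
  then show ?case by (auto intro!: deq_refl)
next
  case (Cons x w)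
  obtain l' e' r' where x: "x = (l', e', r')"
    by (cases x)
  have p: "p = l' @ inputs e' @ r'" and w: "path (l' @ outputs e' @ r') w q"
    using Cons.prems by (auto simp: x)
  let ?i = "m @ l @ inputs e @ r" and ?o = "m @ l @ outputs e @ r"
  let ?p' = "l' @ outputs e' @ r'"
  have "deq (p @ ?i) (q @ ?o) ([(l', e', r' @ ?i)] @ (whisker [] w ?i @ [(q @ m @ l, e, r)]))
      ([(l', e', r' @ ?i)] @ ((?p' @ m @ l, e, r) # whisker [] w ?o))"
    by (rule deq_append[OF deq_refl Cons.IH[OF w]]) (simp add: p)
  also have "deq (p @ ?i) (q @ ?o)
      ([(l', e', r' @ ?i)] @ ((?p' @ m @ l, e, r) # whisker [] w ?o))
      ([(p @ m @ l, e, r), (l', e', r' @ ?o)] @ whisker [] w ?o)"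
  proof -
    have "deq (p @ ?i) (?p' @ ?o) [(l', e', r' @ ?i), (?p' @ m @ l, e, r)] [(p @ m @ l, e, r), (l', e', r' @ ?o)]"
      using deq_whisker[OF deq_interchange_events[of e' "r' @ m @ l" e], of l' r] by (simp add: p)
    moreover have "deq (?p' @ ?o) (q @ ?o) (whisker [] w ?o) (whisker [] w ?o)"
      using path_whisker[OF w, of "[]" ?o] by (intro deq_refl) simp
    ultimately show ?thesis
      using deq_append by fastforce
  qed
  finally show ?case
    by (simp add: x)
qed

lemma deq_interchange:
  assumes w: "path p w q" and w': "path p' w' q'"
  shows "deq (p @ m @ p') (q @ m @ q')
    (whisker [] w (m @ p') @ whisker (q @ m) w' [])
    (whisker (p @ m) w' [] @ whisker [] w (m @ q'))"
  using w'
proof (induction w' arbitrary: p')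
  case Nil
  then show ?case
    using path_whisker[OF w, of "[]" "m @ p'"] by (auto intro!: deq_refl)
next
  case (Cons x w')
  obtain l e r where x: "x = (l, e, r)"
    by (cases x)
  have p': "p' = l @ inputs e @ r" and w': "path (l @ outputs e @ r) w' q'"
    using Cons.prems by (auto simp: x)
  have "deq (p @ m @ p') (q @ m @ q')
      ((whisker [] w (m @ p') @ [(q @ m @ l, e, r)]) @ whisker (q @ m) w' [])
      (((p @ m @ l, e, r) # whisker [] w (m @ l @ outputs e @ r)) @ whisker (q @ m) w' [])"
    unfolding p'
    by (rule deq_append[OF deq_interchange_layer[OF w] deq_refl])
      (use path_whisker[OF w', of "q @ m" "[]"] in simp)
  also have "((p @ m @ l, e, r) # whisker [] w (m @ l @ outputs e @ r)) @ whisker (q @ m) w' [] =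
      [(p @ m @ l, e, r)] @ (whisker [] w (m @ l @ outputs e @ r) @ whisker (q @ m) w' [])"
    by simp
  also have "deq (p @ m @ p') (q @ m @ q')
      ([(p @ m @ l, e, r)] @ (whisker [] w (m @ l @ outputs e @ r) @ whisker (q @ m) w' []))
      ([(p @ m @ l, e, r)] @ (whisker (p @ m) w' [] @ whisker [] w (m @ q')))"
    by (rule deq_append[OF deq_refl Cons.IH[OF w', simplified]]) (simp add: p')
  finally show ?case
    by (simp add: x)
qed

lemma ceq_interchange:
  assumes x: "x \<in> formal_sums p q" and y: "y \<in> formal_sums p' q'"
  shows "ceq (p @ m @ p') (q @ m @ q')
    (stack (whisk [] x (m @ p')) (whisk (q @ m) y []))
    (stack (whisk (p @ m) y []) (whisk [] x (m @ q')))"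
proof -
  have "stack (whisk [] x (m @ p')) (whisk (q @ m) y []) =
      lin_ext (\<lambda>u. lin_ext (\<lambda>v. basis (whisker [] u (m @ p') @ whisker (q @ m) v [])) y) x"
    by (simp add: stack_def in_context_def lin_ext_lin_ext)
  moreover have "stack (whisk (p @ m) y []) (whisk [] x (m @ q')) =
      lin_ext (\<lambda>u. lin_ext (\<lambda>v. basis (whisker (p @ m) v [] @ whisker [] u (m @ q'))) y) x"
    by (simp add: stack_def in_context_def lin_ext_lin_ext) (subst lin_ext_commute, simp)
  moreover have "ceq (p @ m @ p') (q @ m @ q')
      (lin_ext (\<lambda>u. lin_ext (\<lambda>v. basis (whisker [] u (m @ p') @ whisker (q @ m) v [])) y) x)
      (lin_ext (\<lambda>u. lin_ext (\<lambda>v. basis (whisker (p @ m) v [] @ whisker [] u (m @ q'))) y) x)"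
    by (intro ceq_lin_ext deq_interchange)
      (use x y in \<open>auto simp: formal_sums_def diagrams_def\<close>)
  ultimately show ?thesis
    by simp
qed

end

section \<open>Reducing regular isotopy to few moves\<close>

lemma opp_opp [simp]: "opp (opp s) = s"
  by (cases s) simp_all

lemma opp_neq [simp]: "opp s \<noteq> s" "s \<noteq> opp s"
  by (cases s; simp)+

lemma flip_flip [simp]: "flip (flip c) = c"
  by (cases c) simp_all

text \<open>
  Regular isotopy is the least congruence generated by a much shorter list of moves than those of
  \<open>tangle_move\<close>: planar isotopy, cancellation, the second Reidemeister move, the switchback at a
  maximum, and a single one of the third Reidemeister moves, with all strands up and all crossings
  positive. An invariant has to be checked on these only.
\<close>

locale tangle_congruence =
  fixes E :: "sign list \<Rightarrow> sign list \<Rightarrow> crossing event diagram \<Rightarrow> crossing event diagram \<Rightarrow> bool"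
  assumes E_refl: "path p w q \<Longrightarrow> E p q w w"
    and E_sym: "E p q w w' \<Longrightarrow> E p q w' w"
    and E_trans [trans]: "E p q w w' \<Longrightarrow> E p q w' w'' \<Longrightarrow> E p q w w''"
    and E_context: "E p q w w' \<Longrightarrow> path p' u (l @ p @ r) \<Longrightarrow> path (l @ q @ r) v q' \<Longrightarrow>
      E p' q' (u @ whisker l w r @ v) (u @ whisker l w' r @ v)"
    and E_interchange: "E (inputs e @ m @ inputs e') (outputs e @ m @ outputs e')
      [([], e, m @ inputs e'), (outputs e @ m, e', [])]
      [(inputs e @ m, e', []), ([], e, m @ outputs e')]"
    and E_cancel1: "E [s] [s] [([s], Cup (opp s), []), ([], Cap s, [s])] []"
    and E_cancel2: "E [s] [s] [([], Cup s, [s]), ([s], Cap (opp s), [])] []"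
    and E_reidemeister2: "E [s, t] [s, t] [([], Cross c s t, []), ([], Cross (flip c) t s, [])] []"
    and E_switch_max: "E [s, t, opp s] [t]
      [([s], Cross c t (opp s), []), ([], Cap s, [t])]
      [([], Cross (flip c) s t, [opp s]), ([t], Cap s, [])]"
    and E_braid: "E [Up, Up, Up] [Up, Up, Up]
      [([], Cross SlashOver Up Up, [Up]), ([Up], Cross SlashOver Up Up, []),
       ([], Cross SlashOver Up Up, [Up])]
      [([Up], Cross SlashOver Up Up, []), ([], Cross SlashOver Up Up, [Up]),
       ([Up], Cross SlashOver Up Up, [])]"
begin

text \<open>
  Both switchback rewritings of a mixed crossing are equivalent to the crossing: sliding it across
  the cap leaves a snake, which is straightened.
\<close>

lemma E_switchback_same:
  "E [s, opp s] [opp s, s] (switchback c s s) [([], Cross c s (opp s), [])]"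
proof -
  let ?o = "opp s"
  have "E [s, ?o] [?o, s]
      [([], Cup ?o, [s, ?o]), ([?o], Cross (flip c) s s, [?o]), ([?o, s], Cap s, [])]
      [([], Cup ?o, [s, ?o]), ([?o, s], Cross c s ?o, []), ([?o], Cap s, [s])]"
    using E_context[OF E_switch_max[of s s c, THEN E_sym], of _ "[([], Cup ?o, [s, ?o])]" "[?o]" "[]" "[]"]
    by simp
  also have "E [s, ?o] [?o, s] \<dots>
      [([], Cross c s ?o, []), ([], Cup ?o, [?o, s]), ([?o], Cap s, [s])]"
    using E_context[OF E_interchange[of "Cup ?o" "[]" "Cross c s ?o"], of _ "[]" "[]" "[]" "[([?o], Cap s, [s])]"]
    by simp
  also have "E [s, ?o] [?o, s] \<dots> [([], Cross c s ?o, [])]"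
    using E_context[OF E_cancel2[of ?o], of _ "[([], Cross c s ?o, [])]" "[]" "[s]" "[]"]
    by simp
  finally show ?thesis
    by (simp add: switchback_def)
qed

lemma E_switchback_opp:
  "E [s, opp s] [opp s, s] (switchback c s (opp s)) [([], Cross c s (opp s), [])]"
proof -
  let ?o = "opp s"
  have "E [s, ?o] [?o, s]
      [([s, ?o], Cup ?o, []), ([s], Cross (flip c) ?o ?o, [s]), ([], Cap s, [?o, s])]
      [([s, ?o], Cup ?o, []), ([], Cross c s ?o, [?o, s]), ([?o], Cap s, [s])]"
    using E_context[OF E_switch_max[of s ?o "flip c"], of _ "[([s, ?o], Cup ?o, [])]" "[]" "[s]" "[]"]
    by simp
  also have "E [s, ?o] [?o, s] \<dots>
      [([], Cross c s ?o, []), ([?o, s], Cup ?o, []), ([?o], Cap s, [s])]"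
    using E_context[OF E_interchange[of "Cross c s ?o" "[]" "Cup ?o", THEN E_sym],
        of _ "[]" "[]" "[]" "[([?o], Cap s, [s])]"]
    by simp
  also have "E [s, ?o] [?o, s] \<dots> [([], Cross c s ?o, [])]"
    using E_context[OF E_cancel1[of s], of _ "[([], Cross c s ?o, [])]" "[?o]" "[]" "[]"]
    by simp
  finally show ?thesis
    by (simp add: switchback_def)
qed

lemma E_switchback:
  "t = s \<or> t = opp s \<Longrightarrow> E [s, opp s] [opp s, s] (switchback c s t) [([], Cross c s (opp s), [])]"
  using E_switchback_same E_switchback_opp by blast

text \<open>
  The switchback at a minimum follows from the one at a maximum: a snake is added at the right end of
  the strand that forms the minimum, the crossing is pushed across the maximum of the snake, and the
  old minimum then straightens with that maximum.
\<close>

lemma E_switch_min: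
  "E [t] [s, t, opp s]
     [([], Cup s, [t]), ([s], Cross c (opp s) t, [])]
     [([t], Cup s, []), ([], Cross (flip c) t s, [opp s])]"
proof -
  let ?o = "opp s"
  have "E [t] [s, t, ?o]
      [([], Cup s, [t]), ([s], Cross c ?o t, [])]
      [([], Cup s, [t]), ([s], Cross c ?o t, []), ([s, t, ?o], Cup s, []), ([s, t], Cap ?o, [?o])]"
    using E_context[OF E_cancel1[of ?o, THEN E_sym],
        of _ "[([], Cup s, [t]), ([s], Cross c ?o t, [])]" "[s, t]" "[]" "[]"]
    by simp
  also have "E [t] [s, t, ?o] \<dots>
      [([], Cup s, [t]), ([s, ?o, t], Cup s, []), ([s], Cross c ?o t, [s, ?o]), ([s, t], Cap ?o, [?o])]"
    using E_context[OF E_interchange[of "Cross c ?o t" "[]" "Cup s"],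
        of _ "[([], Cup s, [t])]" "[s]" "[]" "[([s, t], Cap ?o, [?o])]"]
    by simp
  also have "E [t] [s, t, ?o] \<dots>
      [([], Cup s, [t]), ([s, ?o, t], Cup s, []), ([s, ?o], Cross (flip c) t s, [?o]), ([s], Cap ?o, [t, ?o])]"
    using E_context[OF E_switch_max[of ?o t "flip c", THEN E_sym],
        of _ "[([], Cup s, [t]), ([s, ?o, t], Cup s, [])]" "[s]" "[?o]" "[]"]
    by simp
  also have "E [t] [s, t, ?o] \<dots>
      [([t], Cup s, []), ([], Cup s, [t, s, ?o]), ([s, ?o], Cross (flip c) t s, [?o]), ([s], Cap ?o, [t, ?o])]"
    using E_context[OF E_interchange[of "Cup s" "[t]" "Cup s"],
        of _ "[]" "[]" "[]" "[([s, ?o], Cross (flip c) t s, [?o]), ([s], Cap ?o, [t, ?o])]"]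
    by simp
  also have "E [t] [s, t, ?o] \<dots>
      [([t], Cup s, []), ([], Cross (flip c) t s, [?o]), ([], Cup s, [s, t, ?o]), ([s], Cap ?o, [t, ?o])]"
    using E_context[OF E_interchange[of "Cup s" "[]" "Cross (flip c) t s"],
        of _ "[([t], Cup s, [])]" "[]" "[?o]" "[([s], Cap ?o, [t, ?o])]"]
    by simp
  also have "E [t] [s, t, ?o] \<dots> [([t], Cup s, []), ([], Cross (flip c) t s, [?o])]"
    using E_context[OF E_cancel2[of s],
        of _ "[([t], Cup s, []), ([], Cross (flip c) t s, [?o])]" "[]" "[t, ?o]" "[]"]
    by simp
  finally show ?thesis .
qed

text \<open>
  The third Reidemeister move as a predicate of its parameters, on which permutations of the strands
  and reversals of their orientations act.
\<close>

definition braid ::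
    "crossing \<Rightarrow> crossing \<Rightarrow> crossing \<Rightarrow> sign \<Rightarrow> sign \<Rightarrow> sign \<Rightarrow> bool" where
  "braid c12 c13 c23 s1 s2 s3 \<longleftrightarrow> E [s1, s2, s3] [s3, s2, s1]
     [([], Cross c12 s1 s2, [s3]), ([s2], Cross c13 s1 s3, []), ([], Cross c23 s2 s3, [s1])]
     [([s1], Cross c23 s2 s3, []), ([], Cross c13 s1 s3, [s2]), ([s3], Cross c12 s1 s2, [])]"

text \<open>
  Composing both sides with the inverse of the crossing of strands 1 and 2, at the bottom and at the
  top, gives the move in which these strands have changed places. The same works for strands 2 and 3.
\<close>

lemma braid_swap12:
  assumes "braid c12 c13 c23 s1 s2 s3"
  shows "braid (flip c12) c23 c13 s2 s1 s3"
proof -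
  have "E [s2, s1, s3] [s3, s1, s2]
      [([s2], Cross c13 s1 s3, []), ([], Cross c23 s2 s3, [s1]), ([s3], Cross (flip c12) s2 s1, [])]
      [([], Cross (flip c12) s2 s1, [s3]), ([], Cross c12 s1 s2, [s3]), ([s2], Cross c13 s1 s3, []),
       ([], Cross c23 s2 s3, [s1]), ([s3], Cross (flip c12) s2 s1, [])]"
    using E_context[OF E_reidemeister2[of s2 s1 "flip c12", THEN E_sym], of _ "[]" "[]" "[s3]"
        "[([s2], Cross c13 s1 s3, []), ([], Cross c23 s2 s3, [s1]), ([s3], Cross (flip c12) s2 s1, [])]"]
    by simp
  also have "E [s2, s1, s3] [s3, s1, s2] \<dots>
      [([], Cross (flip c12) s2 s1, [s3]), ([s1], Cross c23 s2 s3, []), ([], Cross c13 s1 s3, [s2]),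
       ([s3], Cross c12 s1 s2, []), ([s3], Cross (flip c12) s2 s1, [])]"
    using E_context[OF assms[unfolded braid_def], of _ "[([], Cross (flip c12) s2 s1, [s3])]" "[]" "[]"
        "[([s3], Cross (flip c12) s2 s1, [])]"]
    by simp
  also have "E [s2, s1, s3] [s3, s1, s2] \<dots>
      [([], Cross (flip c12) s2 s1, [s3]), ([s1], Cross c23 s2 s3, []), ([], Cross c13 s1 s3, [s2])]"
    using E_context[OF E_reidemeister2[of s1 s2 c12], of _
        "[([], Cross (flip c12) s2 s1, [s3]), ([s1], Cross c23 s2 s3, []), ([], Cross c13 s1 s3, [s2])]"
        "[s3]" "[]" "[]"]
    by simp
  finally show ?thesis
    unfolding braid_def by (rule E_sym)
qed

lemma braid_swap23:
  assumes "braid c12 c13 c23 s1 s2 s3"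
  shows "braid c13 c12 (flip c23) s1 s3 s2"
proof -
  have "E [s1, s3, s2] [s2, s3, s1]
      [([], Cross c13 s1 s3, [s2]), ([s3], Cross c12 s1 s2, []), ([], Cross (flip c23) s3 s2, [s1])]
      [([s1], Cross (flip c23) s3 s2, []), ([s1], Cross c23 s2 s3, []), ([], Cross c13 s1 s3, [s2]),
       ([s3], Cross c12 s1 s2, []), ([], Cross (flip c23) s3 s2, [s1])]"
    using E_context[OF E_reidemeister2[of s3 s2 "flip c23", THEN E_sym], of _ "[]" "[s1]" "[]"
        "[([], Cross c13 s1 s3, [s2]), ([s3], Cross c12 s1 s2, []), ([], Cross (flip c23) s3 s2, [s1])]"]
    by simp
  also have "E [s1, s3, s2] [s2, s3, s1] \<dots>
      [([s1], Cross (flip c23) s3 s2, []), ([], Cross c12 s1 s2, [s3]), ([s2], Cross c13 s1 s3, []),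
       ([], Cross c23 s2 s3, [s1]), ([], Cross (flip c23) s3 s2, [s1])]"
    using E_context[OF assms[unfolded braid_def, THEN E_sym], of _ "[([s1], Cross (flip c23) s3 s2, [])]"
        "[]" "[]" "[([], Cross (flip c23) s3 s2, [s1])]"]
    by simp
  also have "E [s1, s3, s2] [s2, s3, s1] \<dots>
      [([s1], Cross (flip c23) s3 s2, []), ([], Cross c12 s1 s2, [s3]), ([s2], Cross c13 s1 s3, [])]"
    using E_context[OF E_reidemeister2[of s2 s3 c23], of _
        "[([s1], Cross (flip c23) s3 s2, []), ([], Cross c12 s1 s2, [s3]), ([s2], Cross c13 s1 s3, [])]"
        "[]" "[s1]" "[]"]
    by simp
  finally show ?thesis
    unfolding braid_def .
qed

text \<open>
  A strand of sign \<open>opp x\<close> that crosses two others from right to left is bent into one that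
  enters through a minimum on the left, crosses the others from left to right with the sign
  \<open>x\<close>, and leaves through a maximum on the right.
\<close>

lemma E_turn:
  "E [t, s, opp x] [opp x, t, s]
     [([t], Cross c s (opp x), []), ([], Cross d t (opp x), [s])]
     [([], Cup (opp x), [t, s, opp x]), ([opp x], Cross (flip d) x t, [s, opp x]),
      ([opp x, t], Cross (flip c) x s, [opp x]), ([opp x, t, s], Cap x, [])]"
proof -
  let ?o = "opp x"
  have "E [t, s, ?o] [?o, t, s]
      [([], Cup ?o, [t, s, ?o]), ([?o], Cross (flip d) x t, [s, ?o]),
       ([?o, t], Cross (flip c) x s, [?o]), ([?o, t, s], Cap x, [])]
      [([], Cup ?o, [t, s, ?o]), ([?o], Cross (flip d) x t, [s, ?o]),
       ([?o, t, x], Cross c s ?o, []), ([?o, t], Cap x, [s])]"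
    using E_context[OF E_switch_max[of x s c, THEN E_sym], of _
        "[([], Cup ?o, [t, s, ?o]), ([?o], Cross (flip d) x t, [s, ?o])]" "[?o, t]" "[]" "[]"]
    by simp
  also have "E [t, s, ?o] [?o, t, s] \<dots>
      [([], Cup ?o, [t, s, ?o]), ([?o, x, t], Cross c s ?o, []),
       ([?o], Cross (flip d) x t, [?o, s]), ([?o, t], Cap x, [s])]"
    using E_context[OF E_interchange[of "Cross (flip d) x t" "[]" "Cross c s ?o"], of _
        "[([], Cup ?o, [t, s, ?o])]" "[?o]" "[]" "[([?o, t], Cap x, [s])]"]
    by simp
  also have "E [t, s, ?o] [?o, t, s] \<dots>
      [([], Cup ?o, [t, s, ?o]), ([?o, x, t], Cross c s ?o, []),
       ([?o, x], Cross d t ?o, [s]), ([?o], Cap x, [t, s])]"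
    using E_context[OF E_switch_max[of x t d, THEN E_sym], of _
        "[([], Cup ?o, [t, s, ?o]), ([?o, x, t], Cross c s ?o, [])]" "[?o]" "[s]" "[]"]
    by simp
  also have "E [t, s, ?o] [?o, t, s] \<dots>
      [([t], Cross c s ?o, []), ([], Cup ?o, [t, ?o, s]),
       ([?o, x], Cross d t ?o, [s]), ([?o], Cap x, [t, s])]"
    using E_context[OF E_interchange[of "Cup ?o" "[t]" "Cross c s ?o"], of _
        "[]" "[]" "[]" "[([?o, x], Cross d t ?o, [s]), ([?o], Cap x, [t, s])]"]
    by simp
  also have "E [t, s, ?o] [?o, t, s] \<dots>
      [([t], Cross c s ?o, []), ([], Cross d t ?o, [s]), ([], Cup ?o, [?o, t, s]), ([?o], Cap x, [t, s])]"
    using E_context[OF E_interchange[of "Cup ?o" "[]" "Cross d t ?o"], of _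
        "[([t], Cross c s ?o, [])]" "[]" "[s]" "[([?o], Cap x, [t, s])]"]
    by simp
  also have "E [t, s, ?o] [?o, t, s] \<dots> [([t], Cross c s ?o, []), ([], Cross d t ?o, [s])]"
    using E_context[OF E_cancel2[of ?o], of _ "[([t], Cross c s ?o, []), ([], Cross d t ?o, [s])]"
        "[]" "[t, s]" "[]"]
    by simp
  finally show ?thesis
    by (rule E_sym)
qed

text \<open>
  Reversal of the third strand. Bent as in \<open>E_turn\<close>, it has the opposite sign in the part
  that crosses the others and starts to the left of them there, so the move for the strands in the
  order 3, 1, 2 applies to this part.
\<close>

lemma braid_turn:
  assumes "braid (flip c13) (flip c23) c12 x s1 s2"
  shows "braid c12 c13 c23 s1 s2 (opp x)"
proof -
  let ?o = "opp x"
  let ?p = "[s1, s2, ?o]" and ?q = "[?o, s2, s1]"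
  have "E ?p ?q
      [([], Cross c12 s1 s2, [?o]), ([s2], Cross c13 s1 ?o, []), ([], Cross c23 s2 ?o, [s1])]
      [([], Cross c12 s1 s2, [?o]), ([], Cup ?o, [s2, s1, ?o]), ([?o], Cross (flip c23) x s2, [s1, ?o]),
       ([?o, s2], Cross (flip c13) x s1, [?o]), ([?o, s2, s1], Cap x, [])]"
    using E_context[OF E_turn[of s2 s1 x c13 c23], of _ "[([], Cross c12 s1 s2, [?o])]" "[]" "[]" "[]"]
    by simp
  also have "E ?p ?q \<dots>
      [([], Cup ?o, [s1, s2, ?o]), ([?o, x], Cross c12 s1 s2, [?o]), ([?o], Cross (flip c23) x s2, [s1, ?o]),
       ([?o, s2], Cross (flip c13) x s1, [?o]), ([?o, s2, s1], Cap x, [])]"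
    using E_context[OF E_interchange[of "Cup ?o" "[]" "Cross c12 s1 s2", THEN E_sym], of _
        "[]" "[]" "[?o]" "[([?o], Cross (flip c23) x s2, [s1, ?o]),
          ([?o, s2], Cross (flip c13) x s1, [?o]), ([?o, s2, s1], Cap x, [])]"]
    by simp
  also have "E ?p ?q \<dots>
      [([], Cup ?o, [s1, s2, ?o]), ([?o], Cross (flip c13) x s1, [s2, ?o]),
       ([?o, s1], Cross (flip c23) x s2, [?o]), ([?o], Cross c12 s1 s2, [x, ?o]), ([?o, s2, s1], Cap x, [])]"
    using E_context[OF assms[unfolded braid_def, THEN E_sym], of _ "[([], Cup ?o, [s1, s2, ?o])]"
        "[?o]" "[?o]" "[([?o, s2, s1], Cap x, [])]"]
    by simp
  also have "E ?p ?q \<dots>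
      [([], Cup ?o, [s1, s2, ?o]), ([?o], Cross (flip c13) x s1, [s2, ?o]),
       ([?o, s1], Cross (flip c23) x s2, [?o]), ([?o, s1, s2], Cap x, []), ([?o], Cross c12 s1 s2, [])]"
    using E_context[OF E_interchange[of "Cross c12 s1 s2" "[]" "Cap x"], of _
        "[([], Cup ?o, [s1, s2, ?o]), ([?o], Cross (flip c13) x s1, [s2, ?o]),
          ([?o, s1], Cross (flip c23) x s2, [?o])]" "[?o]" "[]" "[]"]
    by simp
  also have "E ?p ?q \<dots>
      [([s1], Cross c23 s2 ?o, []), ([], Cross c13 s1 ?o, [s2]), ([?o], Cross c12 s1 s2, [])]"
    using E_context[OF E_turn[of s1 s2 x c23 c13, THEN E_sym], of _ "[]" "[]" "[]"
        "[([?o], Cross c12 s1 s2, [])]"]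
    by simp
  finally show ?thesis
    unfolding braid_def .
qed

lemma braid_opp3: "braid c12 c13 c23 s1 s2 s3 \<Longrightarrow> braid c12 c13 c23 s1 s2 (opp s3)"
  by (rule braid_turn, rule braid_swap12, rule braid_swap23) simp

lemma braid_opp2: "braid c12 c13 c23 s1 s2 s3 \<Longrightarrow> braid c12 c13 c23 s1 (opp s2) s3"
  using braid_swap23[OF braid_opp3[OF braid_swap23]] by simp

lemma braid_opp1: "braid c12 c13 c23 s1 s2 s3 \<Longrightarrow> braid c12 c13 c23 (opp s1) s2 s3"
  using braid_swap12[OF braid_opp2[OF braid_swap12]] by simp

lemma braid_SlashOver: "braid SlashOver SlashOver SlashOver s1 s2 s3"
proof -
  have 0: "braid SlashOver SlashOver SlashOver Up Up Up"
    using E_braid by (simp add: braid_def)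
  have 1: "braid SlashOver SlashOver SlashOver s1 Up Up"
    using 0 braid_opp1[OF 0] by (cases s1) simp_all
  have 2: "braid SlashOver SlashOver SlashOver s1 s2 Up"
    using 1 braid_opp2[OF 1] by (cases s2) simp_all
  show ?thesis
    using 2 braid_opp3[OF 2] by (cases s3) simp_all
qed

text \<open>
  The six admissible choices of crossing information are the six orders of the strands by height, and
  \<open>braid_swap12\<close> and \<open>braid_swap23\<close> act on them as the two transpositions that
  generate the symmetric group.
\<close>

lemma braid_all:
  assumes "c12 = c23 \<longrightarrow> c13 = c12"
  shows "braid c12 c13 c23 s1 s2 s3"
proof -
  let ?S = SlashOver and ?B = BackslashOver
  have BSS: "braid ?B ?S ?S s1 s2 s3" for s1 s2 s3
    using braid_swap12[OF braid_SlashOver] by simp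
  have SSB: "braid ?S ?S ?B s1 s2 s3" for s1 s2 s3
    using braid_swap23[OF braid_SlashOver] by simp
  have SBB: "braid ?S ?B ?B s1 s2 s3" for s1 s2 s3
    using braid_swap23[OF BSS] by simp
  have BBS: "braid ?B ?B ?S s1 s2 s3" for s1 s2 s3
    using braid_swap12[OF SSB] by simp
  have BBB: "braid ?B ?B ?B s1 s2 s3" for s1 s2 s3
    using braid_swap12[OF SBB] by simp
  show ?thesis
    using assms braid_SlashOver BSS SSB SBB BBS BBB
    by (cases c12; cases c13; cases c23) simp_all
qed

lemma E_tangle_move:
  assumes "tangle_move w w'"
  shows "\<exists>p q. E p q w w' \<and> path p w q \<and> w \<noteq> []"
  using assms
proof cases
  case isotopy
  then show ?thesis
    using E_interchange by cases fastforce
next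
  case (cancel1 s)
  then show ?thesis
    using E_cancel1[of s] by (intro exI[of _ "[s]"]) simp
next
  case (cancel2 s)
  then show ?thesis
    using E_cancel2[of s] by (intro exI[of _ "[s]"]) simp
next
  case (reidemeister2 c s t)
  then show ?thesis
    using E_reidemeister2[of s t c] by (intro exI[of _ "[s, t]"]) simp
next
  case (reidemeister3 c12 c23 c13 s1 s2 s3)
  then show ?thesis
    using braid_all[of c12 c23 c13 s1 s2 s3]
    by (intro exI[of _ "[s1, s2, s3]"] exI[of _ "[s3, s2, s1]"]) (simp add: braid_def)
next
  case (switch_max s c t)
  then show ?thesis
    using E_switch_max[of s t c] by (intro exI[of _ "[s, t, opp s]"] exI[of _ "[t]"]) simp
next
  case (switch_min s t c)
  then show ?thesis
    using E_switch_min[of t s c] by (intro exI[of _ "[t]"] exI[of _ "[s, t, opp s]"]) simp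
qed

text \<open>
  A move in context is only required to be well typed as a whole. As the left-hand side of a move is
  not empty, it determines the strands it acts on.
\<close>

lemma path_unique: "path p w q \<Longrightarrow> path p w q' \<Longrightarrow> q = q'"
  by (induction w arbitrary: p) auto

lemma path_whisker_unique:
  assumes "path p w q" "w \<noteq> []" "path m (whisker l w r) n"
  shows "m = l @ p @ r" "n = l @ q @ r"
proof -
  show m: "m = l @ p @ r"
    using assms by (cases w) auto
  show "n = l @ q @ r"
    using path_unique path_whisker[OF assms(1)] assms(3) m by blast
qed

theorem E_regularly_isotopic:
  assumes "regularly_isotopic p q w w'"
  shows "E p q w w'"
  using assms
proof induction
  case (refl w)
  then show ?case
    by (simp add: diagrams_def E_refl)
next
  case (sym w w')
  then show ?case
    by (blast intro: E_sym)
next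
  case (trans w w' w'')
  then show ?case
    by (blast intro: E_trans)
next
  case (move w w' u l r v)
  obtain p0 q0 where E: "E p0 q0 w w'" and w: "path p0 w q0" "w \<noteq> []"
    using E_tangle_move[OF move(1)] by blast
  obtain m n where "path p u m" "path m (whisker l w r) n" "path n v q"
    using move(2) by (auto simp: diagrams_def path_append)
  then show ?case
    using path_whisker_unique[OF w] E_context[OF E] by blast
qed

end

section \<open>Calculus in tensor powers\<close>

lemma tensors_lin_ext:
  "(\<And>w. w \<in> Poly_Mapping.keys x \<Longrightarrow> f w \<in> tensors n) \<Longrightarrow> lin_ext f x \<in> tensors n"
  using keys_lin_ext[of f x] by (fastforce simp: tensors_def)

lemma tensors_basis: "length w = n \<Longrightarrow> basis w \<in> tensors n"
  by (simp add: tensors_def)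

lemma tensors_length: "x \<in> tensors n \<Longrightarrow> w \<in> Poly_Mapping.keys x \<Longrightarrow> length w = n"
  by (simp add: tensors_def)

lemma length_2: "length w = 2 \<longleftrightarrow> (\<exists>a b. w = [a, b])"
  by (auto simp: numeral_2_eq_2 length_Suc_conv)

text \<open>
  All identities between representatives of elements of \<open>A \<otimes> A\<close> below are checked on pure
  tensors \<open>a \<otimes> b\<close>, without touching the finite sums.
\<close>

lemma lin_ext_cong_2:
  assumes "x \<in> tensors 2" "\<And>a b. f [a, b] = g [a, b]"
  shows "lin_ext f x = lin_ext g x"
  using assms by (intro lin_ext_cong) (auto simp: tensors_def length_2)

lemma lin_ext_id_2:
  assumes "x \<in> tensors 2" "\<And>a b. f [a, b] = basis [a, b]"
  shows "lin_ext f x = x"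
  using lin_ext_cong_2[OF assms(1), of f basis] assms(2) by (simp add: lin_ext_self)

definition tensor_swap :: "('a list \<Rightarrow>\<^sub>0 'k) \<Rightarrow> ('a list \<Rightarrow>\<^sub>0 'k::{comm_ring,comm_monoid_mult})" where
  "tensor_swap = lin_ext (\<lambda>w. basis [w ! 1, w ! 0])"

lemma tensors_swap [simp]: "tensor_swap x \<in> tensors 2"
  unfolding tensor_swap_def by (rule tensors_lin_ext, rule tensors_basis) simp

lemma tensors_map [simp]: "x \<in> tensors n \<Longrightarrow> length fs = n \<Longrightarrow> tensor_map fs x \<in> tensors n"
  unfolding tensor_map_def by (rule tensors_lin_ext, rule tensors_basis) (simp add: tensors_length)

lemma tensors_mult [simp]:
  "x \<in> tensors n \<Longrightarrow> y \<in> tensors n \<Longrightarrow> length ms = n \<Longrightarrow> tensor_mult ms x y \<in> tensors n"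
  unfolding tensor_mult_def
  by (rule tensors_lin_ext, rule tensors_lin_ext, rule tensors_basis) (simp add: tensors_length)

lemma tensor_swap_swap [simp]: "x \<in> tensors 2 \<Longrightarrow> tensor_swap (tensor_swap x) = x"
  unfolding tensor_swap_def by (simp add: lin_ext_lin_ext lin_ext_id_2)

lemma tensor_swap_map:
  "x \<in> tensors 2 \<Longrightarrow> tensor_swap (tensor_map [f, g] x) = tensor_map [g, f] (tensor_swap x)"
  unfolding tensor_swap_def tensor_map_def
  by (simp add: lin_ext_lin_ext) (rule lin_ext_cong_2, simp_all)

lemma tensor_map_map:
  "x \<in> tensors 2 \<Longrightarrow> tensor_map [f, g] (tensor_map [f', g'] x) = tensor_map [f \<circ> f', g \<circ> g'] x"
  unfolding tensor_map_def by (simp add: lin_ext_lin_ext) (rule lin_ext_cong_2, simp_all)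

lemma tensor_map_id: "x \<in> tensors 2 \<Longrightarrow> tensor_map [id, id] x = x"
  unfolding tensor_map_def by (rule lin_ext_id_2) simp_all

lemma tensor_map_mult:
  assumes "x \<in> tensors 2" "y \<in> tensors 2"
    and "\<And>a b. f (m a b) = m (f a) (f b)" "\<And>a b. g (m' a b) = m' (g a) (g b)"
  shows "tensor_map [f, g] (tensor_mult [m, m'] x y) =
    tensor_mult [m, m'] (tensor_map [f, g] x) (tensor_map [f, g] y)"
  unfolding tensor_map_def tensor_mult_def
  by (simp add: lin_ext_lin_ext) (intro lin_ext_cong_2 assms, simp add: assms)

lemma tensor_swap_mult:
  assumes "x \<in> tensors 2" "y \<in> tensors 2"
  shows "tensor_swap (tensor_mult [m, m'] x y) = tensor_mult [m', m] (tensor_swap x) (tensor_swap y)"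
  unfolding tensor_swap_def tensor_mult_def
  by (simp add: lin_ext_lin_ext) (intro lin_ext_cong_2 assms, simp)

lemma tensor_mult_op:
  assumes "x \<in> tensors 2" "y \<in> tensors 2" "\<And>a b. n a b = m b a" "\<And>a b. n' a b = m' b a"
  shows "tensor_mult [n, n'] x y = tensor_mult [m, m'] y x"
  unfolding tensor_mult_def
  by (subst lin_ext_commute) (intro lin_ext_cong_2 assms, simp add: assms)

lemma tensor_mult_assoc:
  assumes "x \<in> tensors 2" "y \<in> tensors 2" "z \<in> tensors 2"
  shows "tensor_mult [(*), (*)] (tensor_mult [(*), (*)] x y) z =
    tensor_mult [(*), (*)] x (tensor_mult [(*), (*)] y (z :: 'a::monoid_mult list \<Rightarrow>\<^sub>0 'k::{comm_ring,comm_monoid_mult}))"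
  unfolding tensor_mult_def
  by (simp add: lin_ext_lin_ext) (intro lin_ext_cong_2 assms, simp add: mult.assoc)

lemma tensor_mult_one:
  assumes "x \<in> tensors 2"
  shows "tensor_mult [(*), (*)] (basis [1, 1]) x = x"
    and "tensor_mult [(*), (*)] x (basis [1, 1]) =
      (x :: 'a::monoid_mult list \<Rightarrow>\<^sub>0 'k::{comm_ring,comm_monoid_mult})"
  unfolding tensor_mult_def using assms by (simp_all add: lin_ext_id_2)

lemma tensor_eq_refl: "x \<in> tensors n \<Longrightarrow> tensor_eq scale n x x"
  by (simp add: tensor_eq_def submodule_span.zero)

lemma tensor_eq_sym: "tensor_eq scale n x y \<Longrightarrow> tensor_eq scale n y x"
  using span_minus[of "x - y" "multilinear_rels scale n"] by (simp add: tensor_eq_def)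

lemma tensor_eq_trans [trans]:
  "tensor_eq scale n x y \<Longrightarrow> tensor_eq scale n y z \<Longrightarrow> tensor_eq scale n x z"
  using span_add[of "x - y" "multilinear_rels scale n" "y - z"] by (simp add: tensor_eq_def)

lemma tensor_eq_tensors:
  "tensor_eq scale n x y \<Longrightarrow> x \<in> tensors n" "tensor_eq scale n x y \<Longrightarrow> y \<in> tensors n"
  by (simp_all add: tensor_eq_def)

lemma tensor_eq_lin_ext:
  assumes "\<And>w. w \<in> Poly_Mapping.keys x \<Longrightarrow> tensor_eq scale n (f w) (g w)"
  shows "tensor_eq scale n (lin_ext f x) (lin_ext g x)"
  using assms span_lin_ext[of x "\<lambda>w. f w - g w" "multilinear_rels scale n"]
  by (simp add: tensor_eq_def tensors_lin_ext lin_ext_fun_diff)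

lemma tensor_eq_lin_image:
  assumes "tensor_eq scale n x y" "lin_ext f x \<in> tensors m" "lin_ext f y \<in> tensors m"
    and "\<And>g. g \<in> multilinear_rels scale n \<Longrightarrow> lin_ext f g \<in> multilinear_rels scale m"
  shows "tensor_eq scale m (lin_ext f x) (lin_ext f y)"
  using assms span_image[of "x - y" "multilinear_rels scale n" f "multilinear_rels scale m"]
  by (simp add: tensor_eq_def lin_ext_diff span_generator)

lemma multilinear_rels_cases:
  assumes "g \<in> multilinear_rels scale n"
  obtains (add) u a b v where "length u + 1 + length v = n"
      "g = basis (u @ [a + b] @ v) - basis (u @ [a] @ v) - basis (u @ [b] @ v)"
    | (scale) u c a v where "length u + 1 + length v = n"
      "g = basis (u @ [scale c a] @ v) - smul c (basis (u @ [a] @ v))"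
  using assms unfolding multilinear_rels_def by blast

lemma tensor_eq_swap:
  assumes "tensor_eq scale 2 x y"
  shows "tensor_eq scale 2 (tensor_swap x) (tensor_swap y)"
  unfolding tensor_swap_def
proof (rule tensor_eq_lin_image[OF assms])
  fix g
  assume "g \<in> multilinear_rels scale 2"
  then show "lin_ext (\<lambda>w. basis [w ! 1, w ! 0]) g \<in> multilinear_rels scale 2"
  proof (cases rule: multilinear_rels_cases)
    case (add u a b v)
    then consider x where "u = []" "v = [x]" | x where "u = [x]" "v = []"
      by (cases u; cases v) auto
    then show ?thesis
    proof cases
      case 1
      with add have "lin_ext (\<lambda>w. basis [w ! 1, w ! 0]) g =
          basis ([x] @ [a + b] @ []) - basis ([x] @ [a] @ []) - basis ([x] @ [b] @ [])"
        by (simp add: lin_ext_diff)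
      then show ?thesis
        unfolding multilinear_rels_def by fastforce
    next
      case 2
      with add have "lin_ext (\<lambda>w. basis [w ! 1, w ! 0]) g =
          basis ([] @ [a + b] @ [x]) - basis ([] @ [a] @ [x]) - basis ([] @ [b] @ [x])"
        by (simp add: lin_ext_diff)
      then show ?thesis
        unfolding multilinear_rels_def by fastforce
    qed
  next
    case (scale u c a v)
    then consider x where "u = []" "v = [x]" | x where "u = [x]" "v = []"
      by (cases u; cases v) auto
    then show ?thesis
    proof cases
      case 1
      with scale have "lin_ext (\<lambda>w. basis [w ! 1, w ! 0]) g =
          basis ([x] @ [scale c a] @ []) - smul c (basis ([x] @ [a] @ []))"
        by (simp add: lin_ext_diff lin_ext_smul)
      then show ?thesis
        unfolding multilinear_rels_def by fastforce
    next
      case 2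
      with scale have "lin_ext (\<lambda>w. basis [w ! 1, w ! 0]) g =
          basis ([] @ [scale c a] @ [x]) - smul c (basis ([] @ [a] @ [x]))"
        by (simp add: lin_ext_diff lin_ext_smul)
      then show ?thesis
        unfolding multilinear_rels_def by fastforce
    qed
  qed
qed (fold tensor_swap_def, simp_all)

definition linear_map ::
    "('k::{comm_ring,comm_monoid_mult} \<Rightarrow> 'a::{ring,monoid_mult} \<Rightarrow> 'a) \<Rightarrow> ('a \<Rightarrow> 'a) \<Rightarrow> bool" where
  "linear_map scale f \<longleftrightarrow> (\<forall>x y. f (x + y) = f x + f y) \<and> (\<forall>c x. f (scale c x) = scale c (f x))"

lemma tensor_eq_map:
  assumes "tensor_eq scale n x y" "length fs = n" and linear: "\<forall>f\<in>set fs. linear_map scale f"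
  shows "tensor_eq scale n (tensor_map fs x) (tensor_map fs y)"
  unfolding tensor_map_def
proof (rule tensor_eq_lin_image[OF assms(1)])
  fix g
  assume g: "g \<in> multilinear_rels scale n"
  let ?F = "\<lambda>fs w. map2 (\<lambda>f a. f a) fs w"
  have split: "\<exists>fs1 f fs2. fs = fs1 @ [f] @ fs2 \<and> length fs1 = length u \<and> length fs2 = length v \<and> linear_map scale f"
    if "length u + 1 + length v = n" for u v :: "'b list"
  proof -
    have "take (length u) fs @ [fs ! length u] @ drop (Suc (length u)) fs = fs"
      using that assms(2) by (simp add: id_take_nth_drop[symmetric])
    moreover have "fs ! length u \<in> set fs"
      using that assms(2) by simp
    ultimately show ?thesis
      using that assms(2) linear
      by (intro exI[of _ "take (length u) fs"] exI[of _ "fs ! length u"] exI[of _ "drop (Suc (length u)) fs"]) auto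
  qed
  from g show "lin_ext (\<lambda>w. basis (?F fs w)) g \<in> multilinear_rels scale n"
  proof (cases rule: multilinear_rels_cases)
    case (add u a b v)
    obtain fs1 f fs2 where fs: "fs = fs1 @ [f] @ fs2" "length fs1 = length u" "length fs2 = length v"
      and "linear_map scale f"
      using split[OF add(1)] by blast
    then have f: "f (a + b) = f a + f b"
      by (simp add: linear_map_def)
    have "lin_ext (\<lambda>w. basis (?F fs w)) g = basis (?F fs1 u @ [f a + f b] @ ?F fs2 v)
        - basis (?F fs1 u @ [f a] @ ?F fs2 v) - basis (?F fs1 u @ [f b] @ ?F fs2 v)"
      using fs f by (simp add: add(2) lin_ext_diff)
    moreover have "length (?F fs1 u) + 1 + length (?F fs2 v) = n"
      using fs add(1) by simp
    ultimately show ?thesis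
      unfolding multilinear_rels_def by blast
  next
    case (scale u c a v)
    obtain fs1 f fs2 where fs: "fs = fs1 @ [f] @ fs2" "length fs1 = length u" "length fs2 = length v"
      and "linear_map scale f"
      using split[OF scale(1)] by blast
    then have f: "f (scale c a) = scale c (f a)"
      by (simp add: linear_map_def)
    have "lin_ext (\<lambda>w. basis (?F fs w)) g = basis (?F fs1 u @ [scale c (f a)] @ ?F fs2 v)
        - smul c (basis (?F fs1 u @ [f a] @ ?F fs2 v))"
      using fs f by (simp add: scale(2) lin_ext_diff lin_ext_smul)
    moreover have "length (?F fs1 u) + 1 + length (?F fs2 v) = n"
      using fs scale(1) by simp
    ultimately show ?thesis
      unfolding multilinear_rels_def by blast
  qed
qed (use assms in \<open>simp_all add: tensor_eq_tensors flip: tensor_map_def\<close>)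

text \<open>
  For a fixed pure tensor on one side, multiplication by it is a tensor product of linear maps, so
  compatibility with multilinearity reduces to that of \<open>tensor_map\<close>.
\<close>

lemma tensor_eq_mult:
  assumes x: "tensor_eq scale 2 x x'" and y: "tensor_eq scale 2 y y'"
    and linear: "\<And>a. linear_map scale (m a)" "\<And>a. linear_map scale (m' a)"
      "\<And>b. linear_map scale (\<lambda>a. m a b)" "\<And>b. linear_map scale (\<lambda>a. m' a b)"
  shows "tensor_eq scale 2 (tensor_mult [m, m'] x y) (tensor_mult [m, m'] x' y')"
proof -
  note tensors = tensor_eq_tensors[OF x] tensor_eq_tensors[OF y]
  have left: "tensor_mult [m, m'] x z = lin_ext (\<lambda>u. tensor_map [m (u ! 0), m' (u ! 1)] z) x"
    if "z \<in> tensors 2" for z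
    unfolding tensor_mult_def tensor_map_def using that tensors by (intro lin_ext_cong_2) simp_all
  have right: "tensor_mult [m, m'] z y' = lin_ext (\<lambda>v. tensor_map [\<lambda>a. m a (v ! 0), \<lambda>a. m' a (v ! 1)] z) y'"
    if "z \<in> tensors 2" for z
    unfolding tensor_mult_def tensor_map_def using that tensors
    by (subst lin_ext_commute) (intro lin_ext_cong_2, simp_all)
  have "tensor_eq scale 2 (tensor_mult [m, m'] x y) (tensor_mult [m, m'] x y')"
    using tensors linear by (auto simp: left intro!: tensor_eq_lin_ext tensor_eq_map[OF y])
  also have "tensor_eq scale 2 (tensor_mult [m, m'] x y') (tensor_mult [m, m'] x' y')"
    using tensors linear by (auto simp: right intro!: tensor_eq_lin_ext tensor_eq_map[OF x])
  finally show ?thesis .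
qed

section \<open>Beads on vertical strands and at crossings\<close>

text \<open>
  The \<open>i\<close>-th entry of a list decorates the \<open>i\<close>-th of the strands \<open>p\<close>, from
  left to right and from bottom to top. Excess strands or entries are ignored.
\<close>

fun beads :: "sign list \<Rightarrow> 'a list \<Rightarrow> 'a bead_event diagram" where
  "beads (s # p) (a # w) = ([], Bead a s, p) # whisker [s] (beads p w) []"
| "beads p w = []"

definition bead_sum ::
    "sign list \<Rightarrow> ('a list \<Rightarrow>\<^sub>0 'k) \<Rightarrow> ('a bead_event diagram \<Rightarrow>\<^sub>0 'k::{comm_ring,comm_monoid_mult})" where
  "bead_sum p = lin_ext (\<lambda>w. basis (beads p w))"

text \<open>
  The strand of sign \<open>s\<close> carries the algebra \<open>A\<close> or its opposite, since on a downward
  strand the upper bead is met first.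
\<close>

definition strand_mult :: "sign \<Rightarrow> 'a::times \<Rightarrow> 'a \<Rightarrow> 'a" where
  "strand_mult s = (case s of Up \<Rightarrow> (*) | Down \<Rightarrow> op_mult)"

lemma strand_mult_simps [simp]:
  "strand_mult Up a b = a * b" "strand_mult Down a b = b * a"
  by (simp_all add: strand_mult_def op_mult_def)

lemma path_appendI: "path p u m \<Longrightarrow> path m v q \<Longrightarrow> path p (u @ v) q"
  by (auto simp: path_append)

lemma bead_sum_diff: "bead_sum p (x - y) = bead_sum p x - bead_sum p y"
  by (simp add: bead_sum_def lin_ext_diff)

lemma path_beads: "path p (beads p w) p"
proof (induction p w rule: beads.induct)
  case (1 s p a w)
  then show ?case
    using path_whisker[of p "beads p w" p "[s]" "[]"] by simp
qed simp_all

lemma path_whisker_beads: "path (l @ p @ r) (whisker l (beads p w) r) (l @ p @ r)"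
  by (rule path_whisker[OF path_beads])

lemma beads_append:
  "length p = length w \<Longrightarrow>
    beads (p @ p') (w @ w') = whisker [] (beads p w) p' @ whisker p (beads p' w') []"
  by (induction p w rule: list_induct2) simp_all

lemma formal_sums_bead_sum: "bead_sum p z \<in> formal_sums p p"
  unfolding bead_sum_def
  by (intro formal_sums_lin_ext formal_sums_basis) (simp add: diagrams_def path_beads)

context bead_calculus
begin

lemma ceq_stack_mid:
  assumes "ceq q r y y'" "x \<in> formal_sums p q" "z \<in> formal_sums r s"
  shows "ceq p s (stack x (stack y z)) (stack x (stack y' z))"
  by (rule ceq_stack[OF ceq_refl[OF assms(2)] ceq_stack[OF assms(1) ceq_refl[OF assms(3)]]])

lemma deq_mult:
  "deq [s] [s] [([], Bead a s, []), ([], Bead b s, [])] [([], Bead (strand_mult s a b) s, [])]"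
  by (cases s) (auto intro!: deq_rel bead_rel.mult_up bead_rel.mult_down)

lemma deq_unit:
  assumes "path p u (l @ s # r)" "path (l @ s # r) v q"
  shows "deq p q (u @ [(l, Bead 1 s, r)] @ v) (u @ v)"
  using deq_context[OF deq_rel[OF bead_rel.unit, of "[s]" s "[s]"], of p u l r v q] assms
  by simp

lemma deq_beads_mult:
  assumes "length u = length p" "length v = length p"
  shows "deq p p (beads p u @ beads p v)
    (beads p (map2 (\<lambda>m (a, b). m a b) (map strand_mult p) (zip u v)))"
  using assms
proof (induction p arbitrary: u v)
  case Nil
  then show ?case
    by (simp add: deq_refl)
next
  case (Cons s p)
  then obtain a u' b v' where uv: "u = a # u'" "v = b # v'" and len: "length u' = length p" "length v' = length p"
    by (auto simp: length_Suc_conv)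
  let ?u = "whisker [s] (beads p u') []" and ?v = "whisker [s] (beads p v') []"
  have path: "path (s # p) (whisker [s] (beads p w) []) (s # p)" for w :: "'a list"
    using path_whisker_beads[of "[s]" p "[]" w] by simp
  have swap: "deq (s # p) (s # p) (?u @ [([], Bead b s, p)]) ([([], Bead b s, p)] @ ?u)"
    using ceq_sym[OF deq_interchange[of "[s]" "[([], Bead b s, [])]" "[s]" p "beads p u'" p "[]"]]
    by (simp add: path_beads)
  have "deq (s # p) (s # p) ([([], Bead a s, p)] @ (?u @ [([], Bead b s, p)]) @ ?v)
      ([([], Bead a s, p)] @ ([([], Bead b s, p)] @ ?u) @ ?v)"
    by (intro deq_append[OF deq_refl deq_append[OF swap deq_refl]]) (simp_all add: path)
  also have "[([], Bead a s, p)] @ ([([], Bead b s, p)] @ ?u) @ ?v =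
      [([], Bead a s, p), ([], Bead b s, p)] @ whisker [s] (beads p u' @ beads p v') []"
    by simp
  also have "deq (s # p) (s # p) \<dots> ([([], Bead (strand_mult s a b) s, p)] @
      whisker [s] (beads p (map2 (\<lambda>m (a, b). m a b) (map strand_mult p) (zip u' v'))) [])"
    using deq_append[of "s # p" "s # p" _ _ "s # p"] deq_whisker[OF deq_mult[of s a b], of "[]" p]
      deq_whisker[OF Cons.IH[OF len], of "[s]" "[]"]
    by fastforce
  finally show ?case
    by (simp add: uv)
qed

text \<open>
  Thus \<open>bead_sum p\<close> is a homomorphism from the tensor product of the algebras carried by the
  strands \<open>p\<close>. Together with \<open>bead_sum_tensor_eq\<close> this turns identities of tensors
  into identities of decorated tangles.
\<close>

lemma bead_sum_mult:
  assumes "length p = n" "x \<in> tensors n" "y \<in> tensors n"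
  shows "ceq p p (stack (bead_sum p x) (bead_sum p y)) (bead_sum p (tensor_mult (map strand_mult p) x y))"
proof -
  have "stack (bead_sum p x) (bead_sum p y) = lin_ext (\<lambda>u. lin_ext (\<lambda>v. basis (beads p u @ beads p v)) y) x"
    by (simp add: bead_sum_def stack_def lin_ext_lin_ext)
  moreover have "bead_sum p (tensor_mult (map strand_mult p) x y) =
      lin_ext (\<lambda>u. lin_ext (\<lambda>v. basis (beads p (map2 (\<lambda>m (a, b). m a b) (map strand_mult p) (zip u v)))) y) x"
    by (simp add: bead_sum_def tensor_mult_def lin_ext_lin_ext)
  ultimately show ?thesis
    using assms by (simp only:) (intro ceq_lin_ext deq_beads_mult; simp add: tensors_length)
qed

lemma bead_sum_tensor_eq:
  assumes n: "length p = n" and "tensor_eq scale n x y"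
  shows "ceq p p (bead_sum p x) (bead_sum p y)"
proof -
  have "bead_sum p (x - y) \<in> submodule_span (cat_rels scale D U p p)"
    unfolding bead_sum_def
  proof (rule span_image)
    show "x - y \<in> submodule_span (multilinear_rels scale n)"
      using assms by (simp add: tensor_eq_def)
  next
    fix g
    assume "g \<in> multilinear_rels scale n"
    then obtain u v where len: "length u + 1 + length v = length p" and
      g: "(\<exists>a b. g = basis (u @ [a + b] @ v) - basis (u @ [a] @ v) - basis (u @ [b] @ v)) \<or>
        (\<exists>c a. g = basis (u @ [scale c a] @ v) - smul c (basis (u @ [a] @ v)))"
      unfolding n by (cases rule: multilinear_rels_cases) blast+
    \<comment> \<open>The strand \<open>s\<close> carries the factor in which the relation is linear.\<close>
  define l s r where "l = take (length u) p" "s = p ! length u" "r = drop (Suc (length u)) p"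
    have p: "p = l @ [s] @ r" and lens: "length l = length u" "length r = length v"
      unfolding l_s_r_def using len id_take_nth_drop[of "length u" p] by simp_all
    define C :: "('a bead_event diagram \<Rightarrow>\<^sub>0 'k) \<Rightarrow> ('a bead_event diagram \<Rightarrow>\<^sub>0 'k)"
      where "C = in_context (whisker [] (beads l u) (s # r)) l r (whisker (l @ [s]) (beads r v) [])"
    have C: "basis (beads p (u @ [a] @ v)) = C (basis [([], Bead a s, [])])" for a
      using lens by (simp add: p C_def beads_append)
    have ceq_C: "ceq p p (C x) (C y)" if "ceq [s] [s] x y" for x y
      unfolding C_def using that
      by (rule ceq_in_context)
        (use path_whisker_beads[of "[]" l "s # r" u]
          path_whisker_beads[of "l @ [s]" r "[]" v] in \<open>simp_all add: p\<close>)
    have bead: "basis [([], Bead a s, [])] \<in> formal_sums [s] [s]" for a :: 'a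
      by (intro formal_sums_basis) (simp add: diagrams_def)
    have add: "ceq [s] [s] (basis [([], Bead (a + b) s, [])])
        (basis [([], Bead a s, [])] + basis [([], Bead b s, [])])" for a b
      by (rule ceq_rel[OF bead_rel.add])
        (auto intro!: formal_sums_add bead)
    have scale: "ceq [s] [s] (basis [([], Bead (scale c a) s, [])])
        (smul c (basis [([], Bead a s, [])]))" for a c
      by (rule ceq_rel[OF bead_rel.scale])
        (auto intro!: formal_sums_smul bead)
    have linear: "C (x + y) = C x + C y" "C (smul c x) = smul c (C x)" for x y c
      by (simp_all add: C_def in_context_def lin_ext_add lin_ext_smul)
    show "lin_ext (\<lambda>w. basis (beads p w)) g \<in> submodule_span (cat_rels scale D U p p)"
      using g
    proof (elim disjE exE)
      fix a b
      assume "g = basis (u @ [a + b] @ v) - basis (u @ [a] @ v) - basis (u @ [b] @ v)"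
      then have "lin_ext (\<lambda>w. basis (beads p w)) g =
          C (basis [([], Bead (a + b) s, [])]) - C (basis [([], Bead a s, [])] + basis [([], Bead b s, [])])"
        by (simp only: lin_ext_diff lin_ext_add lin_ext_basis C linear diff_diff_eq)
      then show ?thesis
        using ceq_C[OF add] by (simp add: cat_eq_def)
    next
      fix c a
      assume "g = basis (u @ [scale c a] @ v) - smul c (basis (u @ [a] @ v))"
      then have "lin_ext (\<lambda>w. basis (beads p w)) g =
          C (basis [([], Bead (scale c a) s, [])]) - C (smul c (basis [([], Bead a s, [])]))"
        by (simp only: lin_ext_diff lin_ext_smul lin_ext_basis C linear)
      then show ?thesis
        using ceq_C[OF scale] by (simp add: cat_eq_def)
    qed
  qed
  then show ?thesis
    by (simp add: cat_eq_def formal_sums_bead_sum bead_sum_diff)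
qed

lemma bead_sum_one: "ceq [s, t] [s, t] (bead_sum [s, t] (basis [1, 1])) (basis [])"
proof -
  have "deq [s, t] [s, t] ([] @ [([], Bead 1 s, [t])] @ [([s], Bead 1 t, [])]) ([] @ [([s], Bead 1 t, [])])"
    by (rule deq_unit) simp_all
  also have "deq [s, t] [s, t] ([] @ [([s], Bead 1 t, [])]) []"
    using deq_unit[of "[s, t]" "[]" "[s]" t "[]" "[]" "[s, t]"] by simp
  finally show ?thesis
    by (simp add: bead_sum_def)
qed

lemma bead_sum_tensor12:
  "ceq [s, t, x] [s, t, x] (whisk [] (bead_sum [s, t] z) [x]) (bead_sum [s, t, x] (lin_ext (\<lambda>w. basis [w ! 0, w ! 1, 1]) z))"
  if "z \<in> tensors 2"
proof -
  have eq: "whisk [] (bead_sum [s, t] z) [x] = lin_ext (\<lambda>w. basis (whisker [] (beads [s, t] w) [x])) z"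
    "bead_sum [s, t, x] (lin_ext (\<lambda>w. basis [w ! 0, w ! 1, 1]) z) =
      lin_ext (\<lambda>w. basis (beads [s, t, x] [w ! 0, w ! 1, 1])) z"
    by (simp_all only: bead_sum_def in_context_lin_ext in_context_basis lin_ext_lin_ext lin_ext_basis
      append_Nil append_Nil2)
  have "deq [s, t, x] [s, t, x] (whisker [] (beads [s, t] w) [x]) (beads [s, t, x] [w ! 0, w ! 1, 1])"
    if len: "length w = 2" for w
  proof -
    obtain a b where w: "w = [a, b]"
      using len by (auto simp: length_2)
    show ?thesis
      using ceq_sym[OF deq_unit[of "[s, t, x]" "[([], Bead a s, [t, x]), ([s], Bead b t, [x])]" "[s, t]" x "[]" "[]" "[s, t, x]"]]
      by (simp add: w)
  qed
  then show ?thesis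
    unfolding eq using that by (intro ceq_lin_ext) (simp add: tensors_length)
qed

lemma bead_sum_tensor23:
  "ceq [x, s, t] [x, s, t] (whisk [x] (bead_sum [s, t] z) []) (bead_sum [x, s, t] (lin_ext (\<lambda>w. basis [1, w ! 0, w ! 1]) z))"
  if "z \<in> tensors 2"
proof -
  have eq: "whisk [x] (bead_sum [s, t] z) [] = lin_ext (\<lambda>w. basis (whisker [x] (beads [s, t] w) [])) z"
    "bead_sum [x, s, t] (lin_ext (\<lambda>w. basis [1, w ! 0, w ! 1]) z) =
      lin_ext (\<lambda>w. basis (beads [x, s, t] [1, w ! 0, w ! 1])) z"
    by (simp_all only: bead_sum_def in_context_lin_ext in_context_basis lin_ext_lin_ext lin_ext_basis
      append_Nil append_Nil2)
  have "deq [x, s, t] [x, s, t] (whisker [x] (beads [s, t] w) []) (beads [x, s, t] [1, w ! 0, w ! 1])"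
    if len: "length w = 2" for w
  proof -
    obtain a b where w: "w = [a, b]"
      using len by (auto simp: length_2)
    show ?thesis
      using ceq_sym[OF deq_unit[of "[x, s, t]" "[]" "[]" x "[s, t]" "[([x], Bead a s, [t]), ([x, s], Bead b t, [])]" "[x, s, t]"]]
      by (simp add: w)
  qed
  then show ?thesis
    unfolding eq using that by (intro ceq_lin_ext) (simp add: tensors_length)
qed

lemma deq_crossing_slide:
  "deq [s, t] [t, s] (beads [s, t] [a, b] @ [([], FCross s t, [])])
    (([], FCross s t, []) # beads [t, s] [b, a])"
proof -
  let ?X = "([], FCross s t, [])"
  have "deq [s, t] [t, s] ([([], Bead a s, [t])] @ [([s], Bead b t, []), ?X])
      ([([], Bead a s, [t])] @ [?X, ([], Bead b t, [s])])"
    by (rule deq_append[OF deq_refl deq_rel[OF bead_rel.cross_right]]) simp_all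
  also have "[([], Bead a s, [t])] @ [?X, ([], Bead b t, [s])] = [([], Bead a s, [t]), ?X] @ [([], Bead b t, [s])]"
    by simp
  also have "deq [s, t] [t, s] ([([], Bead a s, [t]), ?X] @ [([], Bead b t, [s])])
      ([?X, ([t], Bead a s, [])] @ [([], Bead b t, [s])])"
    by (rule deq_append[OF deq_rel[OF bead_rel.cross_left] deq_refl]) simp_all
  also have "[?X, ([t], Bead a s, [])] @ [([], Bead b t, [s])] = [?X] @ [([t], Bead a s, []), ([], Bead b t, [s])]"
    by simp
  also have "deq [s, t] [t, s] ([?X] @ [([t], Bead a s, []), ([], Bead b t, [s])])
      ([?X] @ [([], Bead b t, [s]), ([t], Bead a s, [])])"
    using deq_append[OF deq_refl ceq_sym[OF deq_interchange_events[of "Bead b t" "[]" "Bead a s"]],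
        of "[s, t]" "[?X]"]
    by simp
  finally show ?thesis
    by simp
qed

lemma deq_beads_crossing:
  assumes "length u = length l" "length v = length r"
  shows "deq (l @ [s, t] @ r) (l @ [t, s] @ r) (beads (l @ [s, t] @ r) (u @ [a, b] @ v) @ [(l, FCross s t, r)])
    ((l, FCross s t, r) # beads (l @ [t, s] @ r) (u @ [b, a] @ v))"
proof -
  let ?X = "[(l, FCross s t, r)]"
  let ?u = "\<lambda>p. whisker [] (beads l u) (p @ r)"
    and ?v = "\<lambda>p. whisker (l @ p) (beads r v) []"
    and ?m = "\<lambda>p w. whisker l (beads p w) r"
  have split: "beads (l @ [s, t] @ r) (u @ [a, b] @ v) = ?u [s, t] @ ?m [s, t] [a, b] @ ?v [s, t]" for s t a b
    using assms by (simp add: beads_append[of l u] beads_append[of "[s, t]" "[a, b]" r v, simplified])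
  have path: "path (l @ p @ r) (?u p) (l @ p @ r)" "path (l @ p @ r) (?v p) (l @ p @ r)"
    "path (l @ p @ r) (?m p w) (l @ p @ r)" for p and w :: "'a list"
    using path_whisker_beads[of "[]" l "p @ r" u] path_whisker_beads[of "l @ p" r "[]" v]
      path_whisker_beads[of l p r w] by simp_all
  have v: "deq (l @ [s, t] @ r) (l @ [t, s] @ r) (?v [s, t] @ ?X) (?X @ ?v [t, s])"
    using ceq_sym[OF deq_whisker[OF deq_interchange[of "[s, t]" "[([], FCross s t, [])]" "[t, s]" r "beads r v" r "[]"], of l "[]"]]
    by (simp add: path_beads)
  have m: "deq (l @ [s, t] @ r) (l @ [t, s] @ r) (?m [s, t] [a, b] @ ?X) (?X @ ?m [t, s] [b, a])"
    using deq_whisker[OF deq_crossing_slide, of l s t r a b] by simp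
  have u: "deq (l @ [s, t] @ r) (l @ [t, s] @ r) (?u [s, t] @ ?X) (?X @ ?u [t, s])"
    using deq_whisker[OF deq_interchange[of l "beads l u" l "[s, t]" "[([], FCross s t, [])]" "[t, s]" "[]"], of "[]" r]
    by (simp add: path_beads)
  have "deq (l @ [s, t] @ r) (l @ [t, s] @ r) ((?u [s, t] @ ?m [s, t] [a, b]) @ (?v [s, t] @ ?X))
      ((?u [s, t] @ ?m [s, t] [a, b]) @ (?X @ ?v [t, s]))"
    by (intro deq_append[OF deq_refl v] path_appendI[OF path(1) path(3)])
  also have "(?u [s, t] @ ?m [s, t] [a, b]) @ (?X @ ?v [t, s]) = ?u [s, t] @ (?m [s, t] [a, b] @ ?X) @ ?v [t, s]"
    by simp
  also have "deq (l @ [s, t] @ r) (l @ [t, s] @ r) \<dots> (?u [s, t] @ (?X @ ?m [t, s] [b, a]) @ ?v [t, s])"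
    by (rule deq_append[OF deq_refl[OF path(1)] deq_append[OF m deq_refl[OF path(2)]]])
  also have "?u [s, t] @ (?X @ ?m [t, s] [b, a]) @ ?v [t, s] = (?u [s, t] @ ?X) @ ?m [t, s] [b, a] @ ?v [t, s]"
    by simp
  also have "deq (l @ [s, t] @ r) (l @ [t, s] @ r) \<dots> ((?X @ ?u [t, s]) @ ?m [t, s] [b, a] @ ?v [t, s])"
    by (rule deq_append[OF u deq_refl[OF path_appendI[OF path(3) path(2)]]])
  finally show ?thesis
    unfolding split by (simp only: append_assoc append_Cons append_Nil)
qed

text \<open>
  Beads slide down through a flat crossing while their tensor factors at the two strands change
  places. The functions \<open>f\<close> and \<open>g\<close> describe the decoration below and above.
\<close>

lemma bead_sum_crossing:
  assumes "\<And>w. w \<in> Poly_Mapping.keys z \<Longrightarrow> \<exists>u a b v. f w = u @ [a, b] @ v \<and> g w = u @ [b, a] @ v \<and>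
      length u = length l \<and> length v = length r"
  shows "ceq (l @ [s, t] @ r) (l @ [t, s] @ r)
    (stack (basis [(l, FCross s t, r)]) (bead_sum (l @ [t, s] @ r) (lin_ext (\<lambda>w. basis (g w)) z)))
    (stack (bead_sum (l @ [s, t] @ r) (lin_ext (\<lambda>w. basis (f w)) z)) (basis [(l, FCross s t, r)]))"
proof -
  have eq: "stack (basis [(l, FCross s t, r)]) (bead_sum (l @ [t, s] @ r) (lin_ext (\<lambda>w. basis (g w)) z)) =
      lin_ext (\<lambda>w. basis ((l, FCross s t, r) # beads (l @ [t, s] @ r) (g w))) z"
    "stack (bead_sum (l @ [s, t] @ r) (lin_ext (\<lambda>w. basis (f w)) z)) (basis [(l, FCross s t, r)]) =
      lin_ext (\<lambda>w. basis (beads (l @ [s, t] @ r) (f w) @ [(l, FCross s t, r)])) z"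
    by (simp_all add: bead_sum_def stack_lin_ext_left stack_lin_ext_right lin_ext_lin_ext)
  show ?thesis
    unfolding eq
  proof (rule ceq_lin_ext)
    fix w
    assume "w \<in> Poly_Mapping.keys z"
    then obtain u a b v where "f w = u @ [a, b] @ v" "g w = u @ [b, a] @ v" "length u = length l" "length v = length r"
      using assms by blast
    then show "deq (l @ [s, t] @ r) (l @ [t, s] @ r) ((l, FCross s t, r) # beads (l @ [t, s] @ r) (g w))
        (beads (l @ [s, t] @ r) (f w) @ [(l, FCross s t, r)])"
      using ceq_sym[OF deq_beads_crossing[of u l v r s t a b]] by simp
  qed
qed

lemma bead_sum_swap:
  assumes "z \<in> tensors 2"
  shows "ceq [s, t] [t, s] (stack (basis [([], FCross s t, [])]) (bead_sum [t, s] z))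
    (stack (bead_sum [s, t] (tensor_swap z)) (basis [([], FCross s t, [])]))"
  using assms bead_sum_crossing[of z "\<lambda>w. [w ! 1, w ! 0]" "\<lambda>w. w" "[]" "[]" s t]
  by (fastforce simp: tensor_swap_def lin_ext_self tensors_def length_2)

end

section \<open>Oriented quantum algebras\<close>

lemma algebra_automorphism_inv:
  assumes "algebra_automorphism scale f"
  shows "algebra_automorphism scale (inv f)"
proof -
  have bij: "bij f" and f: "\<And>x y. f (x + y) = f x + f y" "\<And>c x. f (scale c x) = scale c (f x)"
    "\<And>x y. f (x * y) = f x * f y" "f 1 = 1"
    using assms by (auto simp: algebra_automorphism_def)
  have inv: "inv f y = x \<longleftrightarrow> y = f x" for x y
    using bij by (metis bij_inv_eq_iff)
  have f_inv: "f (inv f x) = x" for x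
    using bij by (simp add: bij_is_surj surj_f_inv_f)
  show ?thesis
    unfolding algebra_automorphism_def using bij by (simp add: inv f f_inv bij_imp_bij_inv)
qed

lemma algebra_automorphismD:
  assumes "algebra_automorphism scale f"
  shows "linear_map scale f" "f (a * b) = f a * f b" "f 1 = 1" "bij f"
  using assms by (auto simp: algebra_automorphism_def linear_map_def)

text \<open>The axioms, with a representative of \<open>\<rho>\<inverse>\<close> chosen.\<close>

locale oriented_quantum = bead_calculus scale D U
  for scale :: "'k::{comm_ring,comm_monoid_mult} \<Rightarrow> 'a::{ring,monoid_mult} \<Rightarrow> 'a" and D U +
  fixes rho rinv :: "'a list \<Rightarrow>\<^sub>0 'k"
  assumes algebra: "is_algebra scale"
    and rho [simp]: "rho \<in> tensors 2"
    and yang_baxter: "yang_baxter scale rho"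
    and automorphism_U: "algebra_automorphism scale U"
    and automorphism_D: "algebra_automorphism scale D"
    and rho_U: "tensor_eq scale 2 (tensor_map [U, U] rho) rho"
    and rho_D: "tensor_eq scale 2 (tensor_map [D, D] rho) rho"
    and inverse: "is_inverse scale rho rinv"
    and inverse_op: "mutually_inverse scale [(*), op_mult] (tensor_map [id, U] rho) (tensor_map [D, id] rinv)"
begin

abbreviation teq (infix "\<approx>" 50) where
  "x \<approx> y \<equiv> tensor_eq scale 2 x y"

lemma rinv [simp]: "rinv \<in> tensors 2"
  using inverse by (simp add: is_inverse_def mutually_inverse_def)

lemma linear_mult:
  "linear_map scale (strand_mult s a)" "linear_map scale (\<lambda>x. strand_mult s x a)"
  using algebra by (cases s; auto simp: linear_map_def is_algebra_def algebra_simps)+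

lemma teq_mult:
  "x \<approx> x' \<Longrightarrow> y \<approx> y' \<Longrightarrow>
    tensor_mult [strand_mult s, strand_mult t] x y \<approx> tensor_mult [strand_mult s, strand_mult t] x' y'"
  by (rule tensor_eq_mult) (simp_all add: linear_mult)

lemma mult_Up: "tensor_mult [(*), (*)] = tensor_mult [strand_mult Up, strand_mult Up]"
  by (simp add: strand_mult_def)

text \<open>
  The decoration of a negative crossing may use any representative of the inverse of \<open>\<rho>\<close>.
\<close>

lemma inverse_unique:
  assumes "is_inverse scale rho x" "is_inverse scale rho y"
  shows "x \<approx> y"
proof -
  let ?m = "tensor_mult [(*), (*)]"
  have tensors: "x \<in> tensors 2" "y \<in> tensors 2"
    using assms by (simp_all add: is_inverse_def mutually_inverse_def)
  have "x \<approx> ?m x (basis [1, 1])"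
    using tensors by (simp add: tensor_mult_one tensor_eq_refl)
  also have "\<dots> \<approx> ?m x (?m rho y)"
    using assms tensors unfolding mult_Up
    by (intro teq_mult tensor_eq_refl tensor_eq_sym[where x = "tensor_mult _ _ _"])
      (simp_all add: is_inverse_def mutually_inverse_def mult_Up)
  also have "?m x (?m rho y) = ?m (?m x rho) y"
    using tensors by (simp add: tensor_mult_assoc)
  also have "\<dots> \<approx> ?m (basis [1, 1]) y"
    using assms tensors unfolding mult_Up
    by (intro teq_mult tensor_eq_refl) (simp_all add: is_inverse_def mutually_inverse_def mult_Up)
  also have "?m (basis [1, 1]) y = y"
    using tensors by (simp add: tensor_mult_one)
  finally show ?thesis .
qed

lemma rinv_invariant:
  assumes f: "algebra_automorphism scale f" and rho_f: "tensor_map [f, f] rho \<approx> rho"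
  shows "tensor_map [f, f] rinv \<approx> rinv"
proof (rule inverse_unique[OF _ inverse])
  let ?m = "tensor_mult [(*), (*)]"
  note f = algebra_automorphismD[OF f]
  have one: "tensor_map [f, f] x \<approx> basis [1, 1]" if "x \<approx> basis [1, 1]" for x
    using tensor_eq_map[OF that, of "[f, f]"] f by (simp add: tensor_map_def)
  have "?m rho (tensor_map [f, f] rinv) \<approx> ?m (tensor_map [f, f] rho) (tensor_map [f, f] rinv)"
    unfolding mult_Up by (intro teq_mult tensor_eq_sym[OF rho_f] tensor_eq_refl) simp
  also have "\<dots> = tensor_map [f, f] (?m rho rinv)"
    by (rule tensor_map_mult[symmetric]) (simp_all add: f)
  also have "\<dots> \<approx> basis [1, 1]"
    using inverse by (intro one) (simp add: is_inverse_def mutually_inverse_def)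
  finally have 1: "?m rho (tensor_map [f, f] rinv) \<approx> basis [1, 1]" .
  have "?m (tensor_map [f, f] rinv) rho \<approx> ?m (tensor_map [f, f] rinv) (tensor_map [f, f] rho)"
    unfolding mult_Up by (intro teq_mult tensor_eq_sym[OF rho_f] tensor_eq_refl) simp
  also have "\<dots> = tensor_map [f, f] (?m rinv rho)"
    by (rule tensor_map_mult[symmetric]) (simp_all add: f)
  also have "\<dots> \<approx> basis [1, 1]"
    using inverse by (intro one) (simp add: is_inverse_def mutually_inverse_def)
  finally have 2: "?m (tensor_map [f, f] rinv) rho \<approx> basis [1, 1]" .
  show "is_inverse scale rho (tensor_map [f, f] rinv)"
    using 1 2 by (simp add: is_inverse_def mutually_inverse_def)
qed

text \<open>
  The automorphism applied to a bead that moves from the right leg of \<open>Cap s\<close> to its left leg.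
\<close>

definition turn :: "sign \<Rightarrow> 'a \<Rightarrow> 'a" where
  "turn s = (case s of Up \<Rightarrow> U | Down \<Rightarrow> D)"

lemma automorphism_turn: "algebra_automorphism scale (turn s)"
  using automorphism_U automorphism_D by (cases s) (simp_all add: turn_def)

lemmas automorphism_inv_turn = algebra_automorphism_inv[OF automorphism_turn]

lemma turn_inv [simp]: "turn s \<circ> inv (turn s) = id" "inv (turn s) \<circ> turn s = id" "turn s (inv (turn s) a) = a" "inv (turn s) (turn s a) = a"
proof -
  show 1: "turn s \<circ> inv (turn s) = id" "inv (turn s) \<circ> turn s = id"
    using algebra_automorphismD(4)[OF automorphism_turn[of s]] by (auto simp: bij_def surj_iff inj_iff)
  show "turn s (inv (turn s) a) = a" "inv (turn s) (turn s a) = a"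
    using 1 by (metis comp_apply id_apply)+
qed

lemma teq_map:
  "x \<approx> y \<Longrightarrow> linear_map scale f \<Longrightarrow> linear_map scale g \<Longrightarrow> tensor_map [f, g] x \<approx> tensor_map [f, g] y"
  by (rule tensor_eq_map) simp_all

lemma linear_id: "linear_map scale id"
  by (simp add: linear_map_def)

lemmas linear_inv_turn = algebra_automorphismD(1)[OF automorphism_inv_turn]

text \<open>
  Every crossing can be normalized to a flat crossing with all beads at the bottom; the left factor
  of the tensor found there belongs to the strand from bottom left to top right. If the signs agree,
  the tensor is \<open>\<rho>\<close> or the swapped \<open>\<rho>\<inverse>\<close>. If they
  differ, it results from the switchback that bends the strand from bottom right to top left, whose
  bead then has to pass a cap.
\<close>

definition same_sign_tensor :: "crossing \<Rightarrow> ('a list \<Rightarrow>\<^sub>0 'k)" where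
  "same_sign_tensor c = (case c of SlashOver \<Rightarrow> rho | BackslashOver \<Rightarrow> tensor_swap rinv)"

definition crossing_tensor :: "crossing \<Rightarrow> sign \<Rightarrow> sign \<Rightarrow> ('a list \<Rightarrow>\<^sub>0 'k)" where
  "crossing_tensor c s t = (if t = s then same_sign_tensor c
     else tensor_map [id, inv (turn s)] (tensor_swap (same_sign_tensor (flip c))))"

lemma same_sign_tensor [simp]: "same_sign_tensor c \<in> tensors 2"
  by (cases c) (simp_all add: same_sign_tensor_def)

lemma crossing_tensor [simp]: "crossing_tensor c s t \<in> tensors 2"
  by (simp add: crossing_tensor_def)

lemma rho_turn: "tensor_map [turn s, turn s] rho \<approx> rho"
  using rho_U rho_D by (cases s) (simp_all add: turn_def)

lemma rinv_turn: "tensor_map [turn s, turn s] rinv \<approx> rinv"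
  by (rule rinv_invariant[OF automorphism_turn rho_turn])

lemma same_sign_tensor_inv_turn: "tensor_map [inv (turn s), inv (turn s)] (same_sign_tensor c) \<approx> same_sign_tensor c"
proof -
  have "tensor_map [turn s, turn s] (same_sign_tensor c) \<approx> same_sign_tensor c"
    using rho_turn rinv_turn tensor_eq_swap[OF rinv_turn[of s]]
    by (cases c) (simp_all add: same_sign_tensor_def tensor_swap_map)
  from teq_map[OF tensor_eq_sym[OF this] linear_inv_turn linear_inv_turn, of s s] show ?thesis
    by (simp add: tensor_map_map tensor_map_id)
qed

text \<open>
  The tensor form of the switchback at a maximum. If the two strands have opposite signs in the
  crossing on the right, both factors get turned in total, and the invariance of \<open>\<rho>\<close> and
  \<open>\<rho>\<inverse>\<close> is what makes the two switchback rewritings agree.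
\<close>

lemma crossing_tensor_turn:
  "crossing_tensor c t (opp s) \<approx> tensor_map [id, inv (turn s)] (tensor_swap (crossing_tensor (flip c) s t))"
proof (cases "t = s")
  case True
  then show ?thesis
    by (simp add: crossing_tensor_def tensor_eq_refl)
next
  case False
  then have t: "t = opp s"
    by (cases s; cases t) simp_all
  have "tensor_map [id, inv (turn s)] (tensor_swap (crossing_tensor (flip c) s t)) =
      tensor_map [inv (turn s), inv (turn s)] (same_sign_tensor c)"
    by (simp add: t crossing_tensor_def tensor_swap_map tensor_map_map)
  then show ?thesis
    using tensor_eq_sym[OF same_sign_tensor_inv_turn[of s c]] by (simp add: t crossing_tensor_def)
qed

lemma mult_opp:
  "x \<in> tensors 2 \<Longrightarrow> y \<in> tensors 2 \<Longrightarrow>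
    tensor_mult [strand_mult (opp s), strand_mult (opp t)] x y = tensor_mult [strand_mult s, strand_mult t] y x"
  by (rule tensor_mult_op) (cases s; cases t; simp)+

lemma swap_one: "x \<approx> basis [1, 1] \<Longrightarrow> tensor_swap x \<approx> basis [1, 1]"
  using tensor_eq_swap[of scale x "basis [1, 1]"] by (simp add: tensor_swap_def)

lemma map_one:
  "x \<approx> basis [1, 1] \<Longrightarrow> algebra_automorphism scale f \<Longrightarrow> algebra_automorphism scale g \<Longrightarrow>
    tensor_map [f, g] x \<approx> basis [1, 1]"
  using teq_map[of x "basis [1, 1]" f g] by (simp add: algebra_automorphismD tensor_map_def)

lemma same_sign_inverse:
  "tensor_mult [strand_mult s, strand_mult s] rho rinv \<approx> basis [1, 1]"
  "tensor_mult [strand_mult s, strand_mult s] rinv rho \<approx> basis [1, 1]"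
proof -
  have "tensor_mult [strand_mult Up, strand_mult Up] rho rinv \<approx> basis [1, 1]"
    "tensor_mult [strand_mult Up, strand_mult Up] rinv rho \<approx> basis [1, 1]"
    using inverse by (simp_all add: is_inverse_def mutually_inverse_def mult_Up)
  then show "tensor_mult [strand_mult s, strand_mult s] rho rinv \<approx> basis [1, 1]"
    "tensor_mult [strand_mult s, strand_mult s] rinv rho \<approx> basis [1, 1]"
    using mult_opp[of rho rinv Up Up] mult_opp[of rinv rho Up Up] by (cases s; simp)+
qed

text \<open>
  For \<open>s = Up\<close> this is the axiom on \<open>A \<otimes> A\<^sup>o\<^sup>p\<close> with \<open>D\<inverse> \<otimes> U\<inverse>\<close>
  applied. For \<open>s = Down\<close> both products are those of the axiom in the opposite order, after
  \<open>\<rho>\<close> and \<open>\<rho>\<inverse>\<close> are rewritten by their invariance under \<open>U\<close>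
  and \<open>D\<close>, respectively.
\<close>

lemma opposite_sign_inverse:
  defines "x \<equiv> \<lambda>s. tensor_map [id, inv (turn s)] rinv" and "y \<equiv> \<lambda>s. tensor_map [inv (turn (opp s)), id] rho"
  shows "tensor_mult [strand_mult s, strand_mult (opp s)] (x s) (y s) \<approx> basis [1, 1]"
    and "tensor_mult [strand_mult s, strand_mult (opp s)] (y s) (x s) \<approx> basis [1, 1]"
proof -
  let ?m = "tensor_mult [strand_mult Up, strand_mult Down]"
  let ?p = "tensor_map [id, U] rho" and ?q = "tensor_map [D, id] rinv"
  have pq: "?m ?p ?q \<approx> basis [1, 1]" "?m ?q ?p \<approx> basis [1, 1]"
    using inverse_op by (simp_all add: mutually_inverse_def strand_mult_def)
  have xy: "x s \<in> tensors 2" "y s \<in> tensors 2" for s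
    by (simp_all add: x_def y_def)
  have hom: "tensor_map [inv (turn Down), inv (turn Up)] (?m x y) =
      ?m (tensor_map [inv (turn Down), inv (turn Up)] x) (tensor_map [inv (turn Down), inv (turn Up)] y)"
    if "x \<in> tensors 2" "y \<in> tensors 2" for x y :: "'a list \<Rightarrow>\<^sub>0 'k"
    using that by (rule tensor_map_mult) (simp_all add: algebra_automorphismD(2)[OF automorphism_inv_turn])
  have inv: "inv (turn Down) \<circ> D = id" "inv (turn Up) \<circ> U = id" "inv U \<circ> U = id" "inv D \<circ> D = id"
    using turn_inv(1,2)[of Down] turn_inv(1,2)[of Up] by (simp_all add: turn_def)
  have "tensor_map [inv (turn Down), inv (turn Up)] ?p = y Up" "tensor_map [inv (turn Down), inv (turn Up)] ?q = x Up"
    by (simp_all add: x_def y_def tensor_map_map inv)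
  then have Up: "?m (x Up) (y Up) \<approx> basis [1, 1]" "?m (y Up) (x Up) \<approx> basis [1, 1]"
    using map_one[OF pq(1) automorphism_inv_turn automorphism_inv_turn, of Down Up]
      map_one[OF pq(2) automorphism_inv_turn automorphism_inv_turn, of Down Up]
    by (simp_all add: hom)
  have "?p \<approx> y Down"
    using teq_map[OF rho_turn[of Up] linear_inv_turn[of Up] linear_id]
    by (simp add: y_def tensor_map_map inv turn_def)
  moreover have "?q \<approx> x Down"
    using teq_map[OF rinv_turn[of Down] linear_id linear_inv_turn[of Down]]
    by (simp add: x_def tensor_map_map inv turn_def)
  ultimately have "?m (x Down) (y Down) \<approx> basis [1, 1]" "?m (y Down) (x Down) \<approx> basis [1, 1]"
    using pq by (meson teq_mult tensor_eq_sym tensor_eq_trans)+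
  then have Down: "tensor_mult [strand_mult Down, strand_mult Up] (x Down) (y Down) \<approx> basis [1, 1]"
    "tensor_mult [strand_mult Down, strand_mult Up] (y Down) (x Down) \<approx> basis [1, 1]"
    using mult_opp[OF xy(1) xy(2), of Up Down Down Down] mult_opp[OF xy(2) xy(1), of Up Down Down Down] by simp_all
  show "tensor_mult [strand_mult s, strand_mult (opp s)] (x s) (y s) \<approx> basis [1, 1]"
    "tensor_mult [strand_mult s, strand_mult (opp s)] (y s) (x s) \<approx> basis [1, 1]"
    using Up Down by (cases s; simp)+
qed

text \<open>
  The tensor form of the second Reidemeister move: for strands of equal signs the invertibility of
  \<open>\<rho>\<close>, for strands of opposite signs that in \<open>A \<otimes> A\<^sup>o\<^sup>p\<close>.
\<close>

lemma crossing_tensor_inverse: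
  "tensor_mult [strand_mult s, strand_mult t] (crossing_tensor c s t) (tensor_swap (crossing_tensor (flip c) t s))
    \<approx> basis [1, 1]"
proof (cases "t = s")
  case True
  then show ?thesis
    using same_sign_inverse[of s] swap_one[OF same_sign_inverse(2), of s]
    by (cases c) (simp_all add: crossing_tensor_def same_sign_tensor_def tensor_swap_mult)
next
  case False
  then have t: "t = opp s"
    by (cases s; cases t) simp_all
  show ?thesis
  proof (cases c)
    case SlashOver
    then show ?thesis
      using opposite_sign_inverse(1)[of s]
      by (simp add: t crossing_tensor_def same_sign_tensor_def tensor_swap_map)
  next
    case BackslashOver
    then show ?thesis
      using swap_one[OF opposite_sign_inverse(2)[of "opp s"]]
      by (simp add: t crossing_tensor_def same_sign_tensor_def tensor_swap_map tensor_swap_mult)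
  qed
qed

end

section \<open>Flat tangles\<close>

context bead_calculus
begin

lemma deq_flat_move:
  assumes "tangle_move w w'" "path p (flat_shadow w :: 'a bead_event diagram) q"
    "path p (flat_shadow w' :: 'a bead_event diagram) q"
  shows "deq p q (flat_shadow w) (flat_shadow w')"
  by (rule deq_rel[OF bead_rel.flat[OF assms(1)] assms(2,3)])

lemma deq_flat_reidemeister2: "deq [s, t] [s, t] [([], FCross s t, []), ([], FCross t s, [])] []"
  using deq_flat_move[OF tangle_move.reidemeister2[of SlashOver s t], of "[s, t]" "[s, t]"]
  by (simp add: flat_shadow_def)

lemma deq_flat_braid:
  "deq [s1, s2, s3] [s3, s2, s1]
     [([], FCross s1 s2, [s3]), ([s2], FCross s1 s3, []), ([], FCross s2 s3, [s1])]
     [([s1], FCross s2 s3, []), ([], FCross s1 s3, [s2]), ([s3], FCross s1 s2, [])]"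
  using deq_flat_move[OF tangle_move.reidemeister3[of SlashOver SlashOver SlashOver s1 s2 s3],
      of "[s1, s2, s3]" "[s3, s2, s1]"]
  by (simp add: flat_shadow_def)

lemma deq_flat_switch_max:
  "deq [s, t, opp s] [t]
     [([s], FCross t (opp s), []), ([], Flat (Cap s), [t])]
     [([], FCross s t, [opp s]), ([t], Flat (Cap s), [])]"
  using deq_flat_move[OF tangle_move.switch_max[of s SlashOver t], of "[s, t, opp s]" "[t]"]
  by (simp add: flat_shadow_def)

lemma deq_flat_cancel1: "deq [s] [s] [([s], Flat (Cup (opp s)), []), ([], Flat (Cap s), [s])] []"
  using deq_flat_move[OF tangle_move.cancel1[of s], of "[s]" "[s]"] by (simp add: flat_shadow_def)

lemma deq_flat_cancel2: "deq [s] [s] [([], Flat (Cup s), [s]), ([s], Flat (Cap (opp s)), [])] []"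
  using deq_flat_move[OF tangle_move.cancel2[of s], of "[s]" "[s]"] by (simp add: flat_shadow_def)

end

section \<open>The value of a diagram\<close>

context oriented_quantum
begin

text \<open>
  A value of \<open>F\<close> computed without choices. Mixed crossings get their normal form directly
  instead of a switchback rewriting.
\<close>

definition crossing_sum :: "crossing \<Rightarrow> sign \<Rightarrow> sign \<Rightarrow> ('a bead_event diagram \<Rightarrow>\<^sub>0 'k)" where
  "crossing_sum c s t = stack (bead_sum [s, t] (crossing_tensor c s t)) (basis [([], FCross s t, [])])"

primrec event_value :: "crossing event \<Rightarrow> ('a bead_event diagram \<Rightarrow>\<^sub>0 'k)" where
  "event_value (Cup s) = basis [([], Flat (Cup s), [])]"
| "event_value (Cap s) = basis [([], Flat (Cap s), [])]"
| "event_value (Cross c s t) = crossing_sum c s t"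

fun diagram_value :: "crossing event diagram \<Rightarrow> ('a bead_event diagram \<Rightarrow>\<^sub>0 'k)" where
  "diagram_value [] = basis []"
| "diagram_value ((l, e, r) # w) = stack (whisk l (event_value e) r) (diagram_value w)"

lemma formal_sums_path: "path p w q \<Longrightarrow> basis w \<in> formal_sums p q"
  by (simp add: formal_sums_basis diagrams_def)

lemma formal_sums_crossing: "crossing_sum c s t \<in> formal_sums [s, t] [t, s]"
  unfolding crossing_sum_def
  by (rule formal_sums_stack[OF formal_sums_bead_sum formal_sums_path]) simp

lemma formal_sums_event: "event_value e \<in> formal_sums (inputs e) (outputs e)"
  by (cases e) (simp_all add: formal_sums_crossing formal_sums_path)

lemma formal_sums_diagram: "path p w q \<Longrightarrow> diagram_value w \<in> formal_sums p q"
proof (induction w arbitrary: p)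
  case Nil
  then show ?case
    by (simp add: formal_sums_path)
next
  case (Cons x w)
  then show ?case
    by (cases x) (auto intro!: formal_sums_stack formal_sums_whisk[OF formal_sums_event])
qed

lemma diagram_value_append: "diagram_value (u @ v) = stack (diagram_value u) (diagram_value v)"
  by (induction u rule: diagram_value.induct) (simp_all add: stack_assoc)

lemma diagram_value_whisker: "diagram_value (whisker l w r) = whisk l (diagram_value w) r"
  by (induction w rule: diagram_value.induct) (simp_all add: whisk_stack in_context_in_context)

lemma crossing_sum_reidemeister2:
  "ceq [s, t] [s, t] (stack (crossing_sum c s t) (crossing_sum (flip c) t s)) (basis [])"
proof -
  let ?X = "\<lambda>s t. basis [([], FCross s t, [])] :: 'a bead_event diagram \<Rightarrow>\<^sub>0 'k"
  let ?z = "crossing_tensor c s t" and ?z' = "crossing_tensor (flip c) t s"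
  have X: "?X s t \<in> formal_sums [s, t] [t, s]" for s t
    by (rule formal_sums_path) simp
  have "stack (crossing_sum c s t) (crossing_sum (flip c) t s) =
      stack (bead_sum [s, t] ?z) (stack (stack (?X s t) (bead_sum [t, s] ?z')) (?X t s))"
    by (simp only: crossing_sum_def stack_assoc)
  also have "ceq [s, t] [s, t] \<dots>
      (stack (bead_sum [s, t] ?z) (stack (stack (bead_sum [s, t] (tensor_swap ?z')) (?X s t)) (?X t s)))"
    by (rule ceq_stack_mid[OF bead_sum_swap[OF crossing_tensor] formal_sums_bead_sum X])
  also have "\<dots> = stack (stack (bead_sum [s, t] ?z) (bead_sum [s, t] (tensor_swap ?z'))) (stack (?X s t) (?X t s))"
    by (simp only: stack_assoc)
  also have "ceq [s, t] [s, t] \<dots> (stack (bead_sum [s, t]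
      (tensor_mult (map strand_mult [s, t]) ?z (tensor_swap ?z'))) (basis []))"
    using deq_flat_reidemeister2[of s t]
    by (intro ceq_stack[OF bead_sum_mult[where n = 2]]) simp_all
  also have "\<dots> = bead_sum [s, t] (tensor_mult [strand_mult s, strand_mult t] ?z (tensor_swap ?z'))"
    by simp
  also have "ceq [s, t] [s, t] \<dots> (bead_sum [s, t] (basis [1, 1]))"
    by (rule bead_sum_tensor_eq[OF _ crossing_tensor_inverse]) simp
  also have "ceq [s, t] [s, t] \<dots> (basis [])"
    by (rule bead_sum_one)
  finally show ?thesis .
qed

lemma deq_cap:
  "deq [s, opp s] [] [([], Bead a s, [opp s]), ([], Flat (Cap s), [])]
    [([s], Bead (inv (turn s) a) (opp s), []), ([], Flat (Cap s), [])]"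
proof -
  have "deq [s, opp s] [] [([s], Bead b (opp s), []), ([], Flat (Cap s), [])]
      [([], Bead (turn s b) s, [opp s]), ([], Flat (Cap s), [])]" for b
    by (cases s)
      (auto simp: turn_def intro!: deq_rel bead_rel.cap_clockwise bead_rel.cap_counterclockwise)
  from ceq_sym[OF this[of "inv (turn s) a"]] show ?thesis
    by simp
qed

text \<open>
  The bead of the strand that forms the maximum slides up through the crossing, across the maximum
  and down the other leg to the bottom, which frees the flat crossing to move across the maximum.
\<close>

lemma deq_switch_max:
  "deq [s, t, opp s] [t]
    (whisker [] (beads [s, t] [a, b]) [opp s] @ [([], FCross s t, [opp s]), ([t], Flat (Cap s), [])])
    (whisker [s] (beads [t, opp s] [b, inv (turn s) a]) [] @ [([s], FCross t (opp s), []), ([], Flat (Cap s), [t])])"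
proof -
  let ?o = "opp s" and ?X = "([], FCross s t, [opp s])" and ?M = "([t], Flat (Cap s), [])"
  let ?E = "deq [s, t, opp s] [t]"
  let ?a = "inv (turn s) a"
  have "deq [s, t, ?o] [t, s, ?o] [([], Bead a s, [t, ?o]), ([s], Bead b t, [?o]), ?X]
      [?X, ([], Bead b t, [s, ?o]), ([t], Bead a s, [?o])]"
    using deq_whisker[OF deq_crossing_slide[of s t a b], of "[]" "[?o]"] by simp
  from deq_append[OF this deq_refl, of "[?M]" "[t]"]
  have E1: "?E [([], Bead a s, [t, ?o]), ([s], Bead b t, [?o]), ?X, ?M]
      [?X, ([], Bead b t, [s, ?o]), ([t], Bead a s, [?o]), ?M]"
    by simp
  have "deq [t, s, ?o] [t] [([t], Bead a s, [?o]), ?M] [([t, s], Bead ?a ?o, []), ?M]"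
    using deq_whisker[OF deq_cap[of s a], of "[t]" "[]"] by simp
  from deq_append[OF deq_refl this, of "[s, t, ?o]" "[?X, ([], Bead b t, [s, ?o])]"]
  have E2: "?E [?X, ([], Bead b t, [s, ?o]), ([t], Bead a s, [?o]), ?M]
      [?X, ([], Bead b t, [s, ?o]), ([t, s], Bead ?a ?o, []), ?M]"
    by simp
  have "deq [s, t] [t, s] [([s], Bead b t, []), ([], FCross s t, [])] [([], FCross s t, []), ([], Bead b t, [s])]"
    by (rule deq_rel[OF bead_rel.cross_right]) simp_all
  from deq_append[OF deq_whisker[OF ceq_sym[OF this], of "[]" "[?o]"] deq_refl, of "[([t, s], Bead ?a ?o, []), ?M]" "[t]"]
  have E3: "?E [?X, ([], Bead b t, [s, ?o]), ([t, s], Bead ?a ?o, []), ?M]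
      [([s], Bead b t, [?o]), ?X, ([t, s], Bead ?a ?o, []), ?M]"
    by simp
  have "deq [s, t, ?o] [t, s, ?o] [?X, ([t, s], Bead ?a ?o, [])] [([s, t], Bead ?a ?o, []), ?X]"
    using deq_interchange_events[of "FCross s t" "[]" "Bead ?a ?o"] by simp
  from deq_append[OF deq_refl deq_append[OF this deq_refl], of "[s, t, ?o]" "[([s], Bead b t, [?o])]" "[?M]" "[t]"]
  have E4: "?E [([s], Bead b t, [?o]), ?X, ([t, s], Bead ?a ?o, []), ?M]
      [([s], Bead b t, [?o]), ([s, t], Bead ?a ?o, []), ?X, ?M]"
    by simp
  from deq_append[OF deq_refl ceq_sym[OF deq_flat_switch_max],
      of "[s, t, ?o]" "[([s], Bead b t, [?o]), ([s, t], Bead ?a ?o, [])]" s t]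
  have E5: "?E [([s], Bead b t, [?o]), ([s, t], Bead ?a ?o, []), ?X, ?M]
      [([s], Bead b t, [?o]), ([s, t], Bead ?a ?o, []), ([s], FCross t ?o, []), ([], Flat (Cap s), [t])]"
    by simp
  show ?thesis
    using ceq_trans[OF E1 ceq_trans[OF E2 ceq_trans[OF E3 ceq_trans[OF E4 E5]]]] by simp
qed

lemma crossing_sum_switch_max:
  "ceq [s, t, opp s] [t]
    (stack (whisk [s] (crossing_sum c t (opp s)) []) (basis [([], Flat (Cap s), [t])]))
    (stack (whisk [] (crossing_sum (flip c) s t) [opp s]) (basis [([t], Flat (Cap s), [])]))"
proof -
  let ?z = "crossing_tensor (flip c) s t"
  let ?T = "[([s], FCross t (opp s), []), ([], Flat (Cap s), [t])] :: 'a bead_event diagram"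
  have left: "stack (whisk [s] (crossing_sum c t (opp s)) []) (basis [([], Flat (Cap s), [t])]) =
      stack (whisk [s] (bead_sum [t, opp s] (crossing_tensor c t (opp s))) []) (basis ?T)"
    by (simp add: crossing_sum_def whisk_stack stack_assoc)
  have turned: "stack (whisk [s] (bead_sum [t, opp s] (tensor_map [id, inv (turn s)] (tensor_swap ?z))) []) (basis ?T) =
      lin_ext (\<lambda>w. basis (whisker [s] (beads [t, opp s] [w ! 1, inv (turn s) (w ! 0)]) [] @ ?T)) ?z"
    by (simp add: bead_sum_def tensor_map_def tensor_swap_def lin_ext_lin_ext in_context_def stack_lin_ext_left)
  have right: "stack (whisk [] (crossing_sum (flip c) s t) [opp s]) (basis [([t], Flat (Cap s), [])]) =
      lin_ext (\<lambda>w. basis (whisker [] (beads [s, t] w) [opp s] @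
        [([], FCross s t, [opp s]), ([t], Flat (Cap s), [])])) ?z"
    by (simp add: crossing_sum_def bead_sum_def lin_ext_lin_ext in_context_def stack_lin_ext_left)
  have "ceq [s, t, opp s] [t]
      (stack (whisk [s] (bead_sum [t, opp s] (crossing_tensor c t (opp s))) []) (basis ?T))
      (stack (whisk [s] (bead_sum [t, opp s] (tensor_map [id, inv (turn s)] (tensor_swap ?z))) []) (basis ?T))"
    using ceq_whisk[OF bead_sum_tensor_eq[OF _ crossing_tensor_turn[of c t s], of "[t, opp s]"], of "[s]" "[]"]
    by (intro ceq_stack[where q = "[s, t, opp s]"] ceq_refl formal_sums_path) simp_all
  also have "ceq [s, t, opp s] [t]
      (stack (whisk [s] (bead_sum [t, opp s] (tensor_map [id, inv (turn s)] (tensor_swap ?z))) []) (basis ?T))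
      (lin_ext (\<lambda>w. basis (whisker [] (beads [s, t] w) [opp s] @
        [([], FCross s t, [opp s]), ([t], Flat (Cap s), [])])) ?z)"
    unfolding turned
  proof (rule ceq_lin_ext)
    fix w
    assume "w \<in> Poly_Mapping.keys ?z"
    then obtain a b where w: "w = [a, b]"
      using tensors_length[OF crossing_tensor \<open>w \<in> _\<close>] by (auto simp: length_2)
    show "deq [s, t, opp s] [t] (whisker [s] (beads [t, opp s] [w ! 1, inv (turn s) (w ! 0)]) [] @ ?T)
        (whisker [] (beads [s, t] w) [opp s] @ [([], FCross s t, [opp s]), ([t], Flat (Cap s), [])])"
      using ceq_sym[OF deq_switch_max[of s t a b]] by (simp add: w)
  qed
  finally show ?thesis
    by (simp only: left right)
qed

text \<open>
  With all beads slid to the bottom, both sides are the two sides of the Yang-Baxter equation followed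
  by those of the flat third Reidemeister move.
\<close>

lemma crossing_sum_braid:
  defines "P \<equiv> [Up, Up, Up]" and "C \<equiv> crossing_sum SlashOver Up Up"
  shows "ceq P P
    (stack (whisk [] C [Up]) (stack (whisk [Up] C []) (whisk [] C [Up])))
    (stack (whisk [Up] C []) (stack (whisk [] C [Up]) (whisk [Up] C [])))"
proof -
  define X0 X1 :: "'a bead_event diagram \<Rightarrow>\<^sub>0 'k"
    where "X0 = basis [([], FCross Up Up, [Up])]" and "X1 = basis [([Up], FCross Up Up, [])]"
  define T12 T13 T23 where "T12 = bead_sum P (tensor12 rho)" and "T13 = bead_sum P (tensor13 rho)"
    and "T23 = bead_sum P (tensor23 rho)"
  have X: "X0 \<in> formal_sums P P" "X1 \<in> formal_sums P P"
    by (simp_all add: X0_def X1_def P_def formal_sums_path)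
  have T: "T12 \<in> formal_sums P P" "T13 \<in> formal_sums P P" "T23 \<in> formal_sums P P"
    by (simp_all add: T12_def T13_def T23_def formal_sums_bead_sum)
  note closed = formal_sums_stack[where p = P and q = P and r = P] X T
  have mid: "ceq P P (stack x (stack y z)) (stack x (stack y' z))"
    if "ceq P P y y'" "x \<in> formal_sums P P" "z \<in> formal_sums P P" for x y y' z
    using that by (rule ceq_stack_mid)

  \<comment> \<open>The tensor \<open>\<rho>\<^sub>1\<^sub>3\<close> arises from \<open>\<rho>\<^sub>1\<^sub>2\<close> or \<open>\<rho>\<^sub>2\<^sub>3\<close> by passing one crossing.\<close>
  have slide0: "ceq P P (stack X0 T23) (stack T13 X0)" "ceq P P (stack X0 T13) (stack T23 X0)"
    using bead_sum_crossing[of rho "\<lambda>w. [w ! 0, 1, w ! 1]" "\<lambda>w. [1, w ! 0, w ! 1]" "[]" "[Up]" Up Up]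
      bead_sum_crossing[of rho "\<lambda>w. [1, w ! 0, w ! 1]" "\<lambda>w. [w ! 0, 1, w ! 1]" "[]" "[Up]" Up Up]
    by (simp_all add: X0_def T13_def T23_def tensor13_def tensor23_def P_def)
  have slide1: "ceq P P (stack X1 T12) (stack T13 X1)" "ceq P P (stack X1 T13) (stack T12 X1)"
    using bead_sum_crossing[of rho "\<lambda>w. [w ! 0, 1, w ! 1]" "\<lambda>w. [w ! 0, w ! 1, 1]" "[Up]" "[]" Up Up]
      bead_sum_crossing[of rho "\<lambda>w. [w ! 0, w ! 1, 1]" "\<lambda>w. [w ! 0, 1, w ! 1]" "[Up]" "[]" Up Up]
    by (simp_all add: X1_def T13_def T12_def tensor13_def tensor12_def P_def)
  have C0: "ceq P P (whisk [] C [Up]) (stack T12 X0)"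
    unfolding C_def crossing_sum_def whisk_stack
    using bead_sum_tensor12[OF rho, of Up Up Up] X(1)
    by (intro ceq_stack[where q = P])
      (simp_all add: X0_def P_def T12_def tensor12_def crossing_tensor_def same_sign_tensor_def ceq_refl)
  have C1: "ceq P P (whisk [Up] C []) (stack T23 X1)"
    unfolding C_def crossing_sum_def whisk_stack
    using bead_sum_tensor23[OF rho, of Up Up Up] X(2)
    by (intro ceq_stack[where q = P])
      (simp_all add: X1_def P_def T23_def tensor23_def crossing_tensor_def same_sign_tensor_def ceq_refl)

  have "ceq P P (stack (whisk [] C [Up]) (stack (whisk [Up] C []) (whisk [] C [Up])))
      (stack (stack T12 X0) (stack (stack T23 X1) (stack T12 X0)))"
    by (intro ceq_stack[where q = P] C0 C1)
  also have "\<dots> = stack T12 (stack (stack X0 T23) (stack X1 (stack T12 X0)))"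
    by (simp only: stack_assoc)
  also have "ceq P P \<dots> (stack T12 (stack (stack T13 X0) (stack X1 (stack T12 X0))))"
    by (intro mid slide0 closed)
  also have "\<dots> = stack (stack T12 (stack T13 X0)) (stack (stack X1 T12) X0)"
    by (simp only: stack_assoc)
  also have "ceq P P \<dots> (stack (stack T12 (stack T13 X0)) (stack (stack T13 X1) X0))"
    by (intro mid slide1 closed)
  also have "\<dots> = stack (stack T12 T13) (stack (stack X0 T13) (stack X1 X0))"
    by (simp only: stack_assoc)
  also have "ceq P P \<dots> (stack (stack T12 T13) (stack (stack T23 X0) (stack X1 X0)))"
    by (intro mid slide0 closed)
  also have "\<dots> = stack (stack (stack T12 T13) T23) (stack X0 (stack X1 X0))"
    by (simp only: stack_assoc)
  finally have left: "ceq P P (stack (whisk [] C [Up]) (stack (whisk [Up] C []) (whisk [] C [Up])))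
      (stack (stack (stack T12 T13) T23) (stack X0 (stack X1 X0)))" .

  have "ceq P P (stack (whisk [Up] C []) (stack (whisk [] C [Up]) (whisk [Up] C [])))
      (stack (stack T23 X1) (stack (stack T12 X0) (stack T23 X1)))"
    by (intro ceq_stack[where q = P] C0 C1)
  also have "\<dots> = stack T23 (stack (stack X1 T12) (stack X0 (stack T23 X1)))"
    by (simp only: stack_assoc)
  also have "ceq P P \<dots> (stack T23 (stack (stack T13 X1) (stack X0 (stack T23 X1))))"
    by (intro mid slide1 closed)
  also have "\<dots> = stack (stack T23 (stack T13 X1)) (stack (stack X0 T23) X1)"
    by (simp only: stack_assoc)
  also have "ceq P P \<dots> (stack (stack T23 (stack T13 X1)) (stack (stack T13 X0) X1))"
    by (intro mid slide0 closed)
  also have "\<dots> = stack (stack T23 T13) (stack (stack X1 T13) (stack X0 X1))"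
    by (simp only: stack_assoc)
  also have "ceq P P \<dots> (stack (stack T23 T13) (stack (stack T12 X1) (stack X0 X1)))"
    by (intro mid slide1 closed)
  also have "\<dots> = stack (stack (stack T23 T13) T12) (stack X1 (stack X0 X1))"
    by (simp only: stack_assoc)
  finally have right: "ceq P P (stack (whisk [Up] C []) (stack (whisk [] C [Up]) (whisk [Up] C [])))
      (stack (stack (stack T23 T13) T12) (stack X1 (stack X0 X1)))" .

  let ?m = "tensor_mult (map strand_mult P)"
  have tensors: "tensor12 rho \<in> tensors 3" "tensor13 rho \<in> tensors 3" "tensor23 rho \<in> tensors 3"
    unfolding tensor12_def tensor13_def tensor23_def by (intro tensors_lin_ext tensors_basis, simp)+
  have P: "length P = 3"
    by (simp add: P_def)
  have mult: "ceq P P (stack (stack (bead_sum P x) (bead_sum P y)) (bead_sum P z)) (bead_sum P (?m (?m x y) z))"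
    if "x \<in> tensors 3" "y \<in> tensors 3" "z \<in> tensors 3" for x y z
  proof -
    have "ceq P P (stack (stack (bead_sum P x) (bead_sum P y)) (bead_sum P z))
        (stack (bead_sum P (?m x y)) (bead_sum P z))"
      using that by (intro ceq_stack[where q = P] bead_sum_mult[OF P] ceq_refl formal_sums_bead_sum)
    also have "ceq P P \<dots> (bead_sum P (?m (?m x y) z))"
      using that P by (intro bead_sum_mult[OF P]) simp_all
    finally show ?thesis .
  qed
  have "ceq P P (stack (stack T12 T13) T23) (bead_sum P (?m (?m (tensor12 rho) (tensor13 rho)) (tensor23 rho)))"
    unfolding T12_def T13_def T23_def by (intro mult tensors)
  also have "ceq P P \<dots> (bead_sum P (?m (?m (tensor23 rho) (tensor13 rho)) (tensor12 rho)))"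
    using yang_baxter by (intro bead_sum_tensor_eq[OF P]) (simp add: yang_baxter_def P_def strand_mult_def Let_def)
  also have "ceq P P \<dots> (stack (stack T23 T13) T12)"
    unfolding T12_def T13_def T23_def by (intro ceq_sym[OF mult] tensors)
  finally have "ceq P P (stack (stack T12 T13) T23) (stack (stack T23 T13) T12)" .
  moreover have "ceq P P (stack X0 (stack X1 X0)) (stack X1 (stack X0 X1))"
    using deq_flat_braid[of Up Up Up] by (simp add: X0_def X1_def P_def)
  ultimately have "ceq P P (stack (stack (stack T12 T13) T23) (stack X0 (stack X1 X0)))
      (stack (stack (stack T23 T13) T12) (stack X1 (stack X0 X1)))"
    by (rule ceq_stack)
  then show ?thesis
    by (rule ceq_trans[OF left ceq_trans[OF _ ceq_sym[OF right]]])
qed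

end

context oriented_quantum
begin

section \<open>Invariance of the decoration\<close>

definition value_eq ::
    "sign list \<Rightarrow> sign list \<Rightarrow> crossing event diagram \<Rightarrow> crossing event diagram \<Rightarrow> bool" where
  "value_eq p q w w' \<longleftrightarrow> path p w q \<and> path p w' q \<and> ceq p q (diagram_value w) (diagram_value w')"

sublocale tangle_congruence value_eq
proof
  show "value_eq p q w w" if "path p w q" for p q w
    using that by (simp add: value_eq_def ceq_refl formal_sums_diagram)
  show "value_eq p q w' w" if "value_eq p q w w'" for p q w w'
    using that by (auto simp: value_eq_def intro: ceq_sym)
  show "value_eq p q w w''" if "value_eq p q w w'" "value_eq p q w' w''" for p q w w' w''
    using that by (auto simp: value_eq_def intro: ceq_trans)
  show "value_eq p' q' (u @ whisker l w r @ v) (u @ whisker l w' r @ v)"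
    if w: "value_eq p q w w'" and u: "path p' u (l @ p @ r)" and v: "path (l @ q @ r) v q'"
    for p q w w' p' u l r v q'
  proof -
    have "ceq p' q' (stack (diagram_value u) (stack (whisk l (diagram_value w) r) (diagram_value v)))
        (stack (diagram_value u) (stack (whisk l (diagram_value w') r) (diagram_value v)))"
      using w by (intro ceq_stack_mid[OF ceq_whisk formal_sums_diagram[OF u] formal_sums_diagram[OF v]])
        (simp add: value_eq_def)
    then show ?thesis
      using w path_context[OF _ u v] by (simp add: value_eq_def diagram_value_append diagram_value_whisker)
  qed
  show "value_eq (inputs e @ m @ inputs e') (outputs e @ m @ outputs e')
      [([], e, m @ inputs e'), (outputs e @ m, e', [])] [(inputs e @ m, e', []), ([], e, m @ outputs e')]"
    for e e' m
    using ceq_interchange[OF formal_sums_event formal_sums_event, of e m e'] by (simp add: value_eq_def)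
  show "value_eq [s] [s] [([s], Cup (opp s), []), ([], Cap s, [s])] []" for s
    using deq_flat_cancel1[of s] by (simp add: value_eq_def)
  show "value_eq [s] [s] [([], Cup s, [s]), ([s], Cap (opp s), [])] []" for s
    using deq_flat_cancel2[of s] by (simp add: value_eq_def)
  show "value_eq [s, t] [s, t] [([], Cross c s t, []), ([], Cross (flip c) t s, [])] []" for s t c
    using crossing_sum_reidemeister2[of s t c] by (simp add: value_eq_def)
  show "value_eq [s, t, opp s] [t]
      [([s], Cross c t (opp s), []), ([], Cap s, [t])]
      [([], Cross (flip c) s t, [opp s]), ([t], Cap s, [])]" for s t c
    using crossing_sum_switch_max[of s t c] by (simp add: value_eq_def)
  show "value_eq [Up, Up, Up] [Up, Up, Up]
      [([], Cross SlashOver Up Up, [Up]), ([Up], Cross SlashOver Up Up, []),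
       ([], Cross SlashOver Up Up, [Up])]
      [([Up], Cross SlashOver Up Up, []), ([], Cross SlashOver Up Up, [Up]),
       ([Up], Cross SlashOver Up Up, [])]"
    using crossing_sum_braid by (simp add: value_eq_def)
qed

text \<open>
  The prescribed decorations of crossings of equal signs are equal to their normal forms, whatever
  representatives of the tensors are used.
\<close>

lemma decorated_positive:
  assumes "tensor_eq scale 2 z rho"
  shows "ceq [s, s] [s, s] (lin_ext (\<lambda>t. basis (decorated_crossing SlashOver s (t ! 0) (t ! 1))) z)
    (crossing_sum SlashOver s s)"
proof -
  let ?X = "basis [([], FCross s s, [])] :: 'a bead_event diagram \<Rightarrow>\<^sub>0 'k"
  have z: "z \<in> tensors 2"
    using assms by (rule tensor_eq_tensors)
  have "ceq [s, s] [s, s] (lin_ext (\<lambda>t. basis (decorated_crossing SlashOver s (t ! 0) (t ! 1))) z)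
      (stack (bead_sum [s, s] z) ?X)"
  proof (cases s)
    case Up
    have "lin_ext (\<lambda>t. basis (decorated_crossing SlashOver s (t ! 0) (t ! 1))) z = stack (bead_sum [s, s] z) ?X"
      unfolding Up bead_sum_def stack_lin_ext_left using z by (intro lin_ext_cong_2) simp_all
    then show ?thesis
      by (simp add: ceq_refl formal_sums_stack[OF formal_sums_bead_sum] formal_sums_path)
  next
    case Down
    have "lin_ext (\<lambda>t. basis (decorated_crossing SlashOver s (t ! 0) (t ! 1))) z =
        stack ?X (bead_sum [s, s] (tensor_swap z))"
      unfolding Down bead_sum_def tensor_swap_def stack_lin_ext_right lin_ext_lin_ext
      using z by (intro lin_ext_cong_2) simp_all
    then show ?thesis
      using bead_sum_swap[of "tensor_swap z" s s] z by simp
  qed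
  also have "ceq [s, s] [s, s] \<dots> (crossing_sum SlashOver s s)"
    unfolding crossing_sum_def using assms
    by (intro ceq_stack[where q = "[s, s]"] ceq_refl formal_sums_path bead_sum_tensor_eq[where n = 2])
      (simp_all add: crossing_tensor_def same_sign_tensor_def)
  finally show ?thesis .
qed

lemma decorated_negative:
  assumes "is_inverse scale rho z"
  shows "ceq [s, s] [s, s] (lin_ext (\<lambda>t. basis (decorated_crossing BackslashOver s (t ! 0) (t ! 1))) z)
    (crossing_sum BackslashOver s s)"
proof -
  let ?X = "basis [([], FCross s s, [])] :: 'a bead_event diagram \<Rightarrow>\<^sub>0 'k"
  have z: "z \<in> tensors 2"
    using assms by (simp add: is_inverse_def mutually_inverse_def)
  have "ceq [s, s] [s, s] (lin_ext (\<lambda>t. basis (decorated_crossing BackslashOver s (t ! 0) (t ! 1))) z)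
      (stack (bead_sum [s, s] (tensor_swap z)) ?X)"
  proof (cases s)
    case Up
    have "lin_ext (\<lambda>t. basis (decorated_crossing BackslashOver s (t ! 0) (t ! 1))) z =
        stack ?X (bead_sum [s, s] z)"
      unfolding Up bead_sum_def stack_lin_ext_right
      using z by (intro lin_ext_cong_2) simp_all
    then show ?thesis
      using bead_sum_swap[of z s s] z by simp
  next
    case Down
    have "lin_ext (\<lambda>t. basis (decorated_crossing BackslashOver s (t ! 0) (t ! 1))) z =
        stack (bead_sum [s, s] (tensor_swap z)) ?X"
      unfolding Down bead_sum_def tensor_swap_def stack_lin_ext_left lin_ext_lin_ext
      using z by (intro lin_ext_cong_2) simp_all
    then show ?thesis
      by (simp add: ceq_refl formal_sums_stack[OF formal_sums_bead_sum] formal_sums_path)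
  qed
  also have "ceq [s, s] [s, s] \<dots> (crossing_sum BackslashOver s s)"
    unfolding crossing_sum_def using tensor_eq_swap[OF inverse_unique[OF assms inverse]]
    by (intro ceq_stack[where q = "[s, s]"] ceq_refl formal_sums_path bead_sum_tensor_eq[where n = 2])
      (simp_all add: crossing_tensor_def same_sign_tensor_def)
  finally show ?thesis .
qed

text \<open>
  Independence of all choices: every decoration has the value \<open>diagram_value\<close>. For a mixed
  crossing this needs the invariance of \<open>diagram_value\<close> under the moves, by which both
  switchback rewritings have the value of the crossing.
\<close>

lemma decoration_diagram_value:
  assumes "decoration scale rho w x" "path p w q"
  shows "ceq p q x (diagram_value w)"
  using assms
proof (induction arbitrary: p)
  case empty
  then show ?case
    by (simp add: ceq_refl formal_sums_path)
next
  case (cup w x l s r)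
  then show ?case
    by (auto intro!: ceq_stack ceq_refl formal_sums_path)
next
  case (cap w x l s r)
  then show ?case
    by (auto intro!: ceq_stack ceq_refl formal_sums_path)
next
  case (positive w x z l s r)
  then show ?case
    using ceq_whisk[OF decorated_positive[OF positive.hyps(2), of s], of l r]
    by (auto simp: in_context_lin_ext intro!: ceq_stack)
next
  case (negative w x z l s r)
  then show ?case
    using ceq_whisk[OF decorated_negative[OF negative.hyps(2), of s], of l r]
    by (auto simp: in_context_lin_ext intro!: ceq_stack)
next
  case (mixed l c s t r w x)
  have p: "p = l @ [s, opp s] @ r" and w: "path (l @ [opp s, s] @ r) w q"
    using mixed.prems by simp_all
  have "value_eq [s, opp s] [opp s, s] (switchback c s t) [([], Cross c s (opp s), [])]"
    by (rule E_switchback) (cases s; cases t; simp)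
  from E_context[OF this, of p "[]" l r w q]
  have "value_eq p q (whisker l (switchback c s t) r @ w) ((l, Cross c s (opp s), r) # w)"
    using w by (simp add: p)
  then show ?case
    using mixed.IH ceq_trans unfolding value_eq_def by blast
qed

lemma decoration_exists: "path p w q \<Longrightarrow> \<exists>x. decoration scale rho w x"
proof (induction w arbitrary: p)
  case Nil
  then show ?case
    using decoration.empty by blast
next
  case (Cons y w)
  obtain l e r where y: "y = (l, e, r)"
    by (cases y)
  obtain x where x: "decoration scale rho w x"
    using Cons by (auto simp: y)
  have same: "\<exists>x. decoration scale rho ((l, Cross c s s, r) # w) x" if "decoration scale rho w x" for w x l c s r
  proof (cases c)
    case SlashOver
    then show ?thesis
      using decoration.positive[OF that tensor_eq_refl[OF rho]] by blast
  next
    case BackslashOver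
    then show ?thesis
      using decoration.negative[OF that inverse] by blast
  qed
  show ?case
  proof (cases e)
    case (Cup s)
    then show ?thesis
      using decoration.cup[OF x] y by blast
  next
    case (Cap s)
    then show ?thesis
      using decoration.cap[OF x] y by blast
  next
    case (Cross c s t)
    show ?thesis
    proof (cases "t = s")
      case True
      then show ?thesis
        using same[OF x] Cross y by blast
    next
      case False
      then have t: "t = opp s"
        by (cases s; cases t) simp_all
      have "\<exists>x. decoration scale rho (whisker l (switchback c s s) r @ w) x"
        using same[OF decoration.cap[OF x]] decoration.cup by (fastforce simp: switchback_def)
      then show ?thesis
        using decoration.mixed Cross y t by blast
    qed
  qed
qed

lemma decoration_append:
  "decoration scale rho u x \<Longrightarrow> decoration scale rho v y \<Longrightarrow> decoration scale rho (u @ v) (stack x y)"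
proof (induction rule: decoration.induct)
  case (mixed l c s t r w x)
  then show ?case
    using decoration.mixed[of scale rho l c s t r "w @ v"] by simp
next
  case (positive w x z l s r)
  then show ?case
    using decoration.positive[of scale rho "w @ v" "stack x y" z l s r] by (simp add: stack_assoc)
next
  case (negative w x z l s r)
  then show ?case
    using decoration.negative[of scale rho "w @ v" "stack x y" z l s r] by (simp add: stack_assoc)
qed (simp_all add: stack_assoc decoration.empty decoration.cup decoration.cap)

lemma decoration_isotopic:
  assumes "regularly_isotopic p q w w'" "decoration scale rho w x" "decoration scale rho w' x'"
  shows "ceq p q x x'"
proof -
  have "value_eq p q w w'"
    by (rule E_regularly_isotopic[OF assms(1)])
  then have w: "path p w q" "path p w' q" "ceq p q (diagram_value w) (diagram_value w')"
    by (simp_all add: value_eq_def)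
  show ?thesis
    using decoration_diagram_value[OF assms(2) w(1)] w(3) ceq_sym[OF decoration_diagram_value[OF assms(3) w(2)]]
    by (meson ceq_trans)
qed

end

section \<open>Quotient categories\<close>

text \<open>
  Both categories arise from strictly associative and unital compositions of representatives by a
  congruence.
\<close>

locale composition_congruence =
  fixes M :: "'o \<Rightarrow> 'o \<Rightarrow> 'x set" and E :: "'o \<Rightarrow> 'o \<Rightarrow> ('x \<times> 'x) set"
    and one :: 'x and comp :: "'x \<Rightarrow> 'x \<Rightarrow> 'x"
  assumes equiv: "equiv (M p q) (E p q)"
    and one: "one \<in> M p p"
    and comp_cong: "(x, x') \<in> E p q \<Longrightarrow> (y, y') \<in> E q r \<Longrightarrow> (comp x y, comp x' y') \<in> E p r"
    and comp_assoc: "comp (comp x y) z = comp x (comp y z)"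
    and comp_one: "comp one x = x" "comp x one = x"
begin

definition quotient_category :: "('o, 'x set) category_data" where
  "quotient_category = \<lparr>
     Ob = UNIV,
     Hom = (\<lambda>p q. M p q // E p q),
     Ident = (\<lambda>p. E p p `` {one}),
     Comp = (\<lambda>p q r Y X. \<Union>x\<in>X. \<Union>y\<in>Y. E p r `` {comp x y})\<rparr>"

lemma E_iff: "x \<in> M p q \<Longrightarrow> (x, x) \<in> E p q" "(x, y) \<in> E p q \<Longrightarrow> x \<in> M p q"
  using equiv[of p q] by (auto simp: equiv_def refl_on_def)

lemma comp_closed: "x \<in> M p q \<Longrightarrow> y \<in> M q r \<Longrightarrow> comp x y \<in> M p r"
  using comp_cong E_iff by blast

lemma Comp_classes:
  assumes "x \<in> M p q" "y \<in> M q r"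
  shows "Comp quotient_category p q r (E q r `` {y}) (E p q `` {x}) = E p r `` {comp x y}"
proof -
  have same: "E p r `` {comp x' y'} = E p r `` {comp x y}" if "x' \<in> E p q `` {x}" "y' \<in> E q r `` {y}" for x' y'
    using equiv_class_eq[OF equiv comp_cong, of x x' p q y y' r] that by simp
  have "Comp quotient_category p q r (E q r `` {y}) (E p q `` {x}) =
      (\<Union>x'\<in>E p q `` {x}. \<Union>y'\<in>E q r `` {y}. E p r `` {comp x' y'})"
    by (simp add: quotient_category_def)
  also have "\<dots> = (\<Union>x'\<in>E p q `` {x}. \<Union>y'\<in>E q r `` {y}. E p r `` {comp x y})"
    by (intro SUP_cong same) simp_all
  also have "\<dots> = E p r `` {comp x y}"
    using E_iff(1)[OF assms(1)] E_iff(1)[OF assms(2)] by blast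
  finally show ?thesis .
qed

lemma is_category_quotient: "is_category quotient_category"
proof -
  have Hom: "(\<forall>X\<in>Hom quotient_category p q. P X) \<longleftrightarrow> (\<forall>x\<in>M p q. P (E p q `` {x}))" for p q P
    by (auto simp: quotient_category_def quotient_def)
  have Hom_class: "x \<in> M p q \<Longrightarrow> E p q `` {x} \<in> Hom quotient_category p q" for x p q
    by (simp add: quotient_category_def quotientI)
  have Ident: "Ident quotient_category p = E p p `` {one}" for p
    by (simp add: quotient_category_def)
  have "Comp quotient_category p r s (E r s `` {z}) (Comp quotient_category p q r (E q r `` {y}) (E p q `` {x})) =
      Comp quotient_category p q s (Comp quotient_category q r s (E r s `` {z}) (E q r `` {y})) (E p q `` {x})"
    if "x \<in> M p q" "y \<in> M q r" "z \<in> M r s" for p q r s x y z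
    using that comp_closed[of x p q y r] comp_closed[of y q r z s] by (simp only: Comp_classes comp_assoc)
  moreover have "Comp quotient_category p q r (E q r `` {y}) (E p q `` {x}) \<in> Hom quotient_category p r"
    if "x \<in> M p q" "y \<in> M q r" for p q r x y
    using that comp_closed[OF that] by (simp only: Comp_classes Hom_class)
  moreover have "Comp quotient_category p p q (E p q `` {x}) (E p p `` {one}) = E p q `` {x} \<and>
      Comp quotient_category p q q (E q q `` {one}) (E p q `` {x}) = E p q `` {x}" if "x \<in> M p q" for p q x
    using that one by (simp only: Comp_classes comp_one)
  ultimately show ?thesis
    unfolding is_category_def Hom Ident using Hom_class[OF one] by blast
qed

end

lemma regularly_isotopic_diagrams:
  "regularly_isotopic p q w w' \<Longrightarrow> w \<in> diagrams p q \<and> w' \<in> diagrams p q"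
  by (induction rule: regularly_isotopic.induct) auto

lemma regularly_isotopic_context:
  assumes "regularly_isotopic p q w w'" "path p' u p" "path q v q'"
  shows "regularly_isotopic p' q' (u @ w @ v) (u @ w' @ v)"
  using assms(1)
proof induction
  case (refl w)
  then show ?case
    using assms(2,3) by (intro regularly_isotopic.refl) (auto simp: diagrams_def path_append)
next
  case (sym w w')
  then show ?case
    by (blast intro: regularly_isotopic.sym)
next
  case (trans w w' w'')
  then show ?case
    by (blast intro: regularly_isotopic.trans)
next
  case (move w w' u1 l r v1)
  then show ?case
    using regularly_isotopic.move[OF move(1), of "u @ u1" l r "v1 @ v" p' q'] assms(2,3)
    by (auto simp: diagrams_def path_append)
qed

lemma composition_congruence_Tang:
  "composition_congruence diagrams (\<lambda>p q. {(w, w'). regularly_isotopic p q w w'}) [] (@)"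
proof
  show "equiv (diagrams p q) {(w, w'). regularly_isotopic p q w w'}" for p q
    using regularly_isotopic_diagrams
    by (intro equivI refl_onI symI transI)
      (blast intro: regularly_isotopic.refl regularly_isotopic.sym regularly_isotopic.trans)+
  show "(x @ y, x' @ y') \<in> {(w, w'). regularly_isotopic p r w w'}"
    if "(x, x') \<in> {(w, w'). regularly_isotopic p q w w'}" "(y, y') \<in> {(w, w'). regularly_isotopic q r w w'}"
    for x x' p q y y' r
  proof -
    have x: "regularly_isotopic p q x x'" and y: "regularly_isotopic q r y y'"
      using that by simp_all
    have "regularly_isotopic p r ([] @ x @ y) ([] @ x' @ y)"
      using regularly_isotopic_diagrams[OF y] by (intro regularly_isotopic_context[OF x]) (simp_all add: diagrams_def)
    moreover have "regularly_isotopic p r (x' @ y @ []) (x' @ y' @ [])"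
      using regularly_isotopic_diagrams[OF x] by (intro regularly_isotopic_context[OF y]) (simp_all add: diagrams_def)
    ultimately show ?thesis
      using regularly_isotopic.trans by fastforce
  qed
qed (simp_all add: diagrams_def)

context bead_calculus
begin

lemma composition_congruence_Cat:
  "composition_congruence formal_sums (\<lambda>p q. {(x, y). ceq p q x y}) (basis []) stack"
proof
  show "equiv (formal_sums p q) {(x, y). ceq p q x y}" for p q
    by (intro equivI refl_onI symI transI) (blast intro: ceq_refl ceq_sym ceq_trans ceq_sums)+
  show "basis [] \<in> formal_sums p p" for p
    by (simp add: formal_sums_basis diagrams_def)
qed (auto intro: ceq_stack simp: stack_assoc)

end

context oriented_quantum
begin

interpretation Tang: composition_congruence diagrams "\<lambda>p q. {(w, w'). regularly_isotopic p q w w'}" "[]" "(@)"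
  by (rule composition_congruence_Tang)

interpretation Cat: composition_congruence formal_sums "\<lambda>p q. {(x, y). ceq p q x y}" "basis []" stack
  by (rule composition_congruence_Cat)

lemma Tang_quotient: "Tang = Tang.quotient_category"
  by (simp add: Tang_def Tang.quotient_category_def tangle_class_def Image_def)

lemma Cat_quotient: "Cat scale D U = Cat.quotient_category"
  by (simp add: Cat_def Cat.quotient_category_def cat_class_def Image_def)

text \<open>The union defining the functor runs over equal classes only, by \<open>decoration_isotopic\<close>.\<close>

lemma tangle_functor_class:
  assumes "w \<in> diagrams p q" "decoration scale rho w x"
  shows "tangle_functor scale rho D U p q (tangle_class p q w) = cat_class scale D U p q x"
proof -
  have "cat_class scale D U p q x' = cat_class scale D U p q x"
    if "w' \<in> tangle_class p q w" "decoration scale rho w' x'" for w' x'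
  proof -
    have "ceq p q x x'"
      using that assms by (intro decoration_isotopic[of p q w w']) (simp_all add: tangle_class_def)
    then show ?thesis
      unfolding cat_class_def using ceq_sym ceq_trans by blast
  qed
  moreover have "w \<in> tangle_class p q w"
    using assms by (simp add: tangle_class_def regularly_isotopic.refl)
  ultimately show ?thesis
    unfolding tangle_functor_def using assms(2) by blast
qed

lemma is_functor_tangle_functor: "is_functor Tang (Cat scale D U) (\<lambda>p. p) (tangle_functor scale rho D U)"
proof -
  let ?F = "tangle_functor scale rho D U"
  have Tang_Hom: "\<exists>w x. w \<in> diagrams p q \<and> X = tangle_class p q w \<and> decoration scale rho w x"
    if "X \<in> Hom Tang p q" for p q X
    using that decoration_exists
    by (fastforce simp: Tang_def quotient_def tangle_class_def Image_def diagrams_def)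
  have Cat_Hom: "cat_class scale D U p q x \<in> Hom (Cat scale D U) p q" if "x \<in> formal_sums p q" for p q x
    using that by (auto simp: Cat_def quotient_def cat_class_def Image_def)
  have sums: "x \<in> formal_sums p q" if "w \<in> diagrams p q" "decoration scale rho w x" for p q w x
    using ceq_sums(1)[OF decoration_diagram_value[OF that(2)]] that(1) by (simp add: diagrams_def)
  have "?F p q X \<in> Hom (Cat scale D U) p q" if X: "X \<in> Hom Tang p q" for p q X
    using Tang_Hom[OF X] sums by (auto simp: tangle_functor_class Cat_Hom)
  moreover have "?F p p (Ident Tang p) = Ident (Cat scale D U) p" for p
    using tangle_functor_class[OF _ decoration.empty, of p p] by (simp add: Tang_def Cat_def diagrams_def)
  moreover have "?F p r (Comp Tang p q r Y X) = Comp (Cat scale D U) p q r (?F q r Y) (?F p q X)"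
    if X: "X \<in> Hom Tang p q" and Y: "Y \<in> Hom Tang q r" for p q r X Y
  proof -
    obtain u x where u: "u \<in> diagrams p q" "X = tangle_class p q u" "decoration scale rho u x"
      using Tang_Hom[OF X] by blast
    obtain v y where v: "v \<in> diagrams q r" "Y = tangle_class q r v" "decoration scale rho v y"
      using Tang_Hom[OF Y] by blast
    have "Comp Tang p q r Y X = tangle_class p r (u @ v)"
      using Tang.Comp_classes[OF u(1) v(1)] by (simp add: Tang_quotient u(2) v(2) tangle_class_def Image_def)
    moreover have "u @ v \<in> diagrams p r"
      using Tang.comp_closed[OF u(1) v(1)] .
    moreover have "Comp (Cat scale D U) p q r (cat_class scale D U q r y) (cat_class scale D U p q x) =
        cat_class scale D U p r (stack x y)"
      using Cat.Comp_classes[OF sums[OF u(1,3)] sums[OF v(1,3)]]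
      by (simp add: Cat_quotient cat_class_def Image_def)
    ultimately show ?thesis
      using u v decoration_append[OF u(3) v(3)] by (simp add: tangle_functor_class)
  qed
  moreover have "is_category Tang" "is_category (Cat scale D U)"
    unfolding Tang_quotient Cat_quotient by (rule Tang.is_category_quotient Cat.is_category_quotient)+
  moreover have "Ob (Cat scale D U) = UNIV"
    by (simp add: Cat_def)
  ultimately show ?thesis
    unfolding is_functor_def by simp
qed

end

section \<open>Well-definedness and functoriality\<close>

theorem mainTheorem1:
  fixes scale :: "'k::{comm_ring,comm_monoid_mult} \<Rightarrow> 'a::{ring,monoid_mult} \<Rightarrow> 'a"
    and rho :: "'a list \<Rightarrow>\<^sub>0 'k"
    and D U :: "'a \<Rightarrow> 'a"
  assumes "oriented_quantum_algebra scale rho D U"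
  shows "(\<forall>p q. \<forall>Q\<in>diagrams p q. \<exists>x. decoration scale rho Q x) \<and>
    (\<forall>p q Q Q' x x'. regularly_isotopic p q Q Q' \<and>
        decoration scale rho Q x \<and> decoration scale rho Q' x' \<longrightarrow>
        cat_eq scale D U p q x x') \<and>
    (\<forall>p q Q x. Q \<in> diagrams p q \<and> decoration scale rho Q x \<longrightarrow>
        tangle_functor scale rho D U p q (tangle_class p q Q) = cat_class scale D U p q x) \<and>
    is_functor Tang (Cat scale D U) (\<lambda>p. p) (tangle_functor scale rho D U)"
proof -
  obtain rinv where "oriented_quantum scale D U rho rinv"
    using assms unfolding oriented_quantum_algebra_def oriented_quantum_def by blast
  then interpret oriented_quantum scale D U rho rinv .
  show ?thesis
    using decoration_exists decoration_isotopic tangle_functor_class is_functor_tangle_functor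
    by (auto simp: diagrams_def)
qed

end
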